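(* Let $\alpha>-1$ and $S_0>0$. Suppose that $(V,P)\in C^1_{loc}(\mathbb{R}^{3+1})$, with $V=V(y,s)$ valued in $\mathbb{R}^3$ and $P=P(y,s)$ scalar, is a time periodic solution with period $S_0$ (in $s$) of the system $$\frac{\partial V}{\partial s}+\frac{\alpha}{\alpha+1}V+\frac{1}{\alpha+1}(y\cdot\nabla)V+(V\cdot\nabla)V=-\nabla P,\qquad \operatorname{div}V=0\qquad\text{in }\mathbb{R}^3\times\mathbb{R},$$ that the pressure $P$ is given by $$P(y,s)=-\frac{|V(y,s)|^2}{3}+\sum_{i,j=1}^3\mathrm{p.v.}\!\int_{\mathbb{R}^3}K_{ij}(y-z)\,V_i(z,s)V_j(z,s)\,dz,\qquad K_{ij}(y)=\frac{3y_iy_j-\delta_{ij}|y|^2}{4\pi|y|^5},$$ and that $V$ satisfies, for some $3\le r\le 9/2$, one of the following conditions: (i) $\alpha>3/2$ and $V\in L^3(0,S_0;L^r(\mathbb{R}^3))$; or (ii) $-1<\alpha<3/2$ and $V\in L^2(0,S_0;L^2(\mathbb{R}^3))\cap L^3(0,S_0;L^r(\mathbb{R}^3))$. Then $V=0$ on $\mathbb{R}^{3+1}$.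
   Context: Here $(y,s)\in\mathbb{R}^3\times\mathbb{R}=\mathbb{R}^{3+1}$; $\nabla$ and $\operatorname{div}$ are taken with respect to $y$. $C^1_{loc}(\mathbb{R}^{3+1})$ denotes functions continuously differentiable in $(y,s)$ (no global bounds assumed). Time periodic with period $S_0$ means $(V,P)(y,s+S_0)=(V,P)(y,s)$ for all $(y,s)$. $\delta_{ij}$ is the Kronecker delta, and $\mathrm{p.v.}\!\int$ denotes the principal value $\lim_{\varepsilon\to0^+}\int_{|y-z|>\varepsilon}$. (The system is the self-similar form of the 3D incompressible Euler equations, and $s$-periodic solutions correspond to discretely self-similar Euler solutions.) *)

theory Defs
  imports "HOL-Analysis.Analysis"
begin

text \<open>
  Space-time fields are functions on \<open>(real^3) \<times> real\<close>; the pair is \<open>(y, s)\<close>.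
\<close>

definition C1_on_space :: "('a::real_normed_vector \<Rightarrow> 'b::real_normed_vector) \<Rightarrow> bool" where
  "C1_on_space f \<longleftrightarrow>
     (\<exists>f' :: 'a \<Rightarrow> 'a \<Rightarrow>\<^sub>L 'b.
        (\<forall>x. (f has_derivative blinfun_apply (f' x)) (at x)) \<and> continuous_on UNIV f')"

definition time_deriv :: "((real^3) \<times> real \<Rightarrow> 'b::real_normed_vector) \<Rightarrow> (real^3) \<times> real \<Rightarrow> 'b" where
  "time_deriv f = (\<lambda>(y, s). vector_derivative (\<lambda>t. f (y, t)) (at s))"

text \<open>\<open>dir_deriv a f (y, s)\<close> is \<open>(a \<cdot> \<nabla>) f\<close> at \<open>(y, s)\<close>, differentiating in \<open>y\<close> only.\<close>

definition dir_deriv ::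
    "real^3 \<Rightarrow> ((real^3) \<times> real \<Rightarrow> 'b::real_normed_vector) \<Rightarrow> (real^3) \<times> real \<Rightarrow> 'b" where
  "dir_deriv a f = (\<lambda>(y, s). frechet_derivative (\<lambda>z. f (z, s)) (at y) a)"

definition space_grad :: "((real^3) \<times> real \<Rightarrow> real) \<Rightarrow> (real^3) \<times> real \<Rightarrow> real^3" where
  "space_grad f x = (\<chi> i. dir_deriv (axis i 1) f x)"

definition space_div :: "((real^3) \<times> real \<Rightarrow> real^3) \<Rightarrow> (real^3) \<times> real \<Rightarrow> real" where
  "space_div V x = (\<Sum>i\<in>UNIV. dir_deriv (axis i 1) (\<lambda>x'. V x' $ i) x)"

definition solves_self_similar_Euler ::
    "real \<Rightarrow> ((real^3) \<times> real \<Rightarrow> real^3) \<Rightarrow> ((real^3) \<times> real \<Rightarrow> real) \<Rightarrow> bool" where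
  "solves_self_similar_Euler \<alpha> V P \<longleftrightarrow>
     (\<forall>y s. time_deriv V (y, s) + (\<alpha> / (\<alpha> + 1)) *\<^sub>R V (y, s)
              + (1 / (\<alpha> + 1)) *\<^sub>R dir_deriv y V (y, s)
              + dir_deriv (V (y, s)) V (y, s)
            = - space_grad P (y, s))
   \<and> (\<forall>y s. space_div V (y, s) = 0)"

definition time_periodic :: "real \<Rightarrow> ((real^3) \<times> real \<Rightarrow> 'b) \<Rightarrow> bool" where
  "time_periodic S f \<longleftrightarrow> (\<forall>y s. f (y, s + S) = f (y, s))"

definition pressure_kernel :: "3 \<Rightarrow> 3 \<Rightarrow> real^3 \<Rightarrow> real" where
  "pressure_kernel i j y =
     (3 * y $ i * y $ j - (if i = j then 1 else 0) * (norm y)\<^sup>2) / (4 * pi * norm y ^ 5)"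

text \<open>
  Principal value at the point \<open>y\<close>. Integrability of every truncation has to be required
  explicitly, because the Lebesgue integral of a non-integrable function is \<open>0\<close> by convention.
\<close>

definition has_pv_integral ::
    "('a::euclidean_space \<Rightarrow> real) \<Rightarrow> 'a \<Rightarrow> real \<Rightarrow> bool" where
  "has_pv_integral f y I \<longleftrightarrow>
     (\<forall>\<epsilon>>0. set_integrable lborel {z. norm (y - z) > \<epsilon>} f) \<and>
     ((\<lambda>\<epsilon>. LINT z:{z. norm (y - z) > \<epsilon>}|lborel. f z) \<longlongrightarrow> I) (at_right 0)"

definition pressure_given_by ::
    "((real^3) \<times> real \<Rightarrow> real^3) \<Rightarrow> ((real^3) \<times> real \<Rightarrow> real) \<Rightarrow> bool" where
  "pressure_given_by V P \<longleftrightarrow>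
     (\<forall>y s. \<exists>I :: 3 \<Rightarrow> 3 \<Rightarrow> real.
        (\<forall>i j. has_pv_integral (\<lambda>z. pressure_kernel i j (y - z) * V (z, s) $ i * V (z, s) $ j)
                  y (I i j)) \<and>
        P (y, s) = - (norm (V (y, s)))\<^sup>2 / 3 + (\<Sum>i\<in>UNIV. \<Sum>j\<in>UNIV. I i j))"

text \<open>
  The mixed Lebesgue space \<open>L\<^sup>p(0,T; L\<^sup>q)\<close> for finite exponents \<open>p, q > 0\<close>: the
  function is measurable, almost every time slice lies in \<open>L\<^sup>q\<close>, and the \<open>p\<close>-th power of the
  slice norm is integrable over \<open>(0,T)\<close>.
\<close>

definition Lq_norm :: "real \<Rightarrow> ('a::euclidean_space \<Rightarrow> 'b::euclidean_space) \<Rightarrow> real" where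
  "Lq_norm q f = (LINT y|lborel. norm (f y) powr q) powr (1 / q)"

definition in_Lp_Lq ::
    "real \<Rightarrow> real \<Rightarrow> real \<Rightarrow> ('a::euclidean_space \<times> real \<Rightarrow> 'b::euclidean_space) \<Rightarrow> bool" where
  "in_Lp_Lq p q T f \<longleftrightarrow>
     set_borel_measurable lborel (UNIV \<times> {0<..<T}) f \<and>
     (AE s in lborel. s \<in> {0<..<T} \<longrightarrow> integrable lborel (\<lambda>y. norm (f (y, s)) powr q)) \<and>
     set_integrable lborel {0<..<T} (\<lambda>s. Lq_norm q (\<lambda>y. f (y, s)) powr p)"

end

theory Submission
  imports Defs "HOL-Probability.Probability"
begin

text \<open>
  Testing the equation with \<open>V \<phi>\<^sub>R\<close>, where \<open>\<phi>\<^sub>R = (1 - |y|\<^sup>2/R\<^sup>2)\<^sub>+\<^sup>2\<close>, and integrating over a period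
  gives \<open>(2\<alpha> - 3) A + B + (\<alpha> + 1) D = 0\<close>, where \<open>A = \<integral>\<integral> \<phi>\<^sub>R |V|\<^sup>2/2\<close>, \<open>B = \<integral>\<integral> (- y \<cdot> \<nabla>\<phi>\<^sub>R) |V|\<^sup>2/2 \<ge> 0\<close>
  and \<open>D = \<integral>\<integral> (- V \<cdot> \<nabla>\<phi>\<^sub>R) (|V|\<^sup>2/2 + P)\<close>. If \<open>\<alpha> > 3/2\<close>, then \<open>B\<close> has the good sign; if \<open>\<alpha> < 3/2\<close>, it
  tends to \<open>0\<close> as \<open>R \<rightarrow> \<infinity>\<close> because \<open>V\<close> is square integrable. The flux \<open>D\<close> is at most
  \<open>C \<integral>\<integral> |V|\<^sup>3 R/(R\<^sup>2 + |y|\<^sup>2)\<close>, which tends to \<open>0\<close> because \<open>r \<le> 9/2\<close>. Hence \<open>A\<close>, which increases with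
  \<open>R\<close>, vanishes.

  For the pressure part of the flux one needs
  \<open>|\<integral> h \<partial>\<^sub>a\<^sup>2\<Delta>\<^sup>-\<^sup>1 f| \<le> C \<integral> (|h|\<^sup>3 + f\<^bsup>3/2\<^esup>)\<close> for \<open>f \<ge> 0\<close>. Instead of Calderon-Zygmund theory
  we use that \<open>\<beta>(u, v) = (u\<^sup>2 + v)\<^bsup>3/2\<^esup>\<close> and \<open>\<beta>(u, v) \<plusminus> c u v\<close> are convex for \<open>v \<ge> 0\<close>. If \<open>u, v\<close> are the
  heat extensions of \<open>h, f\<close>, then by Jensen's inequality every additional Gaussian average in
  the direction \<open>a\<close> decreases \<open>\<integral> \<beta>(u, v)\<close> by at least \<open>c\<close> times the change of \<open>\<integral> u v\<close>, and the
  averages in the orthogonal directions do not increase it. Summing over infinitesimal time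
  steps, the changes of \<open>\<integral> u v\<close> add up to the singular integral. Off-diagonal kernels are
  differences of second derivatives in two diagonal directions.
\<close>

section \<open>A Bellman function\<close>

text \<open>The exponent 9/2 comes from scaling. The nonlocal pressure leaves the flux with a tail
  that decays only like R/|y|^2. The integral of the cube of this weight over R^3 does not depend on
  R, and the exponent dual to r/3 is at least 3 exactly when r <= 9/2. At r = 9/2 the resulting
  bound gains nothing as R grows; the decay is obtained by splitting off the tail of V.

  The Bellman function needs a nonnegative second argument, whereas V_i V_j changes sign. The bound
  is therefore applied to V_i V_j + |V|^2 and to |V|^2, and the results are subtracted. These
  products are cut off at twice the radius of the test function, because the flow argument needs
  compact support; the rest of the pressure is bounded by the size of the kernel alone.

  The flow produces the principal value minus one third of the identity. Summed over the diagonal,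
  this third is the term -|V|^2/3 of the pressure formula, so no local term is left over.\<close>

definition bellman :: "real \<Rightarrow> real \<Rightarrow> real" where
  "bellman u v = sqrt (u\<^sup>2 + v) ^ 3"

lemma bellman_nonneg: "0 \<le> v \<Longrightarrow> 0 \<le> bellman u v"
  by (simp add: bellman_def)

lemma cube_add_le:
  fixes a b :: real
  assumes "0 \<le> a" "0 \<le> b"
  shows "(a + b) ^ 3 \<le> 4 * (a ^ 3 + b ^ 3)"
proof -
  have "4 * (a ^ 3 + b ^ 3) - (a + b) ^ 3 = 3 * (a + b) * (a - b)\<^sup>2"
    by (simp add: power3_eq_cube power2_eq_square algebra_simps)
  also have "\<dots> \<ge> 0" using assms by simp
  finally show ?thesis by simp
qed

lemma bellman_le:
  assumes "0 \<le> v"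
  shows "bellman u v \<le> 4 * (\<bar>u\<bar> ^ 3 + sqrt v ^ 3)"
proof -
  have "sqrt (u\<^sup>2 + v) \<le> \<bar>u\<bar> + sqrt v"
    using sqrt_add_le_add_sqrt[of "u\<^sup>2" v] assms by simp
  then have "bellman u v \<le> (\<bar>u\<bar> + sqrt v) ^ 3"
    unfolding bellman_def using assms by (intro power_mono) auto
  also have "\<dots> \<le> 4 * (\<bar>u\<bar> ^ 3 + sqrt v ^ 3)"
    using assms by (intro cube_add_le) auto
  finally show ?thesis .
qed

text \<open>The right side is the convexity gap of \<open>bellman\<close> in the variables of the
  tangent inequality below, the left side bounds the mixed increment. The product
  \<open>a * d\<close> is split by the arithmetic-geometric mean inequality. What remains is a^2 (x
  + y): if \<open>x \<le> 2 * y\<close> it is comparable to y a^2, otherwise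
  \<open>d \<ge> x/2\<close> and the cube of \<open>x\<close> is absorbed, since
  \<open>a \<le> x + y\<close>.\<close>

lemma cubic_gap:
  fixes x y a d :: real
  assumes "0 \<le> x" "0 \<le> y" "0 \<le> a" "a \<le> x + y" "d = \<bar>x - y\<bar>"
  shows "(1/25) * (a * d * (x + y) + a\<^sup>2 * (x + y)) \<le> d\<^sup>2 * (x + y/2) + (3/2) * y * a\<^sup>2"
proof -
  have 1: "a * d * (x + y) \<le> (1/2) * (a\<^sup>2 + d\<^sup>2) * (x + y)"
  proof (rule mult_right_mono)
    show "a * d \<le> (1/2) * (a\<^sup>2 + d\<^sup>2)"
      using sum_squares_bound[of a d] by simp
  qed (use assms in simp)
  have d2: "d\<^sup>2 * (x + y) / 2 \<le> d\<^sup>2 * (x + y/2)"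
    using assms by (simp add: algebra_simps)
  \<comment> \<open>Of 25 copies of \<open>d\<^sup>2 * (x + y/2)\<close> one pays for the term in
    \<open>d2\<close>, and 24 remain. The tight case is \<open>x > 2 * y\<close>, which needs 81/16
    x^3 <= 6 x^3.\<close>
  have 2: "(3/2) * a\<^sup>2 * (x + y) \<le> 24 * (d\<^sup>2 * (x + y/2)) + 25 * ((3/2) * y * a\<^sup>2)"
  proof (cases "x \<le> 2 * y")
    case True
    have "a\<^sup>2 * (x + y) \<le> a\<^sup>2 * (3 * y)"
      using True by (intro mult_left_mono) auto
    moreover have "0 \<le> d\<^sup>2 * (x + y/2)" using assms by simp
    moreover have "0 \<le> y * a\<^sup>2" using assms by simp
    ultimately show ?thesis by (simp add: algebra_simps)
  next
    case False
    have dx: "x / 2 \<le> d" using False assms by simp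
    have "a \<le> 3/2 * x" using False assms by simp
    then have "a\<^sup>2 \<le> (3/2 * x)\<^sup>2" using assms by (intro power_mono) auto
    then have "a\<^sup>2 * (x + y) \<le> (3/2 * x)\<^sup>2 * (3/2 * x)"
      using False assms by (intro mult_mono) auto
    moreover have "(x/2)\<^sup>2 * x \<le> d\<^sup>2 * (x + y/2)"
      using dx assms by (intro mult_mono power_mono) auto
    moreover have "0 \<le> y * a\<^sup>2" using assms by simp
    moreover have "0 \<le> x * (x * x)" using assms by simp
    ultimately show ?thesis by (simp add: power2_eq_square algebra_simps)
  qed
  have "(1/25) * (a * d * (x + y) + a\<^sup>2 * (x + y))
      \<le> (1/25) * ((3/2) * a\<^sup>2 * (x + y) + d\<^sup>2 * (x + y) / 2)"
    using 1 by (simp add: field_simps)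
  also have "\<dots> \<le> d\<^sup>2 * (x + y/2) + (3/2) * y * a\<^sup>2"
  proof -
    have "1/25 * (p + q/2) \<le> r + t" if "p \<le> 24 * r + 25 * t" "q/2 \<le> r" for p q r t :: real
      using that by (simp add: field_simps)
    from this[OF 2 d2] show ?thesis .
  qed
  finally show ?thesis .
qed

text \<open>With \<open>x = sqrt (u\<^sup>2 + v)\<close>, \<open>y = sqrt (u0\<^sup>2 + v0)\<close> and \<open>a = u - u0\<close>, the
  gap between \<open>bellman\<close> and its tangent plane is \<open>(x - y)\<^sup>2 (x + y/2) + 3/2 y a\<^sup>2\<close>.\<close>

lemma bellman_tangent:
  assumes v: "0 \<le> v" and v0: "0 \<le> v0"
  shows "bellman u0 v0 + (3/2) * sqrt (u0\<^sup>2 + v0) * (2 * u0 * (u - u0) + (v - v0))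
           + (1/25) * \<bar>(u - u0) * (v - v0)\<bar> \<le> bellman u v"
proof -
  define x y where "x = sqrt (u\<^sup>2 + v)" and "y = sqrt (u0\<^sup>2 + v0)"
  define a where "a = u - u0"
  have x0: "0 \<le> x" and y0: "0 \<le> y" using v v0 by (auto simp: x_def y_def)
  have x2: "x\<^sup>2 = u\<^sup>2 + v" and y2: "y\<^sup>2 = u0\<^sup>2 + v0" using v v0 by (auto simp: x_def y_def)
  have ux: "\<bar>u\<bar> \<le> x" and uy: "\<bar>u0\<bar> \<le> y"
    unfolding x_def y_def using v v0 by (auto intro!: real_le_rsqrt)
  have gap: "bellman u v - bellman u0 v0 - (3/2) * y * (2 * u0 * a + (v - v0))
      = (x - y)\<^sup>2 * (x + y/2) + (3/2) * y * a\<^sup>2"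
  proof -
    have "2 * u0 * a + (v - v0) = x\<^sup>2 - y\<^sup>2 - a\<^sup>2"
      unfolding x2 y2 a_def by (simp add: power2_eq_square algebra_simps)
    moreover have "bellman u v = x ^ 3" "bellman u0 v0 = y ^ 3"
      by (simp_all add: bellman_def x_def y_def)
    ultimately show ?thesis
      by (simp only:) (simp add: power2_eq_square power3_eq_cube algebra_simps)
  qed
  have "\<bar>a * (v - v0)\<bar> \<le> \<bar>a\<bar> * \<bar>x - y\<bar> * (x + y) + \<bar>a\<bar>\<^sup>2 * (x + y)"
  proof -
    \<comment> \<open>Here \<open>v\<close> is eliminated through v = x^2 - u^2; the factor
      \<open>u + u0\<close> is then at most \<open>x + y\<close>.\<close>
    have "v - v0 = (x - y) * (x + y) - a * (u + u0)"
      using x2 y2 unfolding a_def by (simp add: power2_eq_square algebra_simps)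
    then have "\<bar>v - v0\<bar> \<le> \<bar>x - y\<bar> * (x + y) + \<bar>a\<bar> * (x + y)"
    proof -
      have "\<bar>(x - y) * (x + y) - a * (u + u0)\<bar> \<le> \<bar>x - y\<bar> * \<bar>x + y\<bar> + \<bar>a\<bar> * \<bar>u + u0\<bar>"
        by (metis abs_mult abs_triangle_ineq4)
      also have "\<dots> \<le> \<bar>x - y\<bar> * (x + y) + \<bar>a\<bar> * (x + y)"
        using x0 y0 ux uy by (intro add_mono mult_left_mono) auto
      finally show ?thesis using \<open>v - v0 = _\<close> by simp
    qed
    then have "\<bar>a\<bar> * \<bar>v - v0\<bar> \<le> \<bar>a\<bar> * (\<bar>x - y\<bar> * (x + y) + \<bar>a\<bar> * (x + y))"
      by (intro mult_left_mono) auto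
    then show ?thesis unfolding abs_mult by (simp only: power2_eq_square distrib_left mult.assoc)
  qed
  moreover have "(1/25) * (\<bar>a\<bar> * \<bar>x - y\<bar> * (x + y) + \<bar>a\<bar>\<^sup>2 * (x + y))
      \<le> \<bar>x - y\<bar>\<^sup>2 * (x + y/2) + (3/2) * y * \<bar>a\<bar>\<^sup>2"
    using x0 y0 ux uy by (intro cubic_gap) (auto simp: a_def)
  ultimately show ?thesis using gap unfolding a_def y_def by simp
qed

text \<open>A class closed under products, shift averages and \<open>bellman\<close>, on which all
  integrals of the flow argument are finite.\<close>

definition bdd_int :: "('a::euclidean_space \<Rightarrow> real) \<Rightarrow> bool" where
  "bdd_int u \<longleftrightarrow> integrable lborel u \<and> (\<exists>C. \<forall>x. \<bar>u x\<bar> \<le> C)"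

lemma bdd_int_integrable: "bdd_int u \<Longrightarrow> integrable lborel u"
  by (simp add: bdd_int_def)

lemma bdd_int_measurable [measurable_dest]: "bdd_int u \<Longrightarrow> u \<in> borel_measurable borel"
  using bdd_int_integrable borel_measurable_integrable by fastforce

lemma bdd_int_bounded:
  assumes "bdd_int u" obtains C where "C > 0" "\<And>x. \<bar>u x\<bar> \<le> C"
proof -
  from assms obtain C where C: "\<And>x. \<bar>u x\<bar> \<le> C" by (auto simp: bdd_int_def)
  have "\<bar>u x\<bar> \<le> \<bar>C\<bar> + 1" for x using C[of x] by linarith
  then show ?thesis using that[of "\<bar>C\<bar> + 1"] by simp
qed

lemma bdd_int_mult:
  assumes "bdd_int u" "bdd_int v"
  shows "bdd_int (\<lambda>x. u x * v x)"
proof -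
  obtain C where C: "C > 0" "\<And>x. \<bar>u x\<bar> \<le> C" using assms(1) bdd_int_bounded by blast
  obtain D where D: "D > 0" "\<And>x. \<bar>v x\<bar> \<le> D" using assms(2) bdd_int_bounded by blast
  have [measurable]: "u \<in> borel_measurable borel" "v \<in> borel_measurable borel"
    using assms by measurable
  have "integrable lborel (\<lambda>x. u x * v x)"
  proof (rule Bochner_Integration.integrable_bound)
    show "integrable lborel (\<lambda>x. C * v x)"
      using assms bdd_int_integrable by auto
    show "AE x in lborel. norm (u x * v x) \<le> norm (C * v x)"
      using C by (intro AE_I2) (auto simp: abs_mult intro!: mult_right_mono)
  qed simp
  moreover have "\<forall>x. \<bar>u x * v x\<bar> \<le> C * D"
    using C D by (auto simp: abs_mult intro!: mult_mono)
  ultimately show ?thesis unfolding bdd_int_def by blast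
qed

lemma bdd_int_bellman:
  assumes "bdd_int u" "bdd_int v" "\<And>x. 0 \<le> v x"
  shows "bdd_int (\<lambda>x. bellman (u x) (v x))"
proof -
  obtain C where C: "C > 0" "\<And>x. \<bar>u x\<bar> \<le> C" using assms(1) bdd_int_bounded by blast
  obtain D where D: "D > 0" "\<And>x. \<bar>v x\<bar> \<le> D" using assms(2) bdd_int_bounded by blast
  have [measurable]: "u \<in> borel_measurable borel" "v \<in> borel_measurable borel"
    using assms by measurable
  have eq: "bellman (u x) (v x) = sqrt ((u x)\<^sup>2 + v x) * (u x * u x + v x)" for x
    using assms(3)[of x] unfolding bellman_def
    by (simp add: power3_eq_cube power2_eq_square)
  have s: "sqrt ((u x)\<^sup>2 + v x) \<le> sqrt (C\<^sup>2 + D)" for x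
  proof -
    have "\<bar>u x\<bar>\<^sup>2 \<le> C\<^sup>2" using C by (intro power_mono) auto
    moreover have "v x \<le> D" using D(2)[of x] by linarith
    ultimately show ?thesis by simp
  qed
  have "integrable lborel (\<lambda>x. bellman (u x) (v x))"
  proof (rule Bochner_Integration.integrable_bound)
    show "integrable lborel (\<lambda>x. sqrt (C\<^sup>2 + D) * (u x * u x + v x))"
      using bdd_int_integrable[OF bdd_int_mult[OF assms(1,1)]] bdd_int_integrable[OF assms(2)]
      by (intro integrable_mult_right Bochner_Integration.integrable_add)
    show "AE x in lborel. norm (bellman (u x) (v x)) \<le> norm (sqrt (C\<^sup>2 + D) * (u x * u x + v x))"
      unfolding eq using s assms(3) D by (intro AE_I2) (auto simp: abs_mult intro!: mult_right_mono)
    show "(\<lambda>x. bellman (u x) (v x)) \<in> borel_measurable lborel"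
      unfolding bellman_def by measurable
  qed
  moreover have "\<bar>bellman (u x) (v x)\<bar> \<le> sqrt (C\<^sup>2 + D) ^ 3" for x
    using assms(3)[of x] s[of x] unfolding bellman_def by (simp add: power_mono)
  ultimately show ?thesis unfolding bdd_int_def by blast
qed

lemma lborel_translate:
  fixes f :: "'a::euclidean_space \<Rightarrow> 'b::{banach, second_countable_topology}"
  assumes [measurable]: "f \<in> borel_measurable borel"
  shows "integrable lborel (\<lambda>x. f (x + w)) \<longleftrightarrow> integrable lborel f"
    and "(LBINT x. f (x + w)) = (LBINT x. f x)"
proof -
  have eq: "distr lborel borel (\<lambda>x. x + w) = lborel"
    using lborel_distr_plus[of w] by (simp add: add.commute[of _ w])
  show "integrable lborel (\<lambda>x. f (x + w)) \<longleftrightarrow> integrable lborel f"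
    using integrable_distr_eq[of "\<lambda>x. x + w" lborel borel f] eq by simp
  show "(LBINT x. f (x + w)) = (LBINT x. f x)"
    using integral_distr[of "\<lambda>x. x + w" lborel borel f] eq by simp
qed

lemma lborel_reflect:
  fixes f :: "'a::euclidean_space \<Rightarrow> 'b::{banach, second_countable_topology}"
  assumes [measurable]: "f \<in> borel_measurable borel"
  shows "integrable lborel (\<lambda>x. f (w - x)) \<longleftrightarrow> integrable lborel f"
    and "(LBINT x. f (w - x)) = (LBINT x. f x)"
proof -
  have eq: "distr lborel borel (\<lambda>x::'a. w - x) = lborel"
    using lborel_affine[of "-1::real" w] by (simp add: density_1)
  show "integrable lborel (\<lambda>x. f (w - x)) \<longleftrightarrow> integrable lborel f"
    using integrable_distr_eq[of "\<lambda>x. w - x" lborel borel f] eq by simp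
  show "(LBINT x. f (w - x)) = (LBINT x. f x)"
    using integral_distr[of "\<lambda>x. w - x" lborel borel f] eq by simp
qed

section \<open>Averages over random shifts and Jensen's inequality\<close>

definition avg :: "'a::euclidean_space measure \<Rightarrow> ('a \<Rightarrow> real) \<Rightarrow> 'a \<Rightarrow> real" where
  "avg M u x = (LINT w|M. u (x - w))"

locale shift_prob = prob_space M for M :: "'a::euclidean_space measure" +
  assumes sets_M [measurable_cong]: "sets M = sets borel"
begin

lemma bdd_int_shift_integrable:
  assumes "bdd_int u"
  shows "integrable M (\<lambda>w. u (x - w))"
proof -
  have [measurable]: "u \<in> borel_measurable borel" using assms by measurable
  obtain C where "\<And>x. \<bar>u x\<bar> \<le> C" using assms bdd_int_bounded by blast
  then show ?thesis by (intro integrable_const_bound[where B=C]) auto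
qed

lemma pair_integrable:
  assumes "bdd_int u"
  shows "integrable (M \<Otimes>\<^sub>M lborel) (\<lambda>(w, x). u (x - w))"
proof -
  have [measurable]: "u \<in> borel_measurable borel" using assms by measurable
  interpret P: pair_sigma_finite M lborel
    by (intro pair_sigma_finite.intro sigma_finite_measure_axioms sigma_finite_lborel)
  have n: "integrable lborel (\<lambda>x. \<bar>u x\<bar>)" using assms bdd_int_integrable by auto
  show ?thesis
  proof (rule P.Fubini_integrable)
    have "(LBINT x. \<bar>u (x - w)\<bar>) = (LBINT x. \<bar>u x\<bar>)" for w
      using lborel_translate(2)[of "\<lambda>x. \<bar>u x\<bar>" "- w"] by simp
    then show "integrable M (\<lambda>x. LBINT y. norm (case (x, y) of (w, x) \<Rightarrow> u (x - w)))"
      by simp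
    show "AE x in M. integrable lborel (\<lambda>y. case (x, y) of (w, x) \<Rightarrow> u (x - w))"
      using lborel_translate(1)[of u "- w" for w] assms bdd_int_integrable by (intro AE_I2) auto
  qed measurable
qed

lemma bdd_int_avg:
  assumes "bdd_int u"
  shows "bdd_int (avg M u)" and "(LBINT x. avg M u x) = (LBINT x. u x)"
proof -
  have [measurable]: "u \<in> borel_measurable borel" using assms by measurable
  interpret P: pair_sigma_finite M lborel
    by (intro pair_sigma_finite.intro sigma_finite_measure_axioms sigma_finite_lborel)
  note I = pair_integrable[OF assms]
  have 1: "integrable lborel (avg M u)"
    using P.integrable_snd[OF I] by (simp add: avg_def[abs_def])
  obtain C where C: "C > 0" "\<And>x. \<bar>u x\<bar> \<le> C" using assms bdd_int_bounded by blast
  have "\<bar>avg M u x\<bar> \<le> C" for x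
  proof -
    have "\<bar>avg M u x\<bar> \<le> (LINT w|M. \<bar>u (x - w)\<bar>)"
      unfolding avg_def by (rule integral_abs_bound)
    also have "\<dots> \<le> (LINT w|M. C)"
      using bdd_int_shift_integrable[OF assms] C by (intro integral_mono) auto
    finally show ?thesis by (simp add: prob_space)
  qed
  with 1 show "bdd_int (avg M u)" unfolding bdd_int_def by blast
  have "(LINT x|lborel. avg M u x) = (LINT w|M. LINT x|lborel. u (x - w))"
    using P.Fubini_integral[OF I] by (simp add: avg_def[abs_def])
  also have "\<dots> = (LINT w|M. LINT x|lborel. u x)"
    using lborel_translate(2)[of u "- w" for w] by simp
  finally show "(LBINT x. avg M u x) = (LBINT x. u x)"
    by (simp add: prob_space)
qed

lemma avg_nonneg: "(\<And>x. 0 \<le> v x) \<Longrightarrow> 0 \<le> avg M v x"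
  unfolding avg_def by (rule integral_nonneg_AE) simp

text \<open>Jensen with a remainder: the tangent inequality at the averaged point is integrated over
  the shift. The linear terms cancel, and the product of the deviations integrates to the covariance
  of \<open>u\<close> and \<open>v\<close>. A sign \<open>\<sigma>\<close> in place of the absolute
  value keeps that term linear.\<close>

lemma bellman_avg_pointwise:
  assumes u: "bdd_int u" and v: "bdd_int v" and v0: "\<And>x. 0 \<le> v x" and \<sigma>: "\<bar>\<sigma>\<bar> = 1"
  shows "bellman (avg M u x) (avg M v x)
           + \<sigma>/25 * (avg M (\<lambda>x. u x * v x) x - avg M u x * avg M v x)
         \<le> avg M (\<lambda>x. bellman (u x) (v x)) x"
proof -
  define U W where "U = avg M u x" and "W = avg M v x"
  define s where "s = sqrt (U\<^sup>2 + W)"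
  have W0: "0 \<le> W" unfolding W_def by (rule avg_nonneg) (rule v0)
  note [simp] = bdd_int_shift_integrable[OF u] bdd_int_shift_integrable[OF v]
    bdd_int_shift_integrable[OF bdd_int_mult[OF u v]]
  have pt: "bellman U W + (3/2) * s * (2 * U * (u (x - w) - U) + (v (x - w) - W))
      + \<sigma>/25 * (u (x - w) * v (x - w) - U * v (x - w) - W * u (x - w) + U * W)
      \<le> bellman (u (x - w)) (v (x - w))" for w
  proof -
    have "\<sigma> * ((u (x - w) - U) * (v (x - w) - W)) \<le> \<bar>(u (x - w) - U) * (v (x - w) - W)\<bar>"
      using \<sigma> by (metis abs_ge_self abs_mult mult_1)
    then show ?thesis
      using bellman_tangent[OF v0[of "x - w"] W0, of U "u (x - w)"] unfolding s_def
      by (simp add: algebra_simps)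
  qed
  have "bellman U W + \<sigma>/25 * (avg M (\<lambda>x. u x * v x) x - U * W)
      = (LINT w|M. bellman U W + (3/2) * s * (2 * U * (u (x - w) - U) + (v (x - w) - W))
      + \<sigma>/25 * (u (x - w) * v (x - w) - U * v (x - w) - W * u (x - w) + U * W))"
  proof -
    have "(LINT w|M. u (x - w) * v (x - w)) = avg M (\<lambda>x. u x * v x) x"
      "(LINT w|M. u (x - w)) = U" "(LINT w|M. v (x - w)) = W"
      by (simp_all add: avg_def U_def W_def)
    then show ?thesis by (simp add: prob_space field_simps)
  qed
  also have "\<dots> \<le> (LINT w|M. bellman (u (x - w)) (v (x - w)))"
    using bdd_int_shift_integrable[OF bdd_int_bellman[OF u v v0]]
    by (intro integral_mono pt) simp_all
  finally show ?thesis by (simp add: avg_def U_def W_def)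
qed

text \<open>Averaging preserves integrals over space, so the covariance becomes the change of the
  integral of u v; the two signs together give the absolute value.\<close>

lemma bellman_avg:
  assumes u: "bdd_int u" and v: "bdd_int v" and v0: "\<And>x. 0 \<le> v x"
  shows "(LBINT x. bellman (avg M u x) (avg M v x))
           + 1/25 * \<bar>(LBINT x. u x * v x) - (LBINT x. avg M u x * avg M v x)\<bar>
         \<le> (LBINT x. bellman (u x) (v x))"
proof -
  note uv = bdd_int_mult[OF u v]
  note au = bdd_int_avg(1)[OF u] and av = bdd_int_avg(1)[OF v]
  have I: "integrable lborel (\<lambda>x. bellman (avg M u x) (avg M v x))"
      "integrable lborel (avg M (\<lambda>x. u x * v x))" "integrable lborel (\<lambda>x. avg M u x * avg M v x)"
      "integrable lborel (avg M (\<lambda>x. bellman (u x) (v x)))"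
    using bdd_int_bellman[OF au av avg_nonneg] bdd_int_avg(1)[OF uv] bdd_int_mult[OF au av]
      bdd_int_avg(1)[OF bdd_int_bellman[OF u v v0]] v0 bdd_int_integrable by auto
  have *: "(LBINT x. bellman (avg M u x) (avg M v x)) + \<sigma>/25 *
      ((LBINT x. u x * v x) - (LBINT x. avg M u x * avg M v x))
      \<le> (LBINT x. bellman (u x) (v x))" if \<sigma>: "\<bar>\<sigma>\<bar> = 1" for \<sigma> :: real
  proof -
    have "(LBINT x. bellman (avg M u x) (avg M v x)) + \<sigma>/25 *
      ((LBINT x. u x * v x) - (LBINT x. avg M u x * avg M v x))
      = (LBINT x. bellman (avg M u x) (avg M v x)
           + \<sigma>/25 * (avg M (\<lambda>x. u x * v x) x - avg M u x * avg M v x))"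
      using I bdd_int_avg(2)[OF uv] by simp
    also have "\<dots> \<le> (LBINT x. avg M (\<lambda>x. bellman (u x) (v x)) x)"
      using I by (intro integral_mono bellman_avg_pointwise[OF u v v0 \<sigma>]) auto
    also have "\<dots> = (LBINT x. bellman (u x) (v x))"
      by (rule bdd_int_avg(2)[OF bdd_int_bellman[OF u v v0]])
    finally show ?thesis .
  qed
  show ?thesis using *[of 1] *[of "-1"] by (simp add: abs_if field_simps)
qed

end

section \<open>The heat flow on space\<close>

text \<open>The Gaussian density of variance \<open>t\<close>, not of standard deviation
  \<open>t\<close>, so that convolution adds the parameters.\<close>

definition gam :: "real \<Rightarrow> real \<Rightarrow> real" where
  "gam t x = exp (- (x\<^sup>2 / (2 * t))) / sqrt (2 * pi * t)"

lemma gam_normal_density: "0 < t \<Longrightarrow> gam t x = normal_density 0 (sqrt t) x"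
  by (simp add: gam_def normal_density_def)

lemma gam_nonneg: "0 < t \<Longrightarrow> 0 \<le> gam t x"
  by (simp add: gam_def)

lemma gam_minus [simp]: "gam t (- x) = gam t x"
  by (simp add: gam_def)

lemma gam_measurable [measurable]: "gam t \<in> borel_measurable borel"
  unfolding gam_def[abs_def] by measurable

lemma nn_integral_gam: "0 < t \<Longrightarrow> (\<integral>\<^sup>+x. gam t x \<partial>lborel) = 1"
  by (simp add: gam_normal_density nn_integral_eq_integral)

lemma gam_conv:
  assumes "0 < s" "0 < t"
  shows "(\<integral>\<^sup>+y. ennreal (gam s y * gam t (x - y)) \<partial>lborel) = gam (t + s) x"
  using conv_normal_density_zero_mean[of "sqrt t" "sqrt s"] assms
  by (simp add: fun_eq_iff gam_normal_density mult.commute)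

text \<open>Completing the square around the midpoint \<open>w/2\<close>. The last factor has mass
  one in \<open>x\<close>, which later yields self-convolutions.\<close>

lemma gam_mult:
  assumes t: "0 < t"
  shows "gam t x * gam t (w - x) = gam (2 * t) w * gam (t/2) (x - w/2)"
proof -
  have "- (x\<^sup>2 / (2 * t)) + - ((w - x)\<^sup>2 / (2 * t))
      = - (w\<^sup>2 / (2 * (2 * t))) + - ((x - w/2)\<^sup>2 / (2 * (t/2)))"
    using t by (simp add: field_simps power2_eq_square)
  then have "exp (- (x\<^sup>2 / (2 * t))) * exp (- ((w - x)\<^sup>2 / (2 * t)))
      = exp (- (w\<^sup>2 / (2 * (2 * t)))) * exp (- ((x - w/2)\<^sup>2 / (2 * (t/2))))"
    by (simp only: exp_add[symmetric])
  moreover have "sqrt (2 * pi * t) * sqrt (2 * pi * t) = sqrt (2 * pi * (2 * t)) * sqrt (2 * pi * (t/2))"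
  proof -
    have "(2 * pi * t) * (2 * pi * t) = (2 * pi * (2 * t)) * (2 * pi * (t/2))" by simp
    then show ?thesis by (simp only: real_sqrt_mult[symmetric])
  qed
  ultimately show ?thesis unfolding gam_def by (simp only: times_divide_times_eq)
qed

definition heat :: "real \<Rightarrow> real^3 \<Rightarrow> real" where
  "heat t x = exp (- ((norm x)\<^sup>2 / (2 * t))) / sqrt (2 * pi * t) ^ 3"

lemma heat_measurable [measurable]: "heat t \<in> borel_measurable borel"
  unfolding heat_def[abs_def] by measurable

lemma nn_integral_heat:
  assumes t: "0 < t"
  shows "(\<integral>\<^sup>+x. heat t x \<partial>lborel) = 1"
proof -
  have "heat t x = (\<Prod>b\<in>Basis. gam t (x \<bullet> b))" for x :: "real^3"
  proof -
    have "(norm x)\<^sup>2 = (\<Sum>b\<in>Basis. (x \<bullet> b)\<^sup>2)"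
      unfolding power2_norm_eq_inner euclidean_inner[of x x] by (simp add: power2_eq_square)
    then have "- ((norm x)\<^sup>2 / (2 * t)) = (\<Sum>b\<in>Basis. - ((x \<bullet> b)\<^sup>2 / (2 * t)))"
      by (simp add: sum_divide_distrib sum_negf)
    then show ?thesis
      by (simp only: heat_def gam_def prod_dividef exp_sum[OF finite_Basis] prod_constant) simp
  qed
  then have "(\<integral>\<^sup>+x. heat t x \<partial>lborel)
      = (\<integral>\<^sup>+x. (\<Prod>b\<in>(Basis::(real^3) set). ennreal (gam t (x \<bullet> b))) \<partial>lborel)"
    using t by (simp add: prod_ennreal gam_nonneg)
  also have "\<dots> = (\<Prod>b\<in>(Basis::(real^3) set). (\<integral>\<^sup>+x. gam t x \<partial>lborel))"
    by (rule nn_integral_lborel_prod) auto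
  also have "\<dots> = 1" using t by (simp add: nn_integral_gam)
  finally show ?thesis .
qed

lemma nn_integral_translate:
  fixes f :: "'a::euclidean_space \<Rightarrow> ennreal"
  assumes [measurable]: "f \<in> borel_measurable borel"
  shows "(\<integral>\<^sup>+x. f (x + w) \<partial>lborel) = (\<integral>\<^sup>+x. f x \<partial>lborel)"
proof -
  have eq: "distr lborel borel (\<lambda>x. x + w) = lborel"
    using lborel_distr_plus[of w] by (simp add: add.commute[of _ w])
  show ?thesis
    using nn_integral_distr[of "\<lambda>x. x + w" lborel borel f] eq by simp
qed

section \<open>Anisotropic Gaussians in an orthonormal frame\<close>

text \<open>A degenerate Gaussian carried by the line spanned by \<open>a\<close>: convolution with
  it adds variance in that direction alone.\<close>

definition line_gauss :: "real^3 \<Rightarrow> real \<Rightarrow> (real^3) measure" where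
  "line_gauss a t = distr (density lborel (gam t)) borel (\<lambda>\<alpha>. \<alpha> *\<^sub>R a)"

lemma shift_prob_line_gauss:
  assumes "0 < t"
  shows "shift_prob (line_gauss a t)"
proof -
  have "prob_space (density lborel (gam t))"
  proof -
    have "density lborel (gam t) = density lborel (normal_density 0 (sqrt t))"
      using assms by (intro density_cong) (auto simp: gam_normal_density)
    then show ?thesis using prob_space_normal_density[of "sqrt t" 0] assms by simp
  qed
  then interpret P: prob_space "density lborel (gam t)" .
  show ?thesis unfolding shift_prob_def shift_prob_axioms_def line_gauss_def
    by (auto intro!: P.prob_space_distr)
qed

lemma nn_integral_line_gauss:
  fixes f :: "real^3 \<Rightarrow> ennreal"
  assumes "0 < t" and [measurable]: "f \<in> borel_measurable borel"
  shows "(\<integral>\<^sup>+x. f x \<partial>line_gauss a t) = (\<integral>\<^sup>+\<alpha>. gam t \<alpha> * f (\<alpha> *\<^sub>R a) \<partial>lborel)"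
  unfolding line_gauss_def by (simp add: nn_integral_distr nn_integral_density)

lemma avg_avg:
  fixes M N :: "(real^3) measure"
  assumes "shift_prob M" "shift_prob N" and u: "bdd_int u"
  shows "avg M (avg N u) = avg (M \<star> N) u"
proof
  fix x
  interpret M: shift_prob M by fact
  interpret N: shift_prob N by fact
  interpret MN: pair_prob_space M N ..
  note [measurable_cong] = M.sets_M N.sets_M
  have [measurable]: "u \<in> borel_measurable borel" using u by measurable
  obtain C where C: "\<And>x. \<bar>u x\<bar> \<le> C" using u bdd_int_bounded by blast
  have "integrable (M \<Otimes>\<^sub>M N) (\<lambda>(v, w). u (x - (v + w)))"
    using C by (intro MN.integrable_const_bound[where B=C]) auto
  from MN.integral_fst[OF this]
  have "(LINT v|M. LINT w|N. u (x - (v + w))) = (LINT p|(M \<Otimes>\<^sub>M N). u (x - (fst p + snd p)))"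
    by (simp add: case_prod_beta')
  also have "\<dots> = avg (M \<star> N) u x"
    unfolding avg_def convolution_def by (subst integral_distr) (auto simp: case_prod_beta')
  finally show "avg M (avg N u) x = avg (M \<star> N) u x"
    by (simp add: avg_def diff_diff_add)
qed

lemma shift_prob_convolution:
  fixes M N :: "(real^3) measure"
  assumes "shift_prob M" "shift_prob N"
  shows "shift_prob (M \<star> N)"
proof -
  interpret M: shift_prob M by fact
  interpret N: shift_prob N by fact
  interpret MN: pair_prob_space M N ..
  note [measurable_cong] = M.sets_M N.sets_M
  show ?thesis unfolding shift_prob_def shift_prob_axioms_def convolution_def
    by (auto intro!: MN.prob_space_distr)
qed

text \<open>Translation turns u(x - w) v(x) into u(x) v(x + w), and the symmetry of \<open>M\<close>
  restores the sign of \<open>w\<close>.\<close>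

lemma avg_self_adjoint:
  assumes "shift_prob M" and sym: "distr M borel uminus = M" and u: "bdd_int u" and v: "bdd_int v"
  shows "(LBINT x. avg M u x * v x) = (LBINT x. u x * avg M v x)"
proof -
  interpret M: shift_prob M by fact
  note [measurable_cong] = M.sets_M
  interpret P: pair_sigma_finite M lborel
    by (intro pair_sigma_finite.intro M.sigma_finite_measure_axioms sigma_finite_lborel)
  have [measurable]: "u \<in> borel_measurable borel" "v \<in> borel_measurable borel"
    using u v by measurable
  obtain C where C: "C > 0" "\<And>x. \<bar>u x\<bar> \<le> C" using u bdd_int_bounded by blast
  obtain D where D: "D > 0" "\<And>x. \<bar>v x\<bar> \<le> D" using v bdd_int_bounded by blast
  have 1: "integrable (M \<Otimes>\<^sub>M lborel) (\<lambda>(w, x). u (x - w) * v x)"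
  proof (rule Bochner_Integration.integrable_bound)
    show "integrable (M \<Otimes>\<^sub>M lborel) (\<lambda>p. D * (case p of (w, x) \<Rightarrow> u (x - w)))"
      using M.pair_integrable[OF u] by (rule integrable_mult_right)
    show "AE p in M \<Otimes>\<^sub>M lborel. norm (case p of (w, x) \<Rightarrow> u (x - w) * v x)
        \<le> norm (D * (case p of (w, x) \<Rightarrow> u (x - w)))"
    proof (intro AE_I2, clarify)
      fix w x
      have "\<bar>u (x - w)\<bar> * \<bar>v x\<bar> \<le> \<bar>u (x - w)\<bar> * D" using D by (intro mult_left_mono) auto
      then show "norm (u (x - w) * v x) \<le> norm (D * u (x - w))"
        using D by (simp add: abs_mult mult.commute)
    qed
  qed measurable
  have 2: "integrable (M \<Otimes>\<^sub>M lborel) (\<lambda>(w, x). u x * v (x - w))"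
  proof (rule Bochner_Integration.integrable_bound)
    show "integrable (M \<Otimes>\<^sub>M lborel) (\<lambda>p. C * (case p of (w, x) \<Rightarrow> v (x - w)))"
      using M.pair_integrable[OF v] by (rule integrable_mult_right)
    show "AE p in M \<Otimes>\<^sub>M lborel. norm (case p of (w, x) \<Rightarrow> u x * v (x - w))
        \<le> norm (C * (case p of (w, x) \<Rightarrow> v (x - w)))"
      using C by (intro AE_I2) (auto simp: abs_mult intro!: mult_right_mono)
  qed measurable
  have "(LINT x|lborel. avg M u x * v x) = (LINT x|lborel. LINT w|M. u (x - w) * v x)"
    unfolding avg_def by simp
  also have "\<dots> = (LINT w|M. LINT x|lborel. u (x - w) * v x)"
    by (rule P.Fubini_integral[OF 1])
  also have "\<dots> = (LINT w|M. LINT x|lborel. u x * v (x + w))"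
    using lborel_translate(2)[of "\<lambda>x. u (x - w) * v x" w for w] by simp
  also have "\<dots> = (LINT w|distr M borel uminus. LINT x|lborel. u x * v (x - w))"
    by (subst integral_distr) auto
  also have "\<dots> = (LINT w|M. LINT x|lborel. u x * v (x - w))"
    unfolding sym ..
  also have "\<dots> = (LINT x|lborel. LINT w|M. u x * v (x - w))"
    by (rule P.Fubini_integral[OF 2, symmetric])
  finally show ?thesis unfolding avg_def by simp
qed

lemma bellman_avg_le:
  assumes "shift_prob M" "bdd_int u" "bdd_int v" "\<And>x. 0 \<le> v x"
  shows "(LBINT x. bellman (avg M u x) (avg M v x)) \<le> (LBINT x. bellman (u x) (v x))"
  by (rule order_trans[OF _ shift_prob.bellman_avg[OF assms]]) simp

text \<open>An orthonormal basis, with completeness expressed by Parseval's identity. Frames other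
  than the standard one occur because the off-diagonal kernels are written with rotated
  axes.\<close>

locale frame3 =
  fixes a b c :: "real^3"
  assumes unit: "a \<bullet> a = 1" "b \<bullet> b = 1" "c \<bullet> c = 1"
    and orth: "a \<bullet> b = 0" "a \<bullet> c = 0" "b \<bullet> c = 0"
    and inner_frame: "x \<bullet> x = (a \<bullet> x)\<^sup>2 + (b \<bullet> x)\<^sup>2 + (c \<bullet> x)\<^sup>2"
begin

definition G :: "real \<Rightarrow> real \<Rightarrow> real \<Rightarrow> real^3 \<Rightarrow> real" where
  "G r s t x = gam r (a \<bullet> x) * gam s (b \<bullet> x) * gam t (c \<bullet> x)"

definition \<mu> :: "real \<Rightarrow> real \<Rightarrow> real \<Rightarrow> (real^3) measure" where
  "\<mu> r s t = density lborel (G r s t)"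

lemma G_measurable [measurable]: "G r s t \<in> borel_measurable borel"
  unfolding G_def[abs_def] by measurable

lemma G_nonneg: "0 < r \<Longrightarrow> 0 < s \<Longrightarrow> 0 < t \<Longrightarrow> 0 \<le> G r s t x"
  by (simp add: G_def gam_nonneg)

lemma sets_\<mu> [measurable_cong, simp]: "sets (\<mu> r s t) = sets borel"
  by (simp add: \<mu>_def)

lemma G_iso: "0 < t \<Longrightarrow> G t t t x = heat t x"
proof -
  assume "0 < t"
  then have "- ((norm x)\<^sup>2 / (2 * t))
      = - ((a \<bullet> x)\<^sup>2 / (2 * t)) + - ((b \<bullet> x)\<^sup>2 / (2 * t)) + - ((c \<bullet> x)\<^sup>2 / (2 * t))"
    by (simp add: power2_norm_eq_inner inner_frame[of x] field_simps)
  then show ?thesis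
    unfolding G_def heat_def gam_def by (simp only: exp_add) (simp add: power3_eq_cube)
qed

text \<open>The isotropic density does not depend on the frame, so its mass can be computed in the
  standard basis.\<close>

lemma prob_\<mu>_iso: "0 < t \<Longrightarrow> shift_prob (\<mu> t t t)"
  unfolding shift_prob_def shift_prob_axioms_def
  by (auto intro!: prob_spaceI simp: \<mu>_def emeasure_density G_iso nn_integral_heat)

lemma convolution_line_gauss_measurable:
  assumes [measurable]: "A \<in> sets borel"
  shows "case_prod (\<lambda>y \<alpha>. ennreal (gam h \<alpha>) * (ennreal (G r s t (y - \<alpha> *\<^sub>R a)) * indicator A y))
    \<in> borel_measurable (lborel \<Otimes>\<^sub>M lborel)"
  by measurable

lemma convolution_self_measurable:
  assumes [measurable]: "A \<in> sets borel"
  shows "case_prod (\<lambda>y x. ennreal (G r s t x) * (ennreal (G r s t (y - x)) * indicator A y))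
    \<in> borel_measurable (lborel \<Otimes>\<^sub>M lborel)"
  by measurable

text \<open>A shift along \<open>a\<close> moves only the first coordinate, so one-dimensional
  convolution suffices. That \<open>\<mu> r s t\<close> has mass one is a hypothesis, because the
  mass of an anisotropic Gaussian is itself deduced from this lemma.\<close>

lemma convolution_line_gauss:
  assumes p: "shift_prob (\<mu> r s t)" and pos: "0 < r" "0 < s" "0 < t" "0 < h"
  shows "line_gauss a h \<star> \<mu> r s t = \<mu> (r + h) s t"
proof (rule measure_eqI)
  fix A assume "A \<in> sets (line_gauss a h \<star> \<mu> r s t)"
  then have A [measurable]: "A \<in> sets borel" by simp
  interpret N: shift_prob "\<mu> r s t" by fact
  interpret L: shift_prob "line_gauss a h" using pos by (intro shift_prob_line_gauss)
  note [measurable_cong] = L.sets_M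
  have [measurable]: "(\<lambda>x. \<integral>\<^sup>+y. indicator A (x + y) \<partial>\<mu> r s t) \<in> borel_measurable borel"
    by (rule N.borel_measurable_nn_integral) measurable
  have "emeasure (line_gauss a h \<star> \<mu> r s t) A
      = (\<integral>\<^sup>+x. \<integral>\<^sup>+y. indicator A (x + y) \<partial>\<mu> r s t \<partial>line_gauss a h)"
    by (rule convolution_emeasure') (auto simp: L.sets_M intro: L.finite_measure_axioms N.finite_measure_axioms)
  also have "\<dots> = (\<integral>\<^sup>+\<alpha>. gam h \<alpha> * (\<integral>\<^sup>+y. indicator A (\<alpha> *\<^sub>R a + y) \<partial>\<mu> r s t) \<partial>lborel)"
    by (rule nn_integral_line_gauss) (use pos in simp_all)
  also have "\<dots> = (\<integral>\<^sup>+\<alpha>. \<integral>\<^sup>+y. ennreal (gam h \<alpha>) * (ennreal (G r s t (y - \<alpha> *\<^sub>R a)) * indicator A y) \<partial>lborel \<partial>lborel)"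
  proof (rule nn_integral_cong)
    fix \<alpha> :: real
    have "(\<integral>\<^sup>+y. indicator A (\<alpha> *\<^sub>R a + y) \<partial>\<mu> r s t) = (\<integral>\<^sup>+y. ennreal (G r s t y) * indicator A (\<alpha> *\<^sub>R a + y) \<partial>lborel)"
      unfolding \<mu>_def by (subst nn_integral_density) auto
    also have "\<dots> = (\<integral>\<^sup>+y. ennreal (G r s t (y - \<alpha> *\<^sub>R a)) * indicator A y \<partial>lborel)"
      using nn_integral_translate[of "\<lambda>y. ennreal (G r s t (y - \<alpha> *\<^sub>R a)) * indicator A y" "\<alpha> *\<^sub>R a"]
      by (simp add: add.commute)
    finally show "gam h \<alpha> * (\<integral>\<^sup>+y. indicator A (\<alpha> *\<^sub>R a + y) \<partial>\<mu> r s t)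
      = (\<integral>\<^sup>+y. ennreal (gam h \<alpha>) * (ennreal (G r s t (y - \<alpha> *\<^sub>R a)) * indicator A y) \<partial>lborel)"
      by (simp add: nn_integral_cmult)
  qed
  also have "\<dots> = (\<integral>\<^sup>+y. \<integral>\<^sup>+\<alpha>. ennreal (gam h \<alpha>) * (ennreal (G r s t (y - \<alpha> *\<^sub>R a)) * indicator A y) \<partial>lborel \<partial>lborel)"
    by (rule lborel_pair.Fubini'[OF convolution_line_gauss_measurable[OF A]])
  also have "\<dots> = (\<integral>\<^sup>+y. ennreal (G (r + h) s t y) * indicator A y \<partial>lborel)"
  proof (rule nn_integral_cong)
    fix y :: "real^3"
    have G: "G r s t (y - \<alpha> *\<^sub>R a) = gam r (a \<bullet> y - \<alpha>) * (gam s (b \<bullet> y) * gam t (c \<bullet> y))" for \<alpha>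
      unfolding G_def using unit orth by (simp add: inner_diff_right inner_commute[of b a] inner_commute[of c a])
    have "(\<integral>\<^sup>+\<alpha>. ennreal (gam h \<alpha>) * (ennreal (G r s t (y - \<alpha> *\<^sub>R a)) * indicator A y) \<partial>lborel)
       = (\<integral>\<^sup>+\<alpha>. ennreal (gam h \<alpha> * gam r (a \<bullet> y - \<alpha>)) * (ennreal (gam s (b \<bullet> y) * gam t (c \<bullet> y)) * indicator A y) \<partial>lborel)"
      unfolding G using pos by (intro nn_integral_cong) (simp add: ennreal_mult gam_nonneg mult_ac)
    also have "\<dots> = (\<integral>\<^sup>+\<alpha>. ennreal (gam h \<alpha> * gam r (a \<bullet> y - \<alpha>)) \<partial>lborel) * (ennreal (gam s (b \<bullet> y) * gam t (c \<bullet> y)) * indicator A y)"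
      by (rule nn_integral_multc) measurable
    also have "\<dots> = ennreal (gam (r + h) (a \<bullet> y)) * (ennreal (gam s (b \<bullet> y) * gam t (c \<bullet> y)) * indicator A y)"
      using gam_conv[of h r "a \<bullet> y"] pos by simp
    also have "\<dots> = ennreal (G (r + h) s t y) * indicator A y"
      unfolding G_def using pos by (simp add: ennreal_mult gam_nonneg mult_ac)
    finally show "(\<integral>\<^sup>+\<alpha>. ennreal (gam h \<alpha>) * (ennreal (G r s t (y - \<alpha> *\<^sub>R a)) * indicator A y) \<partial>lborel)
       = ennreal (G (r + h) s t y) * indicator A y" .
  qed
  also have "\<dots> = emeasure (\<mu> (r + h) s t) A"
    unfolding \<mu>_def by (subst emeasure_density) auto
  finally show "emeasure (line_gauss a h \<star> \<mu> r s t) A = emeasure (\<mu> (r + h) s t) A" .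
qed simp

lemma perm_bac: "frame3 b a c" and perm_cba: "frame3 c b a"
proof -
  show "frame3 b a c"
    by unfold_locales (use unit orth in \<open>simp_all only: inner_commute[of b a]\<close>, subst inner_frame, simp)
  show "frame3 c b a"
    by unfold_locales (use unit orth in \<open>simp_all only: inner_commute[of b a] inner_commute[of c a] inner_commute[of c b]\<close>,
        subst inner_frame, simp)
qed

lemma prob_step: "shift_prob (\<mu> r s t) \<Longrightarrow> 0 < r \<Longrightarrow> 0 < s \<Longrightarrow> 0 < t \<Longrightarrow> 0 < h
    \<Longrightarrow> shift_prob (\<mu> (r + h) s t)"
  using shift_prob_convolution[OF shift_prob_line_gauss[of h a], of "\<mu> r s t"] convolution_line_gauss
  by metis

end

context frame3
begin

interpretation B: frame3 b a c by (rule perm_bac)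
interpretation C: frame3 c b a by (rule perm_cba)

lemma B_\<mu>: "B.\<mu> s r t = \<mu> r s t" and C_\<mu>: "C.\<mu> t s r = \<mu> r s t"
  unfolding B.\<mu>_def C.\<mu>_def \<mu>_def B.G_def[abs_def] C.G_def[abs_def] G_def[abs_def]
  by (simp_all add: mult_ac)

text \<open>Starting from an isotropic Gaussian, variance is added along one axis at a time. Taking
  \<open>m\<close> as half of the smallest variance keeps all three increments positive.\<close>

lemma prob_\<mu>:
  assumes "0 < r" "0 < s" "0 < t"
  shows "shift_prob (\<mu> r s t)"
proof -
  define m where "m = min r (min s t) / 2"
  have m: "0 < m" "m < r" "m < s" "m < t" using assms by (auto simp: m_def)
  have "shift_prob (\<mu> r m m)" using prob_step[OF prob_\<mu>_iso, of m "r - m"] m by simp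
  then have "shift_prob (\<mu> r s m)"
    using B.prob_step[of m r m "s - m"] m by (simp add: B_\<mu>)
  then show ?thesis
    using C.prob_step[of m s r "t - m"] m by (simp add: C_\<mu>)
qed

lemma conv_a: "0 < r \<Longrightarrow> 0 < s \<Longrightarrow> 0 < t \<Longrightarrow> 0 < h \<Longrightarrow> line_gauss a h \<star> \<mu> r s t = \<mu> (r + h) s t"
  by (rule convolution_line_gauss[OF prob_\<mu>])

lemma conv_b: "0 < r \<Longrightarrow> 0 < s \<Longrightarrow> 0 < t \<Longrightarrow> 0 < h \<Longrightarrow> line_gauss b h \<star> \<mu> r s t = \<mu> r (s + h) t"
  using B.convolution_line_gauss[of s r t h, unfolded B_\<mu>, OF prob_\<mu>] by blast

lemma conv_c: "0 < r \<Longrightarrow> 0 < s \<Longrightarrow> 0 < t \<Longrightarrow> 0 < h \<Longrightarrow> line_gauss c h \<star> \<mu> r s t = \<mu> r s (t + h)"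
  using C.convolution_line_gauss[of t s r h, unfolded C_\<mu>, OF prob_\<mu>] by blast

lemma G_minus: "G r s t (- x) = G r s t x"
  by (simp add: G_def)

lemma \<mu>_sym: "distr (\<mu> r s t) borel uminus = \<mu> r s t"
proof (rule measure_eqI)
  fix A assume "A \<in> sets (distr (\<mu> r s t) borel uminus)"
  then have [measurable]: "A \<in> sets borel" by simp
  have eq: "distr lborel borel (\<lambda>x::real^3. - x) = lborel"
    using lborel_affine[of "-1::real" "0::real^3"] by (simp add: density_1)
  have "emeasure (distr (\<mu> r s t) borel uminus) A = (\<integral>\<^sup>+x. indicator A (- x) \<partial>\<mu> r s t)"
    using nn_integral_distr[of uminus "\<mu> r s t" borel "indicator A"] by simp
  also have "\<dots> = (\<integral>\<^sup>+x. ennreal (G r s t (- x)) * indicator A (- x) \<partial>lborel)"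
    unfolding \<mu>_def G_minus by (subst nn_integral_density) auto
  also have "\<dots> = (\<integral>\<^sup>+x. ennreal (G r s t x) * indicator A x \<partial>distr lborel borel uminus)"
    by (subst nn_integral_distr) auto
  also have "\<dots> = emeasure (\<mu> r s t) A"
    unfolding eq \<mu>_def by (subst emeasure_density) auto
  finally show "emeasure (distr (\<mu> r s t) borel uminus) A = emeasure (\<mu> r s t) A" .
qed simp

lemma G_mult:
  assumes "0 < r" "0 < s" "0 < t"
  shows "G r s t x * G r s t (w - x) = G (2 * r) (2 * s) (2 * t) w * G (r/2) (s/2) (t/2) (x - (1/2) *\<^sub>R w)"
proof -
  have "G r s t x * G r s t (w - x) = (gam r (a \<bullet> x) * gam r (a \<bullet> w - a \<bullet> x))
    * (gam s (b \<bullet> x) * gam s (b \<bullet> w - b \<bullet> x)) * (gam t (c \<bullet> x) * gam t (c \<bullet> w - c \<bullet> x))"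
    unfolding G_def by (simp add: inner_diff_right mult_ac)
  then show ?thesis
    using assms unfolding G_def by (simp add: gam_mult inner_diff_right mult_ac)
qed

lemma conv_\<mu>_self:
  assumes pos: "0 < r" "0 < s" "0 < t"
  shows "\<mu> r s t \<star> \<mu> r s t = \<mu> (2 * r) (2 * s) (2 * t)"
proof (rule measure_eqI)
  fix A assume "A \<in> sets (\<mu> r s t \<star> \<mu> r s t)"
  then have A [measurable]: "A \<in> sets borel" by simp
  interpret N: shift_prob "\<mu> r s t" using pos by (rule prob_\<mu>)
  interpret H: shift_prob "\<mu> (r/2) (s/2) (t/2)" using pos by (intro prob_\<mu>) auto
  have "emeasure (\<mu> r s t \<star> \<mu> r s t) A = (\<integral>\<^sup>+x. \<integral>\<^sup>+y. indicator A (x + y) \<partial>\<mu> r s t \<partial>\<mu> r s t)"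
    by (rule convolution_emeasure') (auto intro: N.finite_measure_axioms)
  also have "\<dots> = (\<integral>\<^sup>+x. ennreal (G r s t x) * (\<integral>\<^sup>+y. ennreal (G r s t y) * indicator A (x + y) \<partial>lborel) \<partial>lborel)"
    unfolding \<mu>_def by (subst nn_integral_density, simp, simp, subst nn_integral_density) auto
  also have "\<dots> = (\<integral>\<^sup>+x. \<integral>\<^sup>+y. ennreal (G r s t x) * (ennreal (G r s t (y - x)) * indicator A y) \<partial>lborel \<partial>lborel)"
  proof (rule nn_integral_cong)
    fix x :: "real^3"
    have "(\<integral>\<^sup>+y. ennreal (G r s t y) * indicator A (x + y) \<partial>lborel) = (\<integral>\<^sup>+y. ennreal (G r s t (y - x)) * indicator A y \<partial>lborel)"
      using nn_integral_translate[of "\<lambda>y. ennreal (G r s t (y - x)) * indicator A y" x]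
      by (simp add: add.commute)
    then show "ennreal (G r s t x) * (\<integral>\<^sup>+y. ennreal (G r s t y) * indicator A (x + y) \<partial>lborel)
      = (\<integral>\<^sup>+y. ennreal (G r s t x) * (ennreal (G r s t (y - x)) * indicator A y) \<partial>lborel)"
      by (simp add: nn_integral_cmult)
  qed
  also have "\<dots> = (\<integral>\<^sup>+y. \<integral>\<^sup>+x. ennreal (G r s t x) * (ennreal (G r s t (y - x)) * indicator A y) \<partial>lborel \<partial>lborel)"
    by (rule lborel_pair.Fubini'[OF convolution_self_measurable[OF A]])
  also have "\<dots> = (\<integral>\<^sup>+y. ennreal (G (2 * r) (2 * s) (2 * t) y) * indicator A y \<partial>lborel)"
  proof (rule nn_integral_cong)
    fix y :: "real^3"
    have one: "(\<integral>\<^sup>+x. ennreal (G (r/2) (s/2) (t/2) (x - (1/2) *\<^sub>R y)) \<partial>lborel) = 1"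
    proof -
      have "(\<integral>\<^sup>+x. ennreal (G (r/2) (s/2) (t/2) (x - (1/2) *\<^sub>R y)) \<partial>lborel)
          = (\<integral>\<^sup>+x. ennreal (G (r/2) (s/2) (t/2) x) \<partial>lborel)"
        using nn_integral_translate[of "\<lambda>x. ennreal (G (r/2) (s/2) (t/2) x)" "- ((1/2) *\<^sub>R y)"] by simp
      also have "\<dots> = emeasure (\<mu> (r/2) (s/2) (t/2)) UNIV"
        unfolding \<mu>_def by (subst emeasure_density) auto
      finally show ?thesis using H.emeasure_space_1 by (simp add: \<mu>_def)
    qed
    have "(\<integral>\<^sup>+x. ennreal (G r s t x) * (ennreal (G r s t (y - x)) * indicator A y) \<partial>lborel)
      = (\<integral>\<^sup>+x. (ennreal (G (2 * r) (2 * s) (2 * t) y) * indicator A y) * ennreal (G (r/2) (s/2) (t/2) (x - (1/2) *\<^sub>R y)) \<partial>lborel)"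
    proof (rule nn_integral_cong)
      fix x :: "real^3"
      have e: "ennreal (G r s t x) * ennreal (G r s t (y - x))
        = ennreal (G (2 * r) (2 * s) (2 * t) y) * ennreal (G (r/2) (s/2) (t/2) (x - (1/2) *\<^sub>R y))"
        using pos by (simp add: ennreal_mult[symmetric] G_nonneg G_mult)
      show "ennreal (G r s t x) * (ennreal (G r s t (y - x)) * indicator A y)
        = (ennreal (G (2 * r) (2 * s) (2 * t) y) * indicator A y) * ennreal (G (r/2) (s/2) (t/2) (x - (1/2) *\<^sub>R y))"
        unfolding mult.assoc[symmetric] e by (simp only: mult_ac)
    qed
    also have "\<dots> = ennreal (G (2 * r) (2 * s) (2 * t) y) * indicator A y"
      by (subst nn_integral_cmult) (auto simp: one)
    finally show "(\<integral>\<^sup>+x. ennreal (G r s t x) * (ennreal (G r s t (y - x)) * indicator A y) \<partial>lborel)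
      = ennreal (G (2 * r) (2 * s) (2 * t) y) * indicator A y" .
  qed
  also have "\<dots> = emeasure (\<mu> (2 * r) (2 * s) (2 * t)) A"
    unfolding \<mu>_def by (subst emeasure_density) auto
  finally show "emeasure (\<mu> r s t \<star> \<mu> r s t) A = emeasure (\<mu> (2 * r) (2 * s) (2 * t)) A" .
qed simp

text \<open>Self-adjointness moves both averages onto \<open>v\<close>, where they compose and the
  variances double.\<close>

lemma integral_avg_avg:
  assumes pos: "0 < r" "0 < s" "0 < t" and u: "bdd_int u" and v: "bdd_int v"
  shows "(LBINT x. avg (\<mu> r s t) u x * avg (\<mu> r s t) v x)
    = (LBINT x. u x * avg (\<mu> (2 * r) (2 * s) (2 * t)) v x)"
proof -
  note p = prob_\<mu>[OF pos]
  have "(LBINT x. avg (\<mu> r s t) u x * avg (\<mu> r s t) v x)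
    = (LBINT x. u x * avg (\<mu> r s t) (avg (\<mu> r s t) v) x)"
    by (rule avg_self_adjoint[OF p \<mu>_sym u shift_prob.bdd_int_avg(1)[OF p v]])
  also have "avg (\<mu> r s t) (avg (\<mu> r s t) v) = avg (\<mu> (2 * r) (2 * s) (2 * t)) v"
    using avg_avg[OF p p v] conv_\<mu>_self[OF pos] by simp
  finally show ?thesis .
qed

section \<open>Dissipation of the Bellman integral along the heat flow\<close>

definition \<Phi> :: "(real^3 \<Rightarrow> real) \<Rightarrow> (real^3 \<Rightarrow> real) \<Rightarrow> real \<Rightarrow> real" where
  "\<Phi> u v t = (LBINT x. bellman (avg (\<mu> t t t) u x) (avg (\<mu> t t t) v x))"

lemma \<Phi>_nonneg:
  assumes "0 < t" "\<And>x. 0 \<le> v x" shows "0 \<le> \<Phi> u v t"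
proof -
  interpret shift_prob "\<mu> t t t" using assms by (intro prob_\<mu>)
  show ?thesis unfolding \<Phi>_def
    by (intro integral_nonneg_AE AE_I2 bellman_nonneg avg_nonneg assms)
qed

lemma \<Phi>_le:
  assumes t: "0 < t" and u: "bdd_int u" and v: "bdd_int v" and v0: "\<And>x. 0 \<le> v x"
  shows "\<Phi> u v t \<le> (LBINT x. bellman (u x) (v x))"
  using bellman_avg_le[OF prob_\<mu>[OF t t t] u v v0] unfolding \<Phi>_def .

text \<open>The variance is raised one axis at a time. In direction \<open>a\<close> the remainder
  in Jensen's inequality is kept, in directions \<open>b\<close> and \<open>c\<close> it is dropped.
  Hence the two pairings differ in the first variance only: this is a discrete second derivative
  along \<open>a\<close>.\<close>

lemma \<Phi>_step:
  assumes t: "0 < t" and h: "0 < h" and u: "bdd_int u" and v: "bdd_int v" and v0: "\<And>x. 0 \<le> v x"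
  shows "\<Phi> u v (t + h) + 1/25 * \<bar>(LBINT x. u x * avg (\<mu> (2*t) (2*t) (2*t)) v x)
      - (LBINT x. u x * avg (\<mu> (2*t + 2*h) (2*t) (2*t)) v x)\<bar> \<le> \<Phi> u v t"
proof -
  have th: "0 < t + h" using t h by simp
  note LA = shift_prob_line_gauss[OF h, of a] and LB = shift_prob_line_gauss[OF h, of b]
    and LC = shift_prob_line_gauss[OF h, of c]
  note p0 = prob_\<mu>[OF t t t] and p1 = prob_\<mu>[OF th t t] and p2 = prob_\<mu>[OF th th t]
  note bi = shift_prob.bdd_int_avg(1)[OF p0] shift_prob.bdd_int_avg(1)[OF p1] shift_prob.bdd_int_avg(1)[OF p2]
  note nn = shift_prob.avg_nonneg[OF p0 v0] shift_prob.avg_nonneg[OF p1 v0] shift_prob.avg_nonneg[OF p2 v0]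
  have A: "avg (line_gauss a h) (avg (\<mu> t t t) w) = avg (\<mu> (t + h) t t) w" if "bdd_int w" for w
    using avg_avg[OF LA p0 that] conv_a[OF t t t h] by simp
  have B: "avg (line_gauss b h) (avg (\<mu> (t + h) t t) w) = avg (\<mu> (t + h) (t + h) t) w" if "bdd_int w" for w
    using avg_avg[OF LB p1 that] conv_b[OF th t t h] by simp
  have C: "avg (line_gauss c h) (avg (\<mu> (t + h) (t + h) t) w) = avg (\<mu> (t + h) (t + h) (t + h)) w" if "bdd_int w" for w
    using avg_avg[OF LC p2 that] conv_c[OF th th t h] by simp
  have 1: "(LBINT x. bellman (avg (\<mu> (t + h) t t) u x) (avg (\<mu> (t + h) t t) v x))
     + 1/25 * \<bar>(LBINT x. u x * avg (\<mu> (2*t) (2*t) (2*t)) v x)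
      - (LBINT x. u x * avg (\<mu> (2*t + 2*h) (2*t) (2*t)) v x)\<bar> \<le> \<Phi> u v t"
    using shift_prob.bellman_avg[OF LA bi(1)[OF u] bi(1)[OF v] nn(1)]
      integral_avg_avg[OF t t t u v] integral_avg_avg[OF th t t u v]
    unfolding \<Phi>_def A[OF u] A[OF v] by (simp add: distrib_left)
  have 2: "(LBINT x. bellman (avg (\<mu> (t + h) (t + h) t) u x) (avg (\<mu> (t + h) (t + h) t) v x))
     \<le> (LBINT x. bellman (avg (\<mu> (t + h) t t) u x) (avg (\<mu> (t + h) t t) v x))"
    using bellman_avg_le[OF LB bi(2)[OF u] bi(2)[OF v] nn(2)]
    unfolding B[OF u] B[OF v] .
  have 3: "\<Phi> u v (t + h)
     \<le> (LBINT x. bellman (avg (\<mu> (t + h) (t + h) t) u x) (avg (\<mu> (t + h) (t + h) t) v x))"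
    using bellman_avg_le[OF LC bi(3)[OF u] bi(3)[OF v] nn(3)]
    unfolding C[OF u] C[OF v] \<Phi>_def .
  show ?thesis
    by (rule order_trans[OF add_right_mono 1]) (rule order_trans[OF 3 2])
qed

end

section \<open>The kernel of the flow\<close>

text \<open>By the heat equation this is both the derivative of \<open>gam\<close> in the variance
  and half of its second derivative in space.\<close>

definition dgam :: "real \<Rightarrow> real \<Rightarrow> real" where
  "dgam t x = (x\<^sup>2 / (2 * t\<^sup>2) - 1 / (2 * t)) * gam t x"

lemma gam_deriv:
  assumes t: "0 < t"
  shows "((\<lambda>t. gam t x) has_real_derivative dgam t x) (at t)"
proof -
  have pt: "0 < pi * t" using t by simp
  have sq: "sqrt (2 * pi * t) * sqrt (2 * pi * t) = 2 * pi * t"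
  proof -
    have "0 \<le> 2 * pi * t" using t by (intro mult_nonneg_nonneg) auto
    then show ?thesis by (simp only: real_sqrt_mult_self abs_of_nonneg)
  qed
  have "((\<lambda>t. exp (- (x\<^sup>2 / (2 * t)))) has_real_derivative
      exp (- (x\<^sup>2 / (2 * t))) * (x\<^sup>2 / (2 * t\<^sup>2))) (at t)"
    using t by (auto intro!: derivative_eq_intros simp: power2_eq_square field_simps)
  moreover have "((\<lambda>t. sqrt (2 * pi * t)) has_real_derivative (sqrt (2 * pi * t) / (2 * t))) (at t)"
  proof -
    have "((\<lambda>t. sqrt (2 * pi * t)) has_real_derivative (inverse (sqrt (2 * pi * t)) / 2 * (2 * pi))) (at t)"
    proof (rule DERIV_chain2[OF DERIV_real_sqrt])
      show "((\<lambda>t. 2 * pi * t) has_real_derivative 2 * pi) (at t)"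
        by (auto intro!: derivative_eq_intros)
    qed (use pt in simp)
    moreover have "inverse (sqrt (2 * pi * t)) / 2 * (2 * pi) = sqrt (2 * pi * t) / (2 * t)"
      using t pt sq by (simp add: field_simps)
    ultimately show ?thesis by simp
  qed
  ultimately have "((\<lambda>t. gam t x) has_real_derivative
     (exp (- (x\<^sup>2 / (2 * t))) * (x\<^sup>2 / (2 * t\<^sup>2)) * sqrt (2 * pi * t)
       - exp (- (x\<^sup>2 / (2 * t))) * (sqrt (2 * pi * t) / (2 * t))) / (sqrt (2 * pi * t) * sqrt (2 * pi * t))) (at t)"
    unfolding gam_def using t by (intro DERIV_divide) auto
  moreover have "(exp (- (x\<^sup>2 / (2 * t))) * (x\<^sup>2 / (2 * t\<^sup>2)) * sqrt (2 * pi * t)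
       - exp (- (x\<^sup>2 / (2 * t))) * (sqrt (2 * pi * t) / (2 * t))) / (sqrt (2 * pi * t) * sqrt (2 * pi * t)) = dgam t x"
  proof -
    have "(e * p * q - e * (q / r)) / (q * q) = (p - 1 / r) * (e / q)" if "q \<noteq> 0" "r \<noteq> 0" for e p q r :: real
      using that by (simp add: field_simps)
    note E = this
    show ?thesis unfolding dgam_def gam_def by (rule E) (use t pt in auto)
  qed
  ultimately show ?thesis by simp
qed

section \<open>The radial profile of the time-integrated kernel\<close>

text \<open>The traceless part of the Hessian of the Gaussian depends on time through s^(-7/2)
  exp(-|w|^2/(2 s)). The substitution x = |w|/sqrt s turns its time integral into this truncated
  fourth moment.\<close>

definition gmom :: "real \<Rightarrow> real" where
  "gmom Y = integral {0..Y} (\<lambda>x. x ^ 4 * exp (- (x\<^sup>2 / 2)))"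

definition gmom_inf :: real where "gmom_inf = 3 * sqrt (2 * pi) / 2"

lemma gmom_inf_ge_1: "1 \<le> gmom_inf"
proof -
  have "1 \<le> sqrt (2 * pi)" using pi_ge_two by (intro real_le_rsqrt) auto
  then show ?thesis unfolding gmom_inf_def by linarith
qed

lemma gmom_integrable: "(\<lambda>x::real. x ^ 4 * exp (- (x\<^sup>2 / 2))) integrable_on {0..Y}"
  by (intro integrable_continuous_real continuous_intros) auto

lemma gmom_nonneg: "0 \<le> gmom Y"
  unfolding gmom_def by (intro integral_nonneg gmom_integrable) auto

text \<open>The fifth power outweighs the singularity |w|^(-3) of \<open>dkernel\<close>, so that
  \<open>flow_kernel\<close> is bounded near the origin at every positive time.\<close>

lemma gmom_le_power:
  assumes "0 \<le> Y" shows "gmom Y \<le> Y ^ 5"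
proof -
  have "gmom Y \<le> integral {0..Y} (\<lambda>x. Y ^ 4)"
    unfolding gmom_def
  proof (intro integral_le gmom_integrable)
    fix x assume "x \<in> {0..Y}"
    then have "x ^ 4 * exp (- (x\<^sup>2 / 2)) \<le> Y ^ 4 * 1"
      by (intro mult_mono power_mono) auto
    then show "x ^ 4 * exp (- (x\<^sup>2 / 2)) \<le> Y ^ 4" by simp
  qed auto
  then show ?thesis using assms by (simp add: power_Suc[symmetric] mult.commute eval_nat_numeral)
qed

lemma gmom_deriv:
  assumes "0 < Y"
  shows "(gmom has_real_derivative Y ^ 4 * exp (- (Y\<^sup>2 / 2))) (at Y)"
proof -
  have "((\<lambda>u. integral {0..u} (\<lambda>x. x ^ 4 * exp (- (x\<^sup>2 / 2)))) has_real_derivative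
      Y ^ 4 * exp (- (Y\<^sup>2 / 2))) (at Y within {0..Y + 1})"
    using assms by (intro integral_has_real_derivative continuous_intros) auto
  moreover have "at Y within {0..Y + 1} = at Y"
    using assms by (intro at_within_interior) auto
  ultimately show ?thesis unfolding gmom_def[abs_def] by simp
qed

lemma gmom_bochner:
  "has_bochner_integral lborel (\<lambda>x::real. indicator {0..} x *\<^sub>R (x ^ 4 * exp (- (x\<^sup>2 / 2)))) gmom_inf"
proof -
  have s: "(sqrt 2) ^ 4 = (4::real)" by (simp add: power4_eq_xxxx)
  have "has_bochner_integral lborel
      (\<lambda>x::real. 4 * (indicator {0..} x *\<^sub>R (exp (- x\<^sup>2) * x ^ (2 * 2))))
      (4 * ((sqrt pi / 2) * (fact (2 * 2) / (2 ^ (2 * 2) * fact 2))))"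
    by (intro has_bochner_integral_mult_right gaussian_moment_even_pos)
  also have "(\<lambda>x::real. 4 * (indicator {0..} x *\<^sub>R (exp (- x\<^sup>2) * x ^ (2 * 2))))
    = (\<lambda>x. indicator {0..} (0 + sqrt 2 * x) *\<^sub>R ((0 + sqrt 2 * x) ^ 4 * exp (- ((0 + sqrt 2 * x)\<^sup>2 / 2))))"
    by (auto simp: fun_eq_iff power_mult_distrib s indicator_def zero_le_mult_iff)
  also have "4 * ((sqrt pi / 2) * (fact (2 * 2) / (2 ^ (2 * 2) * fact 2))) = gmom_inf /\<^sub>R \<bar>sqrt 2\<bar>"
    by (simp add: gmom_inf_def real_sqrt_mult fact_numeral field_simps)
  finally show ?thesis
    by (subst lborel_has_bochner_integral_real_affine_iff[where c="sqrt 2" and t=0]) auto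
qed

text \<open>A cutoff of one fixed integrable function: limit, upper bound and monotonicity in
  \<open>Y\<close> all follow from this form.\<close>

lemma gmom_eq:
  "gmom Y = (LBINT x. indicator {..Y} x *\<^sub>R (indicator {0..} x *\<^sub>R (x ^ 4 * exp (- (x\<^sup>2 / 2)))))"
proof -
  have I: "set_integrable lborel {0..Y} (\<lambda>x::real. x ^ 4 * exp (- (x\<^sup>2 / 2)))"
    by (intro borel_integrable_atLeastAtMost' continuous_intros) auto
  have "gmom Y = (LINT x:{0..Y}|lborel. x ^ 4 * exp (- (x\<^sup>2 / 2)))"
    using set_borel_integral_eq_integral(2)[OF I] by (simp add: gmom_def)
  also have "\<dots> = (LBINT x. indicator {..Y} x *\<^sub>R (indicator {0..} x *\<^sub>R (x ^ 4 * exp (- (x\<^sup>2 / 2)))))"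
    unfolding set_lebesgue_integral_def by (intro Bochner_Integration.integral_cong) (auto simp: indicator_def)
  finally show ?thesis .
qed

lemma gmom_tendsto: "(gmom \<longlongrightarrow> gmom_inf) at_top"
  using tendsto_integral_at_top[OF _ integrable.intros[OF gmom_bochner]]
  unfolding gmom_eq[abs_def] using gmom_bochner by (simp add: has_bochner_integral_iff)

lemma gmom_le_inf: "gmom Y \<le> gmom_inf"
proof -
  have "gmom Y \<le> (LBINT x. indicator {0..} x *\<^sub>R (x ^ 4 * exp (- (x\<^sup>2 / 2))))"
    unfolding gmom_eq
    by (intro integral_mono integrable_mult_indicator integrable.intros[OF gmom_bochner])
      (auto simp: indicator_def)
  then show ?thesis using gmom_bochner by (simp add: has_bochner_integral_iff)
qed

lemma gmom_measurable [measurable]: "gmom \<in> borel_measurable borel"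
proof -
  have "mono gmom"
    unfolding mono_def gmom_eq
    by (intro allI impI integral_mono integrable_mult_indicator integrable.intros[OF gmom_bochner])
      (auto simp: indicator_def)
  then show ?thesis by (rule borel_measurable_mono)
qed

text \<open>The value at \<open>0\<close> is \<open>0\<close>, by division by zero.\<close>

definition dkernel :: "real^3 \<Rightarrow> real^3 \<Rightarrow> real" where
  "dkernel a w = (3 * (a \<bullet> w)\<^sup>2 - (norm w)\<^sup>2) / (4 * pi * norm w ^ 5)"

lemma dkernel_measurable [measurable]: "dkernel a \<in> borel_measurable borel"
  unfolding dkernel_def[abs_def] by measurable

lemma dkernel_bound:
  assumes "norm a = 1"
  shows "\<bar>dkernel a w\<bar> * norm w ^ 3 \<le> 1"
proof (cases "w = 0")
  case False
  then have n: "0 < norm w" by simp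
  have "(a \<bullet> w)\<^sup>2 \<le> (norm w)\<^sup>2"
    using Cauchy_Schwarz_ineq[of a w] assms by (simp add: power2_norm_eq_inner[symmetric])
  then have "\<bar>3 * (a \<bullet> w)\<^sup>2 - (norm w)\<^sup>2\<bar> \<le> 2 * (norm w)\<^sup>2"
    by (smt (verit) zero_le_power2)
  also have "\<dots> \<le> 4 * pi * (norm w)\<^sup>2"
    using pi_ge_two by (intro mult_right_mono) auto
  finally have "\<bar>3 * (a \<bullet> w)\<^sup>2 - (norm w)\<^sup>2\<bar> * norm w ^ 3 \<le> 4 * pi * (norm w)\<^sup>2 * norm w ^ 3"
    by (intro mult_right_mono) auto
  also have "\<dots> = 4 * pi * norm w ^ 5" by (simp add: power_add[symmetric] flip: mult.assoc)
  finally show ?thesis using n by (simp add: dkernel_def abs_mult field_simps)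
qed (simp add: dkernel_def)

text \<open>
  The antiderivative in \<open>s\<close> of half the second derivative along \<open>a\<close> of the Gaussian of variance \<open>s\<close>
  that vanishes at \<open>s = \<infinity>\<close>. As \<open>s \<rightarrow> 0\<close> it tends to \<open>- dkernel a\<close> plus one third of the Dirac mass.
\<close>

definition flow_kernel :: "real^3 \<Rightarrow> real \<Rightarrow> real^3 \<Rightarrow> real" where
  "flow_kernel a s w = - dkernel a w * (gmom (norm w / sqrt s) / gmom_inf) + heat s w / 3"

lemma flow_kernel_measurable [measurable]: "flow_kernel a s \<in> borel_measurable borel"
  unfolding flow_kernel_def[abs_def] by measurable

text \<open>Serves two purposes: the kernel is bounded on balls at each time, and on a fixed ball it
  tends to zero as \<open>s\<close> grows, which removes the far end of the flow.\<close>

lemma flow_kernel_bound: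
  assumes a: "norm a = 1" and s: "0 < s"
  shows "\<bar>flow_kernel a s w\<bar> \<le> (norm w)\<^sup>2 / sqrt s ^ 5 + 1 / sqrt s ^ 3"
proof -
  have "\<bar>dkernel a w * (gmom (norm w / sqrt s) / gmom_inf)\<bar> \<le> (norm w)\<^sup>2 / sqrt s ^ 5"
  proof -
    have "gmom (norm w / sqrt s) / gmom_inf \<le> (norm w / sqrt s) ^ 5 / 1"
      using s gmom_inf_ge_1 gmom_le_power[of "norm w / sqrt s"] gmom_nonneg[of "norm w / sqrt s"]
      by (intro frac_le) auto
    moreover have "0 \<le> gmom (norm w / sqrt s) / gmom_inf"
      using gmom_inf_ge_1 gmom_nonneg by simp
    ultimately have "\<bar>dkernel a w * (gmom (norm w / sqrt s) / gmom_inf)\<bar> \<le> \<bar>dkernel a w\<bar> * (norm w / sqrt s) ^ 5"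
      unfolding abs_mult by (intro mult_left_mono) auto
    also have "\<dots> = (\<bar>dkernel a w\<bar> * norm w ^ 3) * ((norm w)\<^sup>2 / sqrt s ^ 5)"
      by (simp add: power_divide mult_ac power_add[symmetric])
    also have "\<dots> \<le> 1 * ((norm w)\<^sup>2 / sqrt s ^ 5)"
      using s by (intro mult_right_mono dkernel_bound a) auto
    finally show ?thesis by simp
  qed
  moreover have "0 \<le> heat s w" "heat s w / 3 \<le> 1 / sqrt s ^ 3"
  proof -
    show "0 \<le> heat s w" using s by (simp add: heat_def)
    have "sqrt s \<le> sqrt (2 * pi * s)" using s pi_ge_two by simp
    then have "sqrt s ^ 3 \<le> sqrt (2 * pi * s) ^ 3" using s by (intro power_mono) auto
    then have "heat s w \<le> 1 / sqrt s ^ 3"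
      unfolding heat_def using s by (intro frac_le) auto
    then show "heat s w / 3 \<le> 1 / sqrt s ^ 3" using \<open>0 \<le> heat s w\<close> by simp
  qed
  ultimately show ?thesis unfolding flow_kernel_def by linarith
qed

lemma gmom_scaled_deriv:
  assumes \<rho>: "0 < \<rho>" and s: "0 < s"
  shows "((\<lambda>s. gmom (\<rho> / sqrt s)) has_real_derivative
      - (\<rho> ^ 5 * exp (- (\<rho>\<^sup>2 / (2 * s))) / (2 * s ^ 3 * sqrt s))) (at s)"
proof -
  have "((\<lambda>s. \<rho> / sqrt s) has_real_derivative - (\<rho> / (2 * s * sqrt s))) (at s)"
    using s by (auto intro!: derivative_eq_intros simp: field_simps power2_eq_square)
  from DERIV_chain2[OF gmom_deriv this] have "((\<lambda>s. gmom (\<rho> / sqrt s)) has_real_derivative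
     (\<rho> / sqrt s) ^ 4 * exp (- ((\<rho> / sqrt s)\<^sup>2 / 2)) * - (\<rho> / (2 * s * sqrt s))) (at s)"
    using \<rho> s by simp
  moreover have "(\<rho> / sqrt s)\<^sup>2 = \<rho>\<^sup>2 / s" "(\<rho> / sqrt s) ^ 4 = \<rho> ^ 4 / s\<^sup>2"
  proof -
    show 1: "(\<rho> / sqrt s)\<^sup>2 = \<rho>\<^sup>2 / s" using s by (simp add: power_divide)
    have "(\<rho> / sqrt s) ^ 4 = ((\<rho> / sqrt s)\<^sup>2)\<^sup>2" by (simp flip: power_mult)
    then show "(\<rho> / sqrt s) ^ 4 = \<rho> ^ 4 / s\<^sup>2" unfolding 1 by (simp add: power_divide flip: power_mult)
  qed
  moreover have "\<rho> ^ 4 / s\<^sup>2 * exp (- (\<rho>\<^sup>2 / s / 2)) * - (\<rho> / (2 * s * sqrt s))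
     = - (\<rho> ^ 5 * exp (- (\<rho>\<^sup>2 / (2 * s))) / (2 * s ^ 3 * sqrt s))"
    using s by (simp add: field_simps eval_nat_numeral)
  ultimately show ?thesis by simp
qed

context frame3
begin

lemma norm_a: "norm a = 1"
  using unit(1) by (simp add: norm_eq_1)

text \<open>Half the second derivative along \<open>a\<close> splits into a traceless part, with
  factor (3 A - \<rho>^2)/(6 s^2), and one third of the time derivative of the Gaussian. The first
  comes from the term with \<open>gmom\<close>, the second from \<open>heat s w / 3\<close>.\<close>

lemma flow_kernel_deriv:
  assumes s: "0 < s"
  shows "((\<lambda>s. flow_kernel a s w) has_real_derivative
     dgam s (a \<bullet> w) * gam s (b \<bullet> w) * gam s (c \<bullet> w)) (at s)"
proof -
  define \<rho> where "\<rho> = norm w"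
  define A where "A = (a \<bullet> w)\<^sup>2"
  have \<rho>2: "\<rho>\<^sup>2 = A + (b \<bullet> w)\<^sup>2 + (c \<bullet> w)\<^sup>2"
    unfolding \<rho>_def A_def power2_norm_eq_inner by (rule inner_frame)
  have heat_G: "heat s w = gam s (a \<bullet> w) * gam s (b \<bullet> w) * gam s (c \<bullet> w)"
    using G_iso[OF s, of w] by (simp add: G_def)
  have "((\<lambda>s. gam s (a \<bullet> w) * gam s (b \<bullet> w) * gam s (c \<bullet> w)) has_real_derivative
      heat s w * (\<rho>\<^sup>2 / (2 * s\<^sup>2) - 3 / (2 * s))) (at s)"
    by (rule derivative_eq_intros gam_deriv s refl)+
       (simp add: heat_G \<rho>2 A_def dgam_def add_divide_distrib algebra_simps)
  then have dheat: "((\<lambda>s. heat s w) has_real_derivative heat s w * (\<rho>\<^sup>2 / (2 * s\<^sup>2) - 3 / (2 * s))) (at s)"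
    by (rule has_field_derivative_transform_within_open[where S="{0<..}"])
       (use s G_iso[of _ w] in \<open>auto simp: G_def\<close>)
  have dm: "((\<lambda>s. - dkernel a w * (gmom (norm w / sqrt s) / gmom_inf)) has_real_derivative
      heat s w * ((3 * A - \<rho>\<^sup>2) / (6 * s\<^sup>2))) (at s)"
  proof (cases "w = 0")
    \<comment> \<open>Division by zero makes \<open>dkernel a 0\<close> vanish; the claimed
      derivative is zero there as well.\<close>
    case True
    then show ?thesis by (simp add: dkernel_def A_def \<rho>_def)
  next
    case False
    then have \<rho>: "0 < \<rho>" by (simp add: \<rho>_def)
    have "((\<lambda>s. - dkernel a w * (gmom (\<rho> / sqrt s) / gmom_inf)) has_real_derivative
       - dkernel a w * (- (\<rho> ^ 5 * exp (- (\<rho>\<^sup>2 / (2 * s))) / (2 * s ^ 3 * sqrt s)) / gmom_inf)) (at s)"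
      by (intro DERIV_cmult DERIV_cdivide gmom_scaled_deriv \<rho> s)
    moreover have "- dkernel a w * (- (\<rho> ^ 5 * exp (- (\<rho>\<^sup>2 / (2 * s))) / (2 * s ^ 3 * sqrt s)) / gmom_inf)
       = heat s w * ((3 * A - \<rho>\<^sup>2) / (6 * s\<^sup>2))"
    proof -
      have h: "heat s w = exp (- (\<rho>\<^sup>2 / (2 * s))) / (2 * pi * s * (sqrt (2 * pi) * sqrt s))"
        unfolding heat_def \<rho>_def[symmetric] proof -
        have "sqrt (2 * pi * s) ^ 3 = (sqrt (2 * pi * s))\<^sup>2 * sqrt (2 * pi * s)"
          by (simp only: power3_eq_cube power2_eq_square)
        also have "\<dots> = 2 * pi * s * (sqrt (2 * pi) * sqrt s)"
          using s by (simp add: real_sqrt_pow2 mult_nonneg_nonneg flip: real_sqrt_mult)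
        finally show "exp (- (\<rho>\<^sup>2 / (2 * s))) / sqrt (2 * pi * s) ^ 3
            = exp (- (\<rho>\<^sup>2 / (2 * s))) / (2 * pi * s * (sqrt (2 * pi) * sqrt s))" by simp
      qed
      define e q where "e = exp (- (\<rho>\<^sup>2 / (2 * s)))" and "q = sqrt (2 * pi)"
      have q: "q > 0" by (simp add: q_def)
      show ?thesis
        unfolding h dkernel_def gmom_inf_def \<rho>_def[symmetric] A_def[symmetric] e_def[symmetric] q_def[symmetric]
        using \<rho> s q by (simp add: field_simps eval_nat_numeral)
    qed
    ultimately show ?thesis unfolding \<rho>_def[symmetric] by simp
  qed
  have "((\<lambda>s. flow_kernel a s w) has_real_derivative
      heat s w * ((3 * A - \<rho>\<^sup>2) / (6 * s\<^sup>2)) + heat s w * (\<rho>\<^sup>2 / (2 * s\<^sup>2) - 3 / (2 * s)) / 3) (at s)"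
    unfolding flow_kernel_def by (intro DERIV_add dm DERIV_cdivide dheat)
  moreover have "heat s w * ((3 * A - \<rho>\<^sup>2) / (6 * s\<^sup>2)) + heat s w * (\<rho>\<^sup>2 / (2 * s\<^sup>2) - 3 / (2 * s)) / 3
      = heat s w * (A / (2 * s\<^sup>2) - 1 / (2 * s))"
    using s by (simp add: field_simps)
  ultimately show ?thesis by (simp add: dgam_def A_def heat_G mult_ac)
qed

text \<open>Both increments equal \<open>h\<close> times a value of the same continuous function, at nearby points.\<close>

lemma flow_kernel_increment:
  assumes p: "0 < p" and \<epsilon>: "0 < \<epsilon>"
  obtains \<delta> where "\<delta> > 0"
    "\<And>t h w. p \<le> t \<Longrightarrow> 0 < h \<Longrightarrow> h < \<delta> \<Longrightarrow> t + h \<le> q \<Longrightarrow> norm w \<le> \<rho> \<Longrightarrow>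
       \<bar>(flow_kernel a (t + h) w - flow_kernel a t w) - (G (t + h) t t w - G t t t w)\<bar> \<le> \<epsilon> * h"
proof -
  \<comment> \<open>Three separate time arguments: the mean value theorem yields a point (z, z, z)
    for the flow kernel, but (y, t, t) for the increment of \<open>G\<close>, where only the first
    variance moves.\<close>
  define g :: "real \<times> real \<times> real \<times> (real^3) \<Rightarrow> real" where
    "g = (\<lambda>(x, y, z, w). dgam x (a \<bullet> w) * gam y (b \<bullet> w) * gam z (c \<bullet> w))"
  define S where "S = {p..q} \<times> {p..q} \<times> {p..q} \<times> cball (0::real^3) \<rho>"
  have "continuous_on S g"
    unfolding g_def S_def dgam_def gam_def case_prod_beta
    using p by (intro continuous_intros) auto
  moreover have "compact S" unfolding S_def by (intro compact_Times compact_Icc compact_cball)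
  ultimately have "uniformly_continuous_on S g" by (intro compact_uniformly_continuous)
  then obtain d where d: "d > 0" "\<And>x y. x \<in> S \<Longrightarrow> y \<in> S \<Longrightarrow> dist y x < d \<Longrightarrow> dist (g y) (g x) < \<epsilon>"
    unfolding uniformly_continuous_on_def using \<epsilon> by metis
  show thesis
  proof (rule that[of "d / 3"])
    show "d / 3 > 0" using d by simp
    fix t h :: real and w :: "real^3" assume *: "p \<le> t" "0 < h" "h < d / 3" "t + h \<le> q" "norm w \<le> \<rho>"
    have "\<exists>z>t. z < t + h \<and> flow_kernel a (t + h) w - flow_kernel a t w
        = (t + h - t) * (dgam z (a \<bullet> w) * gam z (b \<bullet> w) * gam z (c \<bullet> w))"
      using * p by (intro MVT2 flow_kernel_deriv) auto
    then obtain z where z: "t < z" "z < t + h"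
      "flow_kernel a (t + h) w - flow_kernel a t w = h * g (z, z, z, w)" by (auto simp: g_def)
    have "\<exists>z>t. z < t + h \<and> gam (t + h) (a \<bullet> w) - gam t (a \<bullet> w) = (t + h - t) * dgam z (a \<bullet> w)"
      using * p by (intro MVT2 gam_deriv) auto
    then obtain y where y: "t < y" "y < t + h" "gam (t + h) (a \<bullet> w) - gam t (a \<bullet> w) = h * dgam y (a \<bullet> w)"
      by auto
    have "G (t + h) t t w - G t t t w = (gam (t + h) (a \<bullet> w) - gam t (a \<bullet> w)) * (gam t (b \<bullet> w) * gam t (c \<bullet> w))"
      unfolding G_def by (simp add: algebra_simps)
    then have G: "G (t + h) t t w - G t t t w = h * g (y, t, t, w)"
      unfolding y(3) by (simp add: g_def)
    have "dist (z, z, z, w) (y, t, t, w) \<le> dist z y + (dist z t + dist z t)"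
    proof -
      have D: "dist (x, u) (y, v) \<le> dist x y + dist u v"
        for x y :: "'x::metric_space" and u v :: "'y::metric_space"
        unfolding dist_Pair_Pair by (intro sqrt_sum_squares_le_sum) auto
      have "dist (z, w) (t, w) \<le> dist z t + dist w w" by (rule D)
      then have "dist (z, z, w) (t, t, w) \<le> dist z t + dist z t"
        using D[of z "(z, w)" t "(t, w)"] by simp
      then show ?thesis using D[of z "(z, z, w)" y "(t, t, w)"] by simp
    qed
    also have "\<dots> < d" using y z * by (simp add: dist_real_def)
    finally have "dist (g (z, z, z, w)) (g (y, t, t, w)) < \<epsilon>"
      using * y z by (intro d(2)) (auto simp: S_def)
    then have "\<bar>h * (g (z, z, z, w) - g (y, t, t, w))\<bar> \<le> \<epsilon> * h"
      using *(2) by (simp add: dist_real_def abs_mult mult.commute)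
    then show "\<bar>(flow_kernel a (t + h) w - flow_kernel a t w) - (G (t + h) t t w - G t t t w)\<bar> \<le> \<epsilon> * h"
      unfolding z(3) G by (simp add: right_diff_distrib)
  qed
qed

end

section \<open>Summing the increments: a bound uniform in time\<close>

text \<open>Increments of at most \<epsilon> h over all short steps add up to \<epsilon> (q - p)
  over a fine equal partition. This lets discrete Jensen steps be used without differentiating the
  Bellman integral.\<close>

lemma nonincreasing_from_increments:
  fixes F :: "real \<Rightarrow> real"
  assumes pq: "p \<le> q"
    and inc: "\<And>\<epsilon>. 0 < \<epsilon> \<Longrightarrow> \<exists>\<delta>>0. \<forall>t h. p \<le> t \<longrightarrow> 0 < h \<longrightarrow> h < \<delta> \<longrightarrow> t + h \<le> q \<longrightarrow> F (t + h) - F t \<le> \<epsilon> * h"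
  shows "F q \<le> F p"
proof (cases "p = q")
  case False
  then have pq: "p < q" using pq by simp
  show ?thesis
  proof (rule field_le_epsilon)
    fix e :: real assume e: "0 < e"
    define \<epsilon> where "\<epsilon> = e / (q - p)"
    have "0 < \<epsilon>" using e pq by (simp add: \<epsilon>_def)
    from inc[OF this] obtain \<delta> where \<delta>: "\<delta> > 0"
      "\<And>t h. p \<le> t \<Longrightarrow> 0 < h \<Longrightarrow> h < \<delta> \<Longrightarrow> t + h \<le> q \<Longrightarrow> F (t + h) - F t \<le> \<epsilon> * h" by blast
    obtain n :: nat where n: "(q - p) / \<delta> < real n" using reals_Archimedean2 by blast
    have n0: "0 < real n" using n pq \<delta> by (smt (verit) divide_pos_pos)
    define h where "h = (q - p) / real n"
    have h: "0 < h" "h < \<delta>" using n n0 pq \<delta> by (auto simp: h_def field_simps)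
    have hn: "real n * h = q - p" using n0 by (simp add: h_def)
    have "F (p + real k * h) - F p \<le> \<epsilon> * (real k * h)" if "k \<le> n" for k
      using that
    proof (induction k)
      case (Suc k)
      have "real (Suc k) * h \<le> real n * h" using Suc.prems h by (intro mult_right_mono) auto
      then have le: "p + real k * h + h \<le> q" using hn by (simp add: algebra_simps)
      have "F (p + real k * h + h) - F (p + real k * h) \<le> \<epsilon> * h"
        by (rule \<delta>(2)) (use h le in auto)
      then show ?case using Suc by (simp add: algebra_simps)
    qed simp
    from this[of n] have "F q - F p \<le> \<epsilon> * (q - p)" using hn by simp
    also have "\<dots> = e" using pq by (simp add: \<epsilon>_def)
    finally show "F q \<le> F p + e" by simp
  qed
qed simp

text \<open>The double integral of k(w) u(x) v(x - w), kept on the product space so that different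
  kernels can be subtracted and compared pointwise.\<close>

definition pairing :: "(real^3 \<Rightarrow> real) \<Rightarrow> (real^3 \<Rightarrow> real) \<Rightarrow> (real^3 \<Rightarrow> real) \<Rightarrow> real" where
  "pairing k u v = (LINT p|(lborel \<Otimes>\<^sub>M lborel). k (snd p) * (u (fst p) * v (fst p - snd p)))"

lemma shift_product_integrable:
  fixes u v :: "real^3 \<Rightarrow> real"
  assumes "bdd_int u" "bdd_int v"
  shows "integrable (lborel \<Otimes>\<^sub>M lborel) (\<lambda>p. u (fst p) * v (fst p - snd p))"
proof -
  have [measurable]: "u \<in> borel_measurable borel" "v \<in> borel_measurable borel"
    using assms by measurable
  have v: "integrable lborel (\<lambda>w. v (x - w))" for x
    using lborel_reflect(1)[of v x] assms bdd_int_integrable by auto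
  show ?thesis
  proof (rule lborel_pair.Fubini_integrable)
    have "(LBINT w. \<bar>v (x - w)\<bar>) = (LBINT w. \<bar>v w\<bar>)" for x
      using lborel_reflect(2)[of "\<lambda>w. \<bar>v w\<bar>" x] by simp
    then show "integrable lborel (\<lambda>x. LBINT y. norm (u (fst (x, y)) * v (fst (x, y) - snd (x, y))))"
      using bdd_int_integrable[OF assms(1)] by (simp add: abs_mult)
    show "AE x in lborel. integrable lborel (\<lambda>y. u (fst (x, y)) * v (fst (x, y) - snd (x, y)))"
      using v by (intro AE_I2) auto
  qed measurable
qed

locale supported_pair =
  fixes u v :: "real^3 \<Rightarrow> real" and \<rho> :: real
  assumes u: "bdd_int u" and v: "bdd_int v"
    and u_supp: "u x \<noteq> 0 \<Longrightarrow> norm x \<le> \<rho>" and v_supp: "v x \<noteq> 0 \<Longrightarrow> norm x \<le> \<rho>"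
begin

lemma u_measurable [measurable]: "u \<in> borel_measurable borel"
  and v_measurable [measurable]: "v \<in> borel_measurable borel"
  using u v by measurable

text \<open>This confines the displacement \<open>w\<close>, so a kernel only has to be controlled
  on a ball.\<close>

lemma product_support: "u x * v (x - w) \<noteq> 0 \<Longrightarrow> norm w \<le> 2 * \<rho>"
  using u_supp[of x] v_supp[of "x - w"] norm_triangle_ineq4[of x "x - w"] by force

lemma pairing_integrable:
  assumes [measurable]: "k \<in> borel_measurable borel" and k: "\<And>w. norm w \<le> 2 * \<rho> \<Longrightarrow> \<bar>k w\<bar> \<le> C"
  shows "integrable (lborel \<Otimes>\<^sub>M lborel) (\<lambda>p. k (snd p) * (u (fst p) * v (fst p - snd p)))"
    and "\<bar>pairing k u v\<bar> \<le> C * (LINT p|(lborel \<Otimes>\<^sub>M lborel). \<bar>u (fst p) * v (fst p - snd p)\<bar>)"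
proof -
  note J = shift_product_integrable[OF u v]
  have le: "norm (k (snd p) * (u (fst p) * v (fst p - snd p))) \<le> C * \<bar>u (fst p) * v (fst p - snd p)\<bar>" for p
  proof (cases "u (fst p) * v (fst p - snd p) = 0")
    case False
    then have "norm (snd p) \<le> 2 * \<rho>" by (rule product_support)
    then have "\<bar>k (snd p)\<bar> * \<bar>u (fst p) * v (fst p - snd p)\<bar> \<le> C * \<bar>u (fst p) * v (fst p - snd p)\<bar>"
      by (intro mult_right_mono k) auto
    then show ?thesis by (simp add: abs_mult)
  qed auto
  have J': "integrable (lborel \<Otimes>\<^sub>M lborel) (\<lambda>p. C * \<bar>u (fst p) * v (fst p - snd p)\<bar>)"
    using J by (intro integrable_mult_right integrable_abs)
  show I: "integrable (lborel \<Otimes>\<^sub>M lborel) (\<lambda>p. k (snd p) * (u (fst p) * v (fst p - snd p)))"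
  proof (rule Bochner_Integration.integrable_bound[OF J'])
    show "AE p in lborel \<Otimes>\<^sub>M lborel. norm (k (snd p) * (u (fst p) * v (fst p - snd p)))
        \<le> norm (C * \<bar>u (fst p) * v (fst p - snd p)\<bar>)"
      by (intro AE_I2 order_trans[OF le]) simp
  qed measurable
  have "\<bar>pairing k u v\<bar> \<le> (LINT p|(lborel \<Otimes>\<^sub>M lborel). \<bar>k (snd p) * (u (fst p) * v (fst p - snd p))\<bar>)"
    unfolding pairing_def by (rule integral_abs_bound)
  also have "\<dots> \<le> (LINT p|(lborel \<Otimes>\<^sub>M lborel). C * \<bar>u (fst p) * v (fst p - snd p)\<bar>)"
    using I J' le by (intro integral_mono integrable_abs) auto
  finally show "\<bar>pairing k u v\<bar> \<le> C * (LINT p|(lborel \<Otimes>\<^sub>M lborel). \<bar>u (fst p) * v (fst p - snd p)\<bar>)"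
    by simp
qed

lemma pairing_diff:
  assumes "k \<in> borel_measurable borel" "\<And>w. norm w \<le> 2 * \<rho> \<Longrightarrow> \<bar>k w\<bar> \<le> C"
    and "l \<in> borel_measurable borel" "\<And>w. norm w \<le> 2 * \<rho> \<Longrightarrow> \<bar>l w\<bar> \<le> D"
  shows "pairing (\<lambda>w. k w - l w) u v = pairing k u v - pairing l u v"
  unfolding pairing_def left_diff_distrib
  by (rule Bochner_Integration.integral_diff[OF pairing_integrable(1)[OF assms(1,2)] pairing_integrable(1)[OF assms(3,4)]])

lemma pairing_iterated:
  assumes "k \<in> borel_measurable borel" "\<And>w. norm w \<le> 2 * \<rho> \<Longrightarrow> \<bar>k w\<bar> \<le> C"
  shows "pairing k u v = (LBINT x. u x * (LBINT w. k w * v (x - w)))"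
proof -
  have "pairing k u v = (LBINT x. LBINT w. k w * (u x * v (x - w)))"
    using lborel_pair.integral_fst'[OF pairing_integrable(1)[OF assms]]
    by (simp add: pairing_def)
  also have "\<dots> = (LBINT x. LBINT w. u x * (k w * v (x - w)))"
    by (simp only: mult.left_commute)
  finally show ?thesis by simp
qed

end

lemma gam_le: "0 < t \<Longrightarrow> gam t x \<le> 1 / sqrt (2 * pi * t)"
  unfolding gam_def by (intro divide_right_mono) auto

context frame3
begin

lemma G_bounded:
  assumes "0 < r" "0 < s" "0 < t"
  shows "\<bar>G r s t w\<bar> \<le> 1 / sqrt (2 * pi * r) * (1 / sqrt (2 * pi * s)) * (1 / sqrt (2 * pi * t))"
proof -
  have "gam r (a \<bullet> w) * gam s (b \<bullet> w) * gam t (c \<bullet> w) \<le> 1 / sqrt (2 * pi * r) * (1 / sqrt (2 * pi * s)) * (1 / sqrt (2 * pi * t))"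
    using assms by (intro mult_mono gam_le mult_nonneg_nonneg gam_nonneg) auto
  then show ?thesis using G_nonneg[OF assms, of w] by (simp add: G_def)
qed

lemma avg_\<mu>:
  assumes "0 < r" "0 < s" "0 < t" and [measurable]: "v \<in> borel_measurable borel"
  shows "avg (\<mu> r s t) v x = (LBINT w. G r s t w * v (x - w))"
  unfolding avg_def \<mu>_def using assms G_nonneg by (subst integral_density) auto

end

locale flow = frame3 a b c + supported_pair u v \<rho> for a b c u v \<rho> +
  assumes v_nonneg: "0 \<le> v x"
begin

lemma pairing_G:
  assumes "0 < r" "0 < s" "0 < t"
  shows "pairing (G r s t) u v = (LBINT x. u x * avg (\<mu> r s t) v x)"
  using pairing_iterated[OF G_measurable G_bounded[OF assms]] avg_\<mu>[OF assms] by simp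

lemma flow_kernel_bdd: "0 < s \<Longrightarrow> norm w \<le> 2 * \<rho> \<Longrightarrow>
    \<bar>flow_kernel a s w\<bar> \<le> (2 * \<rho>)\<^sup>2 / sqrt s ^ 5 + 1 / sqrt s ^ 3"
  by (intro order_trans[OF flow_kernel_bound[OF norm_a]] add_mono divide_right_mono power_mono) auto

text \<open>The decrease of \<open>\<Phi>\<close> pays for the change of the pairing, up to an error
  that is small relative to the step. Two averages of variance s/2 compose to one of variance s,
  hence the halved argument.\<close>

lemma flow_increment:
  assumes pq: "0 < p" "p \<le> q" and \<sigma>: "\<bar>\<sigma>\<bar> = 1"
  shows "\<Phi> u v (q / 2) + \<sigma> / 25 * pairing (flow_kernel a q) u v
    \<le> \<Phi> u v (p / 2) + \<sigma> / 25 * pairing (flow_kernel a p) u v"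
proof -
  define L where "L = (LINT p|(lborel \<Otimes>\<^sub>M lborel). \<bar>u (fst p) * v (fst p - snd p)\<bar>)"
  have L0: "0 \<le> L" unfolding L_def by (intro integral_nonneg_AE) auto
  define F where "F = (\<lambda>s. \<Phi> u v (s / 2) + \<sigma> / 25 * pairing (flow_kernel a s) u v)"
  have "F q \<le> F p"
  proof (rule nonincreasing_from_increments[OF pq(2)])
    fix \<epsilon> :: real assume \<epsilon>: "0 < \<epsilon>"
    \<comment> \<open>The summand 1 avoids division by zero; the error \<open>e * h * L\<close> is
      then at most \<open>\<epsilon> * h\<close>.\<close>
    define e where "e = \<epsilon> / (L + 1)"
    have "0 < e" using \<epsilon> L0 by (simp add: e_def)
    from flow_kernel_increment[OF pq(1) this, of q "2 * \<rho>"] obtain \<delta> where \<delta>: "\<delta> > 0"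
      "\<And>t h w. p \<le> t \<Longrightarrow> 0 < h \<Longrightarrow> h < \<delta> \<Longrightarrow> t + h \<le> q \<Longrightarrow> norm w \<le> 2 * \<rho> \<Longrightarrow>
         \<bar>(flow_kernel a (t + h) w - flow_kernel a t w) - (G (t + h) t t w - G t t t w)\<bar> \<le> e * h"
      by blast
    have "F (t + h) - F t \<le> \<epsilon> * h" if *: "p \<le> t" "0 < h" "h < \<delta>" "t + h \<le> q" for t h
    proof -
      have t: "0 < t" "0 < t + h" using * pq by auto
      let ?K = "\<lambda>w. flow_kernel a (t + h) w - flow_kernel a t w"
      let ?D = "\<lambda>w. G (t + h) t t w - G t t t w"
      have K: "pairing ?K u v = pairing (flow_kernel a (t + h)) u v - pairing (flow_kernel a t) u v"
        by (rule pairing_diff) (use t flow_kernel_bdd in auto)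
      have D: "pairing ?D u v = pairing (G (t + h) t t) u v - pairing (G t t t) u v"
        by (rule pairing_diff[OF _ G_bounded _ G_bounded]) (use t in auto)
      have KD: "pairing (\<lambda>w. ?K w - ?D w) u v = pairing ?K u v - pairing ?D u v"
      proof (rule pairing_diff)
        show "\<bar>?K w\<bar> \<le> ((2 * \<rho>)\<^sup>2 / sqrt (t + h) ^ 5 + 1 / sqrt (t + h) ^ 3) + ((2 * \<rho>)\<^sup>2 / sqrt t ^ 5 + 1 / sqrt t ^ 3)"
          if "norm w \<le> 2 * \<rho>" for w
          using flow_kernel_bdd[OF t(1) that] flow_kernel_bdd[OF t(2) that] by linarith
        show "\<bar>?D w\<bar> \<le> (1 / sqrt (2 * pi * (t + h)) * (1 / sqrt (2 * pi * t)) * (1 / sqrt (2 * pi * t)))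
            + (1 / sqrt (2 * pi * t) * (1 / sqrt (2 * pi * t)) * (1 / sqrt (2 * pi * t)))" for w
          using G_bounded[OF t(2,1,1), of w] G_bounded[OF t(1,1,1), of w] by linarith
      qed measurable
      have "\<bar>pairing (\<lambda>w. ?K w - ?D w) u v\<bar> \<le> e * h * L"
        unfolding L_def by (rule pairing_integrable(2)) (use \<delta>(2) * in auto)
      also have "\<dots> \<le> \<epsilon> * h"
      proof -
        have "L / (L + 1) \<le> 1" using L0 by simp
        then have "\<epsilon> * h * (L / (L + 1)) \<le> \<epsilon> * h * 1" using \<epsilon> * by (intro mult_left_mono) auto
        then show ?thesis by (simp add: e_def field_simps)
      qed
      finally have small: "\<bar>pairing ?K u v - pairing ?D u v\<bar> \<le> \<epsilon> * h" unfolding KD .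
      have step: "\<Phi> u v ((t + h) / 2) + 1/25 * \<bar>pairing ?D u v\<bar> \<le> \<Phi> u v (t / 2)"
      proof -
        have "2 * (t / 2) = t" "2 * (t / 2) + 2 * (h / 2) = t + h" "t / 2 + h / 2 = (t + h) / 2"
          by (simp_all add: field_simps)
        then show ?thesis
          using \<Phi>_step[of "t/2" "h/2" u v] t * u v v_nonneg D
            pairing_G[OF t(2,1,1)] pairing_G[OF t(1,1,1)] by (simp add: abs_minus_commute add_divide_distrib)
      qed
      have "\<sigma> * pairing ?K u v \<le> \<bar>pairing ?D u v\<bar> + \<epsilon> * h"
      proof -
        have "\<sigma> = 1 \<or> \<sigma> = -1" using \<sigma> by linarith
        moreover have "x \<le> \<bar>y\<bar> + e \<and> - x \<le> \<bar>y\<bar> + e" if "\<bar>x - y\<bar> \<le> e" for x y e :: real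
          using that by linarith
        ultimately show ?thesis using small by force
      qed
      moreover have "F (t + h) - F t = \<Phi> u v ((t + h) / 2) - \<Phi> u v (t / 2) + (\<sigma> * pairing ?K u v) / 25"
        unfolding F_def K by (simp add: field_simps)
      ultimately have "F (t + h) - F t \<le> \<epsilon> * h / 25"
        using step by (simp add: field_simps)
      also have "\<dots> \<le> \<epsilon> * h" using \<epsilon> * by simp
      finally show ?thesis .
    qed
    then show "\<exists>\<delta>>0. \<forall>t h. p \<le> t \<longrightarrow> 0 < h \<longrightarrow> h < \<delta> \<longrightarrow> t + h \<le> q \<longrightarrow> F (t + h) - F t \<le> \<epsilon> * h"
      using \<delta>(1) by blast
  qed
  then show ?thesis by (simp add: F_def)
qed

text \<open>At a late time \<open>q\<close> the pairing tends to zero and \<open>\<Phi>\<close> is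
  still nonnegative. So the pairing at \<open>p\<close> costs at most 25 times the initial Bellman
  integral, however small \<open>p\<close> is.\<close>

lemma flow_bound:
  assumes p: "0 < p"
  shows "\<bar>pairing (flow_kernel a p) u v\<bar> \<le> 25 * (LBINT x. bellman (u x) (v x))"
proof -
  define L where "L = (LINT p|(lborel \<Otimes>\<^sub>M lborel). \<bar>u (fst p) * v (fst p - snd p)\<bar>)"
  define B where "B = (LBINT x. bellman (u x) (v x))"
  define E where "E = (\<lambda>q. ((2 * \<rho>)\<^sup>2 / sqrt q ^ 5 + 1 / sqrt q ^ 3) * L)"
  have "(E \<longlongrightarrow> 0) at_top"
  proof -
    have "filterlim sqrt at_top at_top" by (rule sqrt_at_top)
    then have "((\<lambda>q. inverse (sqrt q)) \<longlongrightarrow> 0) at_top" by (rule tendsto_inverse_0_at_top)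
    then have "((\<lambda>q. ((2 * \<rho>)\<^sup>2 * inverse (sqrt q) ^ 5 + inverse (sqrt q) ^ 3) * L) \<longlongrightarrow> ((2 * \<rho>)\<^sup>2 * 0 ^ 5 + 0 ^ 3) * L) at_top"
      by (intro tendsto_intros)
    then show ?thesis by (simp add: E_def divide_inverse power_inverse)
  qed
  then have lim: "((\<lambda>q. 25 * B + E q) \<longlongrightarrow> 25 * B + 0) at_top" by (intro tendsto_intros)
  have "\<bar>pairing (flow_kernel a p) u v\<bar> \<le> 25 * B + E q" if q: "p \<le> q" for q
  proof -
    have q0: "0 < q" using p q by simp
    have E: "\<bar>pairing (flow_kernel a q) u v\<bar> \<le> E q"
      unfolding E_def L_def by (rule pairing_integrable(2)) (use flow_kernel_bdd q0 in auto)
    have \<Phi>: "0 \<le> \<Phi> u v (q / 2)" "\<Phi> u v (p / 2) \<le> B"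
      using \<Phi>_nonneg[of "q/2" v u] \<Phi>_le[of "p/2" u v] u v v_nonneg p q0 by (auto simp: B_def)
    show ?thesis
      using flow_increment[OF p q, of 1] flow_increment[OF p q, of "-1"] E \<Phi>
      by (simp add: abs_le_iff field_simps)
  qed
  then have "\<forall>\<^sub>F q in at_top. \<bar>pairing (flow_kernel a p) u v\<bar> \<le> 25 * B + E q"
    by (auto simp: eventually_at_top_linorder)
  with lim have "\<bar>pairing (flow_kernel a p) u v\<bar> \<le> 25 * B + 0"
    by (rule tendsto_lowerbound) simp
  then show ?thesis by (simp add: B_def)
qed

end

section \<open>Rotation invariance and the cancellation of the kernel\<close>

lemma distr_lborel_orthogonal:
  fixes f :: "real^3 \<Rightarrow> real^3"
  assumes f: "orthogonal_transformation f"
  shows "distr lborel borel f = lborel"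
proof (rule lborel_eqI[symmetric])
  have "linear f" using f by (simp add: orthogonal_transformation_def)
  then have cont: "continuous_on UNIV f" by (intro linear_continuous_on) (simp add: linear_conv_bounded_linear)
  then have [measurable]: "f \<in> borel_measurable borel" by (rule borel_measurable_continuous_onI)
  obtain g where g: "orthogonal_transformation g" "\<And>x. g (f x) = x" "\<And>x. f (g x) = x"
    using orthogonal_transformation_inv[OF f] orthogonal_transformation_bij[OF f]
    by (metis bij_inv_eq_iff)
  fix l u :: "real^3" assume le: "\<And>b. b \<in> Basis \<Longrightarrow> l \<bullet> b \<le> u \<bullet> b"
  have im: "f -` box l u = g ` box l u"
    using g by (auto simp: image_iff) metis
  have S: "f -` box l u \<in> sets borel"
    using measurable_sets[of f borel borel "box l u"] by simp
  have "emeasure (distr lborel borel f) (box l u) = emeasure lborel (f -` box l u)"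
    by (subst emeasure_distr) auto
  also have "\<dots> = emeasure lebesgue (g ` box l u)"
    using S im by simp
  also have "\<dots> = ennreal (measure lebesgue (g ` box l u))"
    by (intro emeasure_eq_ennreal_measure fmeasurableD2 measurable_orthogonal_image[OF g(1)] lmeasurable_box)
  also have "\<dots> = ennreal (measure lebesgue (box l u))"
    using measure_orthogonal_image[OF g(1), of "box l u"] by simp
  also have "\<dots> = (\<Prod>b\<in>Basis. (u - l) \<bullet> b)"
    using le by (simp add: measure_lborel_box_eq)
  finally show "emeasure (distr lborel borel f) (box l u) = (\<Prod>b\<in>Basis. (u - l) \<bullet> b)" .
qed simp

context frame3
begin

text \<open>\<open>R\<close> is the reflection in the plane orthogonal to \<open>a - b\<close>,
  whose squared length is 2; it exchanges \<open>a\<close> and \<open>b\<close> and preserves norm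
  and volume.\<close>

lemma square_integral_swap:
  assumes [measurable]: "\<theta> \<in> borel_measurable borel"
  shows "(LBINT w. (b \<bullet> w)\<^sup>2 * \<theta> (norm w)) = (LBINT w. (a \<bullet> w)\<^sup>2 * \<theta> (norm w))"
proof -
  define R where "R w = w - ((a - b) \<bullet> w) *\<^sub>R (a - b)" for w
  have lin: "linear R"
    unfolding R_def by (intro linearI) (simp_all add: algebra_simps inner_add_right)
  have nn: "(a - b) \<bullet> (a - b) = 2"
    using unit orth by (simp add: inner_diff_left inner_diff_right inner_commute[of b a])
  have "R x \<bullet> R y = x \<bullet> y" for x y
  proof -
    have "R x \<bullet> R y = x \<bullet> y - ((a - b) \<bullet> y) * (x \<bullet> (a - b)) - ((a - b) \<bullet> x) * ((a - b) \<bullet> y)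
       + ((a - b) \<bullet> x) * ((a - b) \<bullet> y) * ((a - b) \<bullet> (a - b))"
      unfolding R_def by (simp only: inner_diff_left[of x] inner_diff_right[of _ y] inner_scaleR_left inner_scaleR_right) (simp add: algebra_simps)
    then show ?thesis unfolding nn by (simp add: inner_commute[of x])
  qed
  then have orthR: "orthogonal_transformation R" using lin by (simp add: orthogonal_transformation_def)
  have nR: "norm (R w) = norm w" for w using orthR by (rule orthogonal_transformation_norm)
  have aR: "a \<bullet> R w = b \<bullet> w" for w
    unfolding R_def using unit orth by (simp add: inner_diff_left inner_diff_right)
  have [measurable]: "R \<in> borel_measurable borel"
    using lin by (intro borel_measurable_continuous_onI linear_continuous_on) (simp add: linear_conv_bounded_linear)
  have "(LINT w|lborel. (a \<bullet> w)\<^sup>2 * \<theta> (norm w)) = (LINT w|distr lborel borel R. (a \<bullet> w)\<^sup>2 * \<theta> (norm w))"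
    by (simp add: distr_lborel_orthogonal[OF orthR])
  also have "\<dots> = (LBINT w. (a \<bullet> R w)\<^sup>2 * \<theta> (norm (R w)))"
    by (rule integral_distr) auto
  finally show ?thesis by (simp add: aR nR)
qed

end

context frame3
begin

text \<open>By Parseval the numerator is 2 (a.w)^2 - (b.w)^2 - (c.w)^2, and the three radially
  weighted integrals agree by reflection. The integrability hypothesis allows them to be
  separated.\<close>

lemma dkernel_radial_integral:
  assumes [measurable]: "\<theta> \<in> borel_measurable borel"
    and int: "integrable lborel (\<lambda>w::real^3. \<theta> (norm w) / norm w ^ 3)"
  shows "(LBINT w. dkernel a w * \<theta> (norm w)) = 0"
proof -
  interpret C: frame3 a c b
    using unit orth by unfold_locales (simp_all only: inner_commute[of c b], subst inner_frame, simp)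
  define h where "h r = \<theta> r / (4 * pi * r ^ 5)" for r
  have [measurable]: "h \<in> borel_measurable borel" unfolding h_def[abs_def] by measurable
  have I: "integrable lborel (\<lambda>w. (e \<bullet> w)\<^sup>2 * h (norm w))" if e: "norm e = 1" for e :: "real^3"
  proof (rule Bochner_Integration.integrable_bound[OF int])
    show "AE w in lborel. norm ((e \<bullet> w)\<^sup>2 * h (norm w)) \<le> norm (\<theta> (norm w) / norm w ^ 3)"
    proof (rule AE_I2)
      fix w :: "real^3"
      have "(e \<bullet> w)\<^sup>2 \<le> (norm w)\<^sup>2"
        using Cauchy_Schwarz_ineq[of e w] e by (simp add: power2_norm_eq_inner[symmetric])
      then have "(e \<bullet> w)\<^sup>2 * \<bar>h (norm w)\<bar> \<le> (norm w)\<^sup>2 * \<bar>h (norm w)\<bar>" by (rule mult_right_mono) simp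
      also have "\<dots> = \<bar>\<theta> (norm w) / norm w ^ 3\<bar> / (4 * pi)"
        by (cases "w = 0") (simp_all add: h_def abs_mult field_simps eval_nat_numeral)
      also have "\<dots> \<le> \<bar>\<theta> (norm w) / norm w ^ 3\<bar> / 1"
        using pi_ge_two by (intro divide_left_mono) auto
      finally show "norm ((e \<bullet> w)\<^sup>2 * h (norm w)) \<le> norm (\<theta> (norm w) / norm w ^ 3)"
        by (simp add: abs_mult)
    qed
  qed measurable
  have n: "norm a = 1" "norm b = 1" "norm c = 1" using unit by (simp_all add: norm_eq_1)
  have "dkernel a w * \<theta> (norm w) = 2 * ((a \<bullet> w)\<^sup>2 * h (norm w)) - (b \<bullet> w)\<^sup>2 * h (norm w) - (c \<bullet> w)\<^sup>2 * h (norm w)" for w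
  proof -
    have "3 * (a \<bullet> w)\<^sup>2 - (norm w)\<^sup>2 = 2 * (a \<bullet> w)\<^sup>2 - (b \<bullet> w)\<^sup>2 - (c \<bullet> w)\<^sup>2"
      unfolding power2_norm_eq_inner inner_frame[of w] by simp
    then show ?thesis unfolding dkernel_def h_def
      by (simp only: times_divide_eq_left times_divide_eq_right diff_divide_distrib[symmetric] left_diff_distrib mult.assoc)
  qed
  then show ?thesis
    using I[OF n(1)] I[OF n(2)] I[OF n(3)] square_integral_swap[of h] C.square_integral_swap[of h] by simp
qed

end

section \<open>Singular integrals\<close>

lemma cball_in_borel [measurable]: "cball c r \<in> sets borel"
  by simp

text \<open>Layers: 1/|w|^2 is 1/r^2 plus the integral of 2/t^3 from |w| to r. After exchanging the
  integrals the ball volume c t^3 leaves the constant 2 c on (0, r].\<close>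

lemma integrable_inverse_square:
  "integrable lborel (\<lambda>w::real^3. indicator (cball 0 r) w / (norm w)\<^sup>2)"
proof (cases "0 < r")
  case False
  have z: "indicator (cball 0 r) w / (norm w)\<^sup>2 = (0::real)" for w :: "real^3"
  proof (cases "w = 0")
    case w: False
    then have "r < norm w" using False by (meson le_less_trans not_less zero_less_norm_iff)
    then show ?thesis by simp
  qed simp
  show ?thesis unfolding z by simp
next
  case r: True
  define c where "c = unit_ball_vol (real DIM(real^3))"
  have c: "0 \<le> c" by (simp add: c_def)
  have vol: "emeasure lborel (cball (0::real^3) t) = ennreal (c * t ^ 3)" if "0 < t" for t
    using emeasure_cball[of t "0::real^3"] that by (simp add: c_def)
  have pt: "ennreal (indicator (cball 0 r) w / (norm w)\<^sup>2)
     \<le> ennreal (1 / r\<^sup>2) * indicator (cball 0 r) w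
       + (\<integral>\<^sup>+t. ennreal (2 / t ^ 3) * indicator {0<..r} t * indicator (cball 0 t) w \<partial>lborel)" for w :: "real^3"
  proof (cases "w = 0 \<or> r < norm w")
    case False
    then have w: "0 < norm w" "norm w \<le> r" by auto
    have "(\<integral>\<^sup>+t. ennreal (2 / t ^ 3) * indicator {norm w..r} t \<partial>lborel) = ennreal (- (1 / r\<^sup>2) - (- (1 / (norm w)\<^sup>2)))"
    proof (rule nn_integral_FTC_Icc)
      fix t assume t: "t \<in> {norm w..r}"
      then have "0 < t" using less_le_trans[OF w(1), of t] by simp
      then show "((\<lambda>t. - (1 / t\<^sup>2)) has_real_derivative 2 / t ^ 3) (at t)"
        by (auto intro!: derivative_eq_intros simp: field_simps eval_nat_numeral)
      show "0 \<le> 2 / t ^ 3"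
        using \<open>0 < t\<close> by simp
    qed (use w in auto)
    also have "(\<integral>\<^sup>+t. ennreal (2 / t ^ 3) * indicator {norm w..r} t \<partial>lborel)
       = (\<integral>\<^sup>+t. ennreal (2 / t ^ 3) * indicator {0<..r} t * indicator (cball 0 t) w \<partial>lborel)"
    proof (rule nn_integral_cong)
      fix t :: real
      have "norm w \<le> t \<Longrightarrow> 0 < t" using w(1) by linarith
      then show "ennreal (2 / t ^ 3) * indicator {norm w..r} t
          = ennreal (2 / t ^ 3) * indicator {0<..r} t * indicator (cball 0 t) w"
        by (auto simp: indicator_def)
    qed
    finally have eq: "(\<integral>\<^sup>+t. ennreal (2 / t ^ 3) * indicator {0<..r} t * indicator (cball 0 t) w \<partial>lborel)
       = ennreal (1 / (norm w)\<^sup>2 - 1 / r\<^sup>2)" by simp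
    have "1 / r\<^sup>2 \<le> 1 / (norm w)\<^sup>2" using w r by (intro divide_left_mono power_mono mult_pos_pos zero_less_power) auto
    then show ?thesis unfolding eq using w r by (simp add: ennreal_plus[symmetric] del: ennreal_plus)
  qed (auto simp: indicator_def)
  have "(\<integral>\<^sup>+w. ennreal (indicator (cball 0 r) (w::real^3) / (norm w)\<^sup>2) \<partial>lborel)
     \<le> (\<integral>\<^sup>+w. ennreal (1 / r\<^sup>2) * indicator (cball (0::real^3) r) w
       + (\<integral>\<^sup>+t. ennreal (2 / t ^ 3) * indicator {0<..r} t * indicator (cball 0 t) w \<partial>lborel) \<partial>lborel)"
    by (intro nn_integral_mono pt)
  also have "\<dots> = ennreal (1 / r\<^sup>2) * emeasure lborel (cball (0::real^3) r)
       + (\<integral>\<^sup>+w. \<integral>\<^sup>+t. ennreal (2 / t ^ 3) * indicator {0<..r} t * indicator (cball (0::real^3) t) w \<partial>lborel \<partial>lborel)"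
  proof (subst nn_integral_add)
    show "(\<lambda>w::real^3. \<integral>\<^sup>+t. ennreal (2 / t ^ 3) * indicator {0<..r} t * indicator (cball 0 t) w \<partial>lborel)
        \<in> borel_measurable lborel"
      unfolding indicator_def by simp
  qed (simp_all add: nn_integral_cmult_indicator)
  also have "(\<integral>\<^sup>+w. \<integral>\<^sup>+t. ennreal (2 / t ^ 3) * indicator {0<..r} t * indicator (cball (0::real^3) t) w \<partial>lborel \<partial>lborel)
     = (\<integral>\<^sup>+t. \<integral>\<^sup>+w. ennreal (2 / t ^ 3) * indicator {0<..r} t * indicator (cball (0::real^3) t) w \<partial>lborel \<partial>lborel)"
    by (rule lborel_pair.Fubini') (simp add: indicator_def)
  also have "\<dots> = (\<integral>\<^sup>+t. ennreal (2 * c) * indicator {0<..r} t \<partial>lborel)"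
  proof (rule nn_integral_cong)
    fix t :: real
    show "(\<integral>\<^sup>+w. ennreal (2 / t ^ 3) * indicator {0<..r} t * indicator (cball (0::real^3) t) w \<partial>lborel)
       = ennreal (2 * c) * indicator {0<..r} t"
      using vol[of t] c
      by (cases "0 < t \<and> t \<le> r") (auto simp: nn_integral_cmult ennreal_mult[symmetric])
  qed
  finally have fin: "(\<integral>\<^sup>+w. ennreal (indicator (cball 0 r) (w::real^3) / (norm w)\<^sup>2) \<partial>lborel) < \<infinity>"
    using r vol[OF r] by (elim le_less_trans) (simp add: nn_integral_cmult_indicator ennreal_mult_less_top)
  show ?thesis
    by (rule integrableI_nonneg) (use fin in \<open>auto simp: indicator_def\<close>)
qed

text \<open>Meaningful only if \<open>v (y - w) = 0\<close> for all \<open>w\<close> with \<open>norm w > r\<close>.\<close>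

definition dkernel_pv :: "real^3 \<Rightarrow> real \<Rightarrow> (real^3 \<Rightarrow> real) \<Rightarrow> real^3 \<Rightarrow> real" where
  "dkernel_pv a r v y = (LBINT w. indicator (cball 0 r) w * (dkernel a w * (v (y - w) - v y)))"

lemma dkernel_le:
  assumes "norm a = 1" shows "\<bar>dkernel a w\<bar> \<le> 1 / norm w ^ 3"
  using dkernel_bound[OF assms, of w] by (cases "w = 0") (auto simp: dkernel_def field_simps)

text \<open>A Lipschitz increment cancels one power of the singularity; the remaining |w|^(-2) is
  integrable in three dimensions.\<close>

lemma dkernel_lipschitz_le:
  assumes "norm a = 1" "\<bar>d\<bar> \<le> L * norm w"
  shows "\<bar>indicator (cball 0 r) w * (dkernel a w * d)\<bar> \<le> L * (indicator (cball 0 r) w / (norm w)\<^sup>2)"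
proof -
  have "\<bar>dkernel a w\<bar> * \<bar>d\<bar> \<le> (1 / norm w ^ 3) * (L * norm w)"
    using dkernel_le[OF assms(1), of w] assms(2) by (intro mult_mono) auto
  also have "\<dots> = L * (1 / (norm w)\<^sup>2)"
    by (cases "w = 0") (auto simp: field_simps eval_nat_numeral)
  finally show ?thesis by (auto simp: indicator_def abs_mult)
qed

section \<open>Principal values and heat regularisation at one point\<close>

text \<open>Everything is seen from a single point \<open>y\<close>: the Lipschitz bound is required
  only there, and \<open>r\<close> bounds the displacements that reach the support of
  \<open>v\<close>.\<close>

locale kernel_point = frame3 a b c for a b c +
  fixes v :: "real^3 \<Rightarrow> real" and y :: "real^3" and r L C :: real
  assumes v_meas [measurable]: "v \<in> borel_measurable borel"
    and v_bound: "\<bar>v x\<bar> \<le> C"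
    and v_lip: "\<bar>v (y - w) - v y\<bar> \<le> L * norm w"
    and v_far: "v (y - w) \<noteq> 0 \<Longrightarrow> norm w \<le> r"
begin

lemma truncated_integrable:
  assumes [measurable]: "\<theta> \<in> borel_measurable borel" and \<theta>: "\<And>x. \<bar>\<theta> x\<bar> \<le> 1"
  shows "integrable lborel (\<lambda>w. indicator (cball 0 r) w * (dkernel a w * (\<theta> (norm w) * (v (y - w) - v y))))"
    and "\<bar>LBINT w. indicator (cball 0 r) w * (dkernel a w * (\<theta> (norm w) * (v (y - w) - v y)))\<bar>
      \<le> L * (LBINT w. indicator (cball (0::real^3) r) w / (norm w)\<^sup>2)"
proof -
  have d: "\<bar>\<theta> (norm w) * (v (y - w) - v y)\<bar> \<le> L * norm w" for w
    using mult_mono[OF \<theta>[of "norm w"] v_lip[of w]] by (simp add: abs_mult)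
  note le = dkernel_lipschitz_le[OF norm_a d, of r]
  have J: "integrable lborel (\<lambda>w::real^3. L * (indicator (cball 0 r) w / (norm w)\<^sup>2))"
    by (intro integrable_mult_right integrable_inverse_square)
  show I: "integrable lborel (\<lambda>w. indicator (cball 0 r) w * (dkernel a w * (\<theta> (norm w) * (v (y - w) - v y))))"
  proof (rule Bochner_Integration.integrable_bound[OF J])
    show "AE w in lborel. norm (indicator (cball 0 r) w * (dkernel a w * (\<theta> (norm w) * (v (y - w) - v y))))
       \<le> norm (L * (indicator (cball 0 r) w / (norm w)\<^sup>2))"
      by (intro AE_I2) (unfold real_norm_def, rule order_trans[OF le abs_ge_self])
  qed measurable
  have "\<bar>LBINT w. indicator (cball 0 r) w * (dkernel a w * (\<theta> (norm w) * (v (y - w) - v y)))\<bar>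
     \<le> (LBINT w. \<bar>indicator (cball 0 r) w * (dkernel a w * (\<theta> (norm w) * (v (y - w) - v y)))\<bar>)"
    by (rule integral_abs_bound)
  also have "\<dots> \<le> (LBINT w. L * (indicator (cball (0::real^3) r) w / (norm w)\<^sup>2))"
    by (intro integral_mono integrable_abs I J le)
  finally show "\<bar>LBINT w. indicator (cball 0 r) w * (dkernel a w * (\<theta> (norm w) * (v (y - w) - v y)))\<bar>
      \<le> L * (LBINT w. indicator (cball (0::real^3) r) w / (norm w)\<^sup>2)"
    by (simp only: integral_mult_right_zero)
qed

text \<open>One dominated convergence for all radial regularisations. It is applied to the sharp
  cutoffs in the principal value and to the smooth profile \<open>gmom\<close> of the flow, which is
  why the two limits agree.\<close>

lemma truncated_limit:
  assumes [measurable]: "\<And>n::nat. \<theta> n \<in> borel_measurable borel" and \<theta>: "\<And>n x. \<bar>\<theta> n x\<bar> \<le> 1"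
    and lim: "\<And>x. 0 < x \<Longrightarrow> (\<lambda>n. \<theta> n x) \<longlonglongrightarrow> 1"
  shows "(\<lambda>n. LBINT w. indicator (cball 0 r) w * (dkernel a w * (\<theta> n (norm w) * (v (y - w) - v y))))
    \<longlonglongrightarrow> dkernel_pv a r v y"
  unfolding dkernel_pv_def
proof (rule integral_dominated_convergence)
  have d: "\<bar>\<theta> n (norm w) * (v (y - w) - v y)\<bar> \<le> L * norm w" for w n
    using mult_mono[OF \<theta>[of n "norm w"] v_lip[of w]] by (simp add: abs_mult)
  show "integrable lborel (\<lambda>w::real^3. L * (indicator (cball 0 r) w / (norm w)\<^sup>2))"
    by (intro integrable_mult_right integrable_inverse_square)
  show "AE w in lborel. norm (indicator (cball 0 r) w * (dkernel a w * (\<theta> n (norm w) * (v (y - w) - v y))))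
       \<le> L * (indicator (cball 0 r) w / (norm w)\<^sup>2)" for n
    using dkernel_lipschitz_le[OF norm_a d, of r] by (intro AE_I2) simp
  show "AE w in lborel. (\<lambda>n. indicator (cball 0 r) w * (dkernel a w * (\<theta> n (norm w) * (v (y - w) - v y))))
       \<longlonglongrightarrow> indicator (cball 0 r) w * (dkernel a w * (v (y - w) - v y))"
  proof (rule AE_I2)
    fix w :: "real^3"
    show "(\<lambda>n. indicator (cball 0 r) w * (dkernel a w * (\<theta> n (norm w) * (v (y - w) - v y))))
       \<longlonglongrightarrow> indicator (cball 0 r) w * (dkernel a w * (v (y - w) - v y))"
    \<comment> \<open>At the origin the kernel is 0 by division by zero, so convergence of
      \<open>\<theta> n 0\<close> is not asked for.\<close>
    proof (cases "w = 0")
      case False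
      then have "(\<lambda>n. indicator (cball 0 r) w * (dkernel a w * (\<theta> n (norm w) * (v (y - w) - v y))))
       \<longlonglongrightarrow> indicator (cball 0 r) w * (dkernel a w * (1 * (v (y - w) - v y)))"
        by (intro tendsto_intros lim) simp
      then show ?thesis by simp
    qed (simp add: dkernel_def)
  qed
qed measurable

text \<open>The subtraction of \<open>v y\<close> is for free: the kernel has mean zero on spheres.\<close>

lemma truncated_eq:
  assumes [measurable]: "\<theta> \<in> borel_measurable borel" and \<theta>: "\<And>x. \<bar>\<theta> x\<bar> \<le> 1"
    and \<theta>3: "\<And>x. 0 \<le> x \<Longrightarrow> \<bar>\<theta> x\<bar> \<le> D * x ^ 3"
  shows "integrable lborel (\<lambda>w. dkernel a w * \<theta> (norm w) * v (y - w))"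
    and "(LBINT w. dkernel a w * \<theta> (norm w) * v (y - w))
     = (LBINT w. indicator (cball 0 r) w * (dkernel a w * (\<theta> (norm w) * (v (y - w) - v y))))"
proof -
  \<comment> \<open>Cutting at radius \<open>r\<close> makes the subtracted term integrable, while
    \<open>v (y - w)\<close> vanishes beyond \<open>r\<close>. The cubic bound on
    \<open>\<theta>\<close> removes the singularity at the origin.\<close>
  define \<eta> where "\<eta> x = indicator {..r} x * \<theta> x" for x
  have [measurable]: "\<eta> \<in> borel_measurable borel" unfolding \<eta>_def[abs_def] by measurable
  have ball: "integrable lborel (\<lambda>w. \<bar>D\<bar> * indicator (cball (0::real^3) r) w)"
    by (intro integrable_mult_right integrable_real_indicator emeasure_bounded_finite bounded_cball) simp
  have \<eta>_le: "\<bar>\<eta> (norm w)\<bar> \<le> \<bar>D\<bar> * norm w ^ 3 * indicator (cball 0 r) w" for w :: "real^3"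
  proof -
    have "\<bar>\<theta> (norm w)\<bar> \<le> \<bar>D\<bar> * norm w ^ 3"
      by (rule order_trans[OF \<theta>3]) (auto intro!: mult_right_mono)
    then show ?thesis by (auto simp: \<eta>_def indicator_def)
  qed
  have 1: "integrable lborel (\<lambda>w::real^3. \<eta> (norm w) / norm w ^ 3)"
  proof (rule Bochner_Integration.integrable_bound[OF ball])
    show "AE w in lborel. norm (\<eta> (norm w) / norm w ^ 3) \<le> norm (\<bar>D\<bar> * indicator (cball (0::real^3) r) w)"
    proof (rule AE_I2)
      fix w :: "real^3"
      show "norm (\<eta> (norm w) / norm w ^ 3) \<le> norm (\<bar>D\<bar> * indicator (cball (0::real^3) r) w)"
        using \<eta>_le[of w] by (cases "w = 0") (auto simp: field_simps abs_mult)
    qed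
  qed measurable
  have 2: "integrable lborel (\<lambda>w. dkernel a w * \<eta> (norm w))"
  proof (rule Bochner_Integration.integrable_bound[OF 1])
    show "AE w in lborel. norm (dkernel a w * \<eta> (norm w)) \<le> norm (\<eta> (norm w) / norm w ^ 3)"
    proof (rule AE_I2)
      fix w :: "real^3"
      have "\<bar>dkernel a w\<bar> * \<bar>\<eta> (norm w)\<bar> \<le> 1 / norm w ^ 3 * \<bar>\<eta> (norm w)\<bar>"
        by (intro mult_right_mono dkernel_le norm_a) simp
      then show "norm (dkernel a w * \<eta> (norm w)) \<le> norm (\<eta> (norm w) / norm w ^ 3)"
        by (simp add: abs_mult)
    qed
  qed measurable
  have eq: "dkernel a w * \<theta> (norm w) * v (y - w)
     = indicator (cball 0 r) w * (dkernel a w * (\<theta> (norm w) * (v (y - w) - v y)))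
       + v y * (dkernel a w * \<eta> (norm w))" for w
    using v_far[of w] by (auto simp: \<eta>_def indicator_def algebra_simps)
  note I = truncated_integrable(1)[OF assms(1,2)]
  show "integrable lborel (\<lambda>w. dkernel a w * \<theta> (norm w) * v (y - w))"
    unfolding eq by (intro Bochner_Integration.integrable_add I integrable_mult_right 2)
  show "(LBINT w. dkernel a w * \<theta> (norm w) * v (y - w))
     = (LBINT w. indicator (cball 0 r) w * (dkernel a w * (\<theta> (norm w) * (v (y - w) - v y))))"
    unfolding eq using I 2 dkernel_radial_integral[OF _ 1] by simp
qed

text \<open>Removing the ball of radius \<epsilon> corresponds to the multiplier
  \<open>indicator {\<epsilon><..}\<close>, which satisfies the cubic bound with constant
  \<epsilon>^(-3).\<close>

lemma has_pv_dkernel: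
  assumes v_int: "integrable lborel v"
  shows "has_pv_integral (\<lambda>z. dkernel a (y - z) * v z) y (dkernel_pv a r v y)"
  unfolding has_pv_integral_def
proof (intro conjI allI impI)
  fix \<epsilon> :: real assume \<epsilon>: "0 < \<epsilon>"
  show "set_integrable lborel {z. norm (y - z) > \<epsilon>} (\<lambda>z. dkernel a (y - z) * v z)"
    unfolding set_integrable_def
  proof (rule Bochner_Integration.integrable_bound)
    show "integrable lborel (\<lambda>z. 1 / \<epsilon> ^ 3 * v z)" using v_int by (rule integrable_mult_right)
    show "AE z in lborel. norm (indicator {z. \<epsilon> < norm (y - z)} z *\<^sub>R (dkernel a (y - z) * v z)) \<le> norm (1 / \<epsilon> ^ 3 * v z)"
    proof (rule AE_I2)
      fix z :: "real^3"
      have "\<bar>dkernel a (y - z)\<bar> * \<bar>v z\<bar> \<le> 1 / \<epsilon> ^ 3 * \<bar>v z\<bar>" if "\<epsilon> < norm (y - z)"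
      proof (intro mult_right_mono order_trans[OF dkernel_le[OF norm_a]] divide_left_mono power_mono)
        have "0 < norm (y - z)" using \<epsilon> that by linarith
        then show "0 < norm (y - z) ^ 3 * \<epsilon> ^ 3" using \<epsilon> by simp
      qed (use \<epsilon> that in auto)
      then show "norm (indicator {z. \<epsilon> < norm (y - z)} z *\<^sub>R (dkernel a (y - z) * v z)) \<le> norm (1 / \<epsilon> ^ 3 * v z)"
        using \<epsilon> by (auto simp: indicator_def abs_mult)
    qed
  qed measurable
next
  define \<theta> where "\<theta> \<epsilon> x = (indicator {\<epsilon><..} x :: real)" for \<epsilon> x :: real
  have eq: "(LINT z:{z. norm (y - z) > \<epsilon>}|lborel. dkernel a (y - z) * v z)
     = (LBINT w. indicator (cball 0 r) w * (dkernel a w * (\<theta> \<epsilon> (norm w) * (v (y - w) - v y))))"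
    if \<epsilon>: "0 < \<epsilon>" for \<epsilon>
  proof -
    have "(LINT z:{z. norm (y - z) > \<epsilon>}|lborel. dkernel a (y - z) * v z)
       = (LBINT z. dkernel a (y - z) * \<theta> \<epsilon> (norm (y - z)) * v (y - (y - z)))"
      unfolding set_lebesgue_integral_def \<theta>_def
      by (intro Bochner_Integration.integral_cong) (auto simp: indicator_def)
    also have "\<dots> = (LBINT w. dkernel a w * \<theta> \<epsilon> (norm w) * v (y - w))"
      unfolding \<theta>_def
      by (rule lborel_reflect(2)[of "\<lambda>w. dkernel a w * indicator {\<epsilon><..} (norm w) * v (y - w)" y]) measurable
    also have "\<dots> = (LBINT w. indicator (cball 0 r) w * (dkernel a w * (\<theta> \<epsilon> (norm w) * (v (y - w) - v y))))"
    proof (rule truncated_eq(2)[where D="1 / \<epsilon> ^ 3"])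
      fix x :: real assume x: "0 \<le> x"
      show "\<bar>\<theta> \<epsilon> x\<bar> \<le> 1 / \<epsilon> ^ 3 * x ^ 3"
      proof (cases "\<epsilon> < x")
        case True
        then have "\<epsilon> ^ 3 \<le> x ^ 3" using \<epsilon> by (intro power_mono) auto
        then show ?thesis using True \<epsilon> by (simp add: \<theta>_def field_simps)
      qed (use x \<epsilon> in \<open>auto simp: \<theta>_def indicator_def\<close>)
    qed (auto simp: \<theta>_def indicator_def)
    finally show ?thesis .
  qed
  show "((\<lambda>\<epsilon>. LINT z:{z. norm (y - z) > \<epsilon>}|lborel. dkernel a (y - z) * v z) \<longlongrightarrow> dkernel_pv a r v y) (at_right 0)"
  proof (rule tendsto_at_right_sequentially[where b=1])
    fix S :: "nat \<Rightarrow> real" assume S: "\<And>n. 0 < S n" "S \<longlonglongrightarrow> 0"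
    have "(\<lambda>n. LBINT w. indicator (cball 0 r) w * (dkernel a w * (\<theta> (S n) (norm w) * (v (y - w) - v y))))
       \<longlonglongrightarrow> dkernel_pv a r v y"
    proof (rule truncated_limit)
      fix x :: real assume x: "0 < x"
      have "\<forall>\<^sub>F n in sequentially. S n < x" using S(2) x by (rule order_tendstoD)
      then have "\<forall>\<^sub>F n in sequentially. \<theta> (S n) x = 1" by eventually_elim (simp add: \<theta>_def)
      then show "(\<lambda>n. \<theta> (S n) x) \<longlonglongrightarrow> 1" by (rule tendsto_eventually)
    qed (auto simp: \<theta>_def indicator_def)
    then show "(\<lambda>n. LINT z:{z. norm (y - z) > S n}|lborel. dkernel a (y - z) * v z) \<longlonglongrightarrow> dkernel_pv a r v y"
      using S(1) by (simp add: eq)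
  qed simp
qed

lemma heat_integral: "0 < s \<Longrightarrow> (LBINT w. heat s w) = 1" "0 < s \<Longrightarrow> integrable lborel (heat s)"
proof -
  assume s: "0 < s"
  have nn: "0 \<le> heat s w" for w using s by (simp add: heat_def)
  show I: "integrable lborel (heat s)"
    by (rule integrableI_nonneg) (use nn nn_integral_heat[OF s] in auto)
  have "ennreal (LBINT w. heat s w) = 1"
    using nn_integral_eq_integral[OF I] nn nn_integral_heat[OF s] by simp
  then show "(LBINT w. heat s w) = 1" by simp
qed

lemma heat_integrable: "0 < s \<Longrightarrow> integrable lborel (\<lambda>w. heat s w * v (y - w))"
  and heat_bound: "0 < s \<Longrightarrow> \<bar>LBINT w. heat s w * v (y - w)\<bar> \<le> C"
proof -
  assume s: "0 < s"
  have nn: "0 \<le> heat s w" for w using s by (simp add: heat_def)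
  have J: "integrable lborel (\<lambda>w. C * heat s w)" using heat_integral(2)[OF s] by simp
  have le: "\<bar>heat s w * v (y - w)\<bar> \<le> C * heat s w" for w
    using mult_right_mono[OF v_bound[of "y - w"] nn[of w]] nn[of w] by (simp add: abs_mult mult.commute)
  show I: "integrable lborel (\<lambda>w. heat s w * v (y - w))"
  proof (rule Bochner_Integration.integrable_bound[OF J])
    show "AE w in lborel. norm (heat s w * v (y - w)) \<le> norm (C * heat s w)"
      by (intro AE_I2) (unfold real_norm_def, rule order_trans[OF le abs_ge_self])
  qed measurable
  have "\<bar>LBINT w. heat s w * v (y - w)\<bar> \<le> (LBINT w. \<bar>heat s w * v (y - w)\<bar>)"
    by (rule integral_abs_bound)
  also have "\<dots> \<le> (LBINT w. C * heat s w)" by (intro integral_mono integrable_abs I J le)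
  finally show "\<bar>LBINT w. heat s w * v (y - w)\<bar> \<le> C" using heat_integral(1)[OF s] by simp
qed

text \<open>Rescaling \<open>w\<close> by \<open>sqrt s\<close> fixes the Gaussian and moves the
  time into the argument of \<open>v\<close>, where the Lipschitz bound at \<open>y\<close> gives
  the limit.\<close>

lemma heat_limit:
  assumes S: "\<And>n. 0 < S n" "S \<longlonglongrightarrow> 0"
  shows "(\<lambda>n. LBINT w. heat (S n) w * v (y - w)) \<longlonglongrightarrow> v y"
proof -
  have scale: "(LBINT w. heat s w * v (y - w)) = (LBINT w. heat 1 w * v (y - sqrt s *\<^sub>R w))"
    if s: "0 < s" for s
  proof -
    have h: "sqrt s ^ 3 * heat s (sqrt s *\<^sub>R w) = heat 1 w" for w
    proof -
      have "(norm (sqrt s *\<^sub>R w))\<^sup>2 / (2 * s) = (norm w)\<^sup>2 / (2 * 1)"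
        using s by (simp add: power_mult_distrib)
      moreover have "sqrt (2 * pi * s) ^ 3 = sqrt s ^ 3 * sqrt (2 * pi * 1) ^ 3"
        by (simp add: real_sqrt_mult power_mult_distrib)
      ultimately show ?thesis unfolding heat_def using s by simp
    qed
    have "(LBINT w. heat s w * v (y - w))
      = (LINT w|density (distr lborel borel (\<lambda>x. 0 + sqrt s *\<^sub>R x)) (\<lambda>_. ennreal (\<bar>sqrt s\<bar> ^ DIM(real^3))). heat s w * v (y - w))"
      using s by (subst lborel_affine[of "sqrt s" "0::real^3"]) auto
    also have "\<dots> = (LINT w|distr lborel borel (\<lambda>x. 0 + sqrt s *\<^sub>R x). sqrt s ^ 3 * (heat s w * v (y - w)))"
      using s by (subst integral_density) auto
    also have "\<dots> = (LBINT w. sqrt s ^ 3 * (heat s (sqrt s *\<^sub>R w) * v (y - sqrt s *\<^sub>R w)))"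
      by (subst integral_distr) auto
    also have "\<dots> = (LBINT w. heat 1 w * v (y - sqrt s *\<^sub>R w))"
      by (simp only: mult.assoc[symmetric] h)
    finally show ?thesis .
  qed
  have "(\<lambda>n. LBINT w. heat 1 w * v (y - sqrt (S n) *\<^sub>R w)) \<longlonglongrightarrow> (LBINT w. heat 1 w * v y)"
  proof (rule integral_dominated_convergence)
    show "integrable lborel (\<lambda>w. C * heat 1 w)" using heat_integral(2)[of 1] by simp
    have nn: "0 \<le> heat 1 w" for w by (simp add: heat_def)
    show "AE w in lborel. norm (heat 1 w * v (y - sqrt (S n) *\<^sub>R w)) \<le> C * heat 1 w" for n
    proof (rule AE_I2)
      fix w :: "real^3"
      show "norm (heat 1 w * v (y - sqrt (S n) *\<^sub>R w)) \<le> C * heat 1 w"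
        using mult_right_mono[OF v_bound[of "y - sqrt (S n) *\<^sub>R w"] nn[of w]] nn[of w]
        by (simp add: abs_mult mult.commute)
    qed
    show "AE w in lborel. (\<lambda>n. heat 1 w * v (y - sqrt (S n) *\<^sub>R w)) \<longlonglongrightarrow> heat 1 w * v y"
    proof (rule AE_I2)
      fix w :: "real^3"
      have "(\<lambda>n. v (y - sqrt (S n) *\<^sub>R w)) \<longlonglongrightarrow> v y"
      proof (rule LIM_zero_cancel, rule Lim_null_comparison)
        show "\<forall>\<^sub>F n in sequentially. norm (v (y - sqrt (S n) *\<^sub>R w) - v y) \<le> L * (\<bar>sqrt (S n)\<bar> * norm w)"
          using v_lip[of "sqrt (S n) *\<^sub>R w" for n] by simp
        have "(\<lambda>n. L * (\<bar>sqrt (S n)\<bar> * norm w)) \<longlonglongrightarrow> L * (\<bar>sqrt 0\<bar> * norm w)"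
          by (intro tendsto_intros S)
        then show "(\<lambda>n. L * (\<bar>sqrt (S n)\<bar> * norm w)) \<longlonglongrightarrow> 0" by simp
      qed
      then show "(\<lambda>n. heat 1 w * v (y - sqrt (S n) *\<^sub>R w)) \<longlonglongrightarrow> heat 1 w * v y" by (intro tendsto_intros)
    qed
  qed measurable
  then show ?thesis using heat_integral(1)[of 1] S(1) by (simp add: scale)
qed

text \<open>The bound in the second part is free of \<open>s\<close>; it dominates the limit
  \<open>s \<rightarrow> 0\<close> once this is integrated against \<open>u\<close>.\<close>

lemma flow_kernel_integral:
  assumes s: "0 < s"
  shows "(LBINT w. flow_kernel a s w * v (y - w))
    = - (LBINT w. indicator (cball 0 r) w * (dkernel a w * (gmom (norm w / sqrt s) / gmom_inf * (v (y - w) - v y))))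
      + (LBINT w. heat s w * v (y - w)) / 3" (is "_ = - ?T + _")
    and "\<bar>LBINT w. flow_kernel a s w * v (y - w)\<bar>
      \<le> L * (LBINT w. indicator (cball (0::real^3) r) w / (norm w)\<^sup>2) + C"
proof -
  define \<theta> where "\<theta> x = gmom (x / sqrt s) / gmom_inf" for x
  have [measurable]: "\<theta> \<in> borel_measurable borel" unfolding \<theta>_def[abs_def] by measurable
  have i1: "0 < gmom_inf" using gmom_inf_ge_1 by simp
  have \<theta>1: "\<bar>\<theta> x\<bar> \<le> 1" for x
    using gmom_nonneg[of "x / sqrt s"] gmom_le_inf[of "x / sqrt s"] i1 by (simp add: \<theta>_def)
  \<comment> \<open>For \<open>x \<le> sqrt s\<close> the fifth power bound is stronger than a cubic
    one; beyond, the bound by 1 suffices.\<close>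
  have \<theta>3: "\<bar>\<theta> x\<bar> \<le> (1 / sqrt s ^ 3) * x ^ 3" if "0 \<le> x" for x
  proof (cases "x / sqrt s \<le> 1")
    case True
    have x: "0 \<le> x / sqrt s" using that s by simp
    have "\<bar>\<theta> x\<bar> = gmom (x / sqrt s) / gmom_inf" using gmom_nonneg i1 by (simp add: \<theta>_def)
    also have "\<dots> \<le> (x / sqrt s) ^ 5 / 1"
      using gmom_le_power[OF x] gmom_nonneg gmom_inf_ge_1 x by (intro frac_le zero_le_power) auto
    also have "\<dots> \<le> (x / sqrt s) ^ 3"
      using x True power_decreasing[of 3 5 "x / sqrt s"] by simp
    finally show ?thesis by (simp add: power_divide)
  next
    case False
    then have "1 \<le> (x / sqrt s) ^ 3" by (intro one_le_power) auto
    then show ?thesis using \<theta>1[of x] by (simp add: power_divide)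
  qed
  note E = truncated_eq[OF _ \<theta>1 \<theta>3]
  note I = truncated_integrable[OF _ \<theta>1]
  have T: "?T = (LBINT w. indicator (cball 0 r) w * (dkernel a w * (\<theta> (norm w) * (v (y - w) - v y))))"
    by (simp add: \<theta>_def)
  have "flow_kernel a s w * v (y - w) = - (dkernel a w * \<theta> (norm w) * v (y - w)) + heat s w * v (y - w) / 3" for w
    unfolding flow_kernel_def \<theta>_def by (simp add: algebra_simps)
  then show eq: "(LBINT w. flow_kernel a s w * v (y - w)) = - ?T + (LBINT w. heat s w * v (y - w)) / 3"
    unfolding T using E heat_integrable[OF s] by simp
  have "\<bar>?T\<bar> \<le> L * (LBINT w. indicator (cball (0::real^3) r) w / (norm w)\<^sup>2)"
    unfolding T by (rule I(2)) simp
  then show "\<bar>LBINT w. flow_kernel a s w * v (y - w)\<bar>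
      \<le> L * (LBINT w. indicator (cball (0::real^3) r) w / (norm w)\<^sup>2) + C"
    unfolding eq using heat_bound[OF s] by linarith
qed

lemma flow_kernel_limit:
  assumes S: "\<And>n. 0 < S n" "S \<longlonglongrightarrow> 0"
  shows "(\<lambda>n. LBINT w. flow_kernel a (S n) w * v (y - w)) \<longlonglongrightarrow> - dkernel_pv a r v y + v y / 3"
proof -
  have i1: "0 < gmom_inf" using gmom_inf_ge_1 by simp
  have "(\<lambda>n. LBINT w. indicator (cball 0 r) w * (dkernel a w * (gmom (norm w / sqrt (S n)) / gmom_inf * (v (y - w) - v y))))
    \<longlonglongrightarrow> dkernel_pv a r v y"
  proof (rule truncated_limit[where \<theta>="\<lambda>n x. gmom (x / sqrt (S n)) / gmom_inf"])
    show "\<bar>gmom (x / sqrt (S n)) / gmom_inf\<bar> \<le> 1" for n x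
      using gmom_nonneg[of "x / sqrt (S n)"] gmom_le_inf[of "x / sqrt (S n)"] i1 by simp
    fix x :: real assume x: "0 < x"
    have "(\<lambda>n. sqrt (S n)) \<longlonglongrightarrow> sqrt 0" by (intro tendsto_intros S)
    then have "filterlim (\<lambda>n. sqrt (S n)) (at_right 0) sequentially"
      using S(1) by (intro tendsto_imp_filterlim_at_right) auto
    then have "filterlim (\<lambda>n. inverse (sqrt (S n))) at_top sequentially"
      by (rule filterlim_compose[OF filterlim_inverse_at_top_right])
    then have "filterlim (\<lambda>n. x * inverse (sqrt (S n))) at_top sequentially"
      by (rule filterlim_tendsto_pos_mult_at_top[OF tendsto_const x])
    then have "(\<lambda>n. gmom (x * inverse (sqrt (S n)))) \<longlonglongrightarrow> gmom_inf"
      by (rule filterlim_compose[OF gmom_tendsto])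
    then have "(\<lambda>n. gmom (x * inverse (sqrt (S n))) / gmom_inf) \<longlonglongrightarrow> gmom_inf / gmom_inf"
      using i1 by (intro tendsto_divide) auto
    then show "(\<lambda>n. gmom (x / sqrt (S n)) / gmom_inf) \<longlonglongrightarrow> 1"
      using i1 by (simp add: divide_inverse)
  qed measurable
  then show ?thesis
    unfolding flow_kernel_integral(1)[OF S(1)]
    by (intro tendsto_intros heat_limit S) auto
qed

end

text \<open>The Lipschitz bound is asked only on the support of \<open>u\<close>, because in the
  application \<open>v\<close> is cut off sharply on a larger ball and jumps at its
  boundary.\<close>

locale lipschitz_flow = flow a b c u v \<rho> for a b c u v \<rho> +
  fixes L :: real
  assumes lip: "u y \<noteq> 0 \<Longrightarrow> \<bar>v (y - w) - v y\<bar> \<le> L * norm w"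
begin

text \<open>The singular integral operator \<open>-\<partial>\<^sub>a\<^sup>2 \<Delta>\<^sup>-\<^sup>1\<close> in the unit direction \<open>a\<close> is
  the principal value minus one third of the identity.\<close>

lemma singular_integral_bound:
  shows "integrable lborel (\<lambda>y. u y * (dkernel_pv a (2 * \<rho>) v y - v y / 3))"
    and "\<bar>LBINT y. u y * (dkernel_pv a (2 * \<rho>) v y - v y / 3)\<bar>
      \<le> 25 * (LBINT x. bellman (u x) (v x))"
proof -
  obtain C where C: "C > 0" "\<And>x. \<bar>v x\<bar> \<le> C" using v bdd_int_bounded by blast
  have kp: "kernel_point a b c v y (2 * \<rho>) L C" if "u y \<noteq> 0" for y
  proof unfold_locales
    show "norm w \<le> 2 * \<rho>" if "v (y - w) \<noteq> 0" for w
      using product_support[of y w] that \<open>u y \<noteq> 0\<close> by simp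
  qed (use C lip[OF that] in auto)
  define S where "S n = inverse (real (Suc n))" for n
  have S: "\<And>n. 0 < S n" "S \<longlonglongrightarrow> 0"
    unfolding S_def using LIMSEQ_inverse_real_of_nat by auto
  define I where "I = (LBINT w. indicator (cball (0::real^3) (2 * \<rho>)) w / (norm w)\<^sup>2)"
  define F where "F n y = u y * (LBINT w. flow_kernel a (S n) w * v (y - w))" for n y
  define f where "f y = u y * (- dkernel_pv a (2 * \<rho>) v y + v y / 3)" for y
  have F_meas: "F n \<in> borel_measurable borel" for n
    unfolding F_def[abs_def] by measurable
  have conv: "(\<lambda>n. F n y) \<longlonglongrightarrow> f y" for y
  proof (cases "u y = 0")
    case False
    interpret kernel_point a b c v y "2 * \<rho>" L C by (rule kp[OF False])
    show ?thesis unfolding F_def f_def by (intro tendsto_mult tendsto_const flow_kernel_limit S)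
  qed (simp add: F_def f_def)
  have bound: "\<bar>F n y\<bar> \<le> (L * I + C) * \<bar>u y\<bar>" for n y
  proof (cases "u y = 0")
    case False
    interpret kernel_point a b c v y "2 * \<rho>" L C by (rule kp[OF False])
    show ?thesis
      unfolding F_def abs_mult I_def mult.commute[of _ "\<bar>u y\<bar>"]
      by (intro mult_left_mono flow_kernel_integral(2) S) simp
  qed (simp add: F_def)
  have f_meas: "f \<in> borel_measurable lborel"
    by (rule borel_measurable_LIMSEQ_real[OF conv]) (simp add: F_meas)
  have dom: "integrable lborel (\<lambda>y. (L * I + C) * \<bar>u y\<bar>)"
    using bdd_int_integrable[OF u] by (intro integrable_mult_right integrable_abs)
  have int_f: "integrable lborel f"
    by (rule integrable_dominated_convergence[OF f_meas _ dom, where s=F])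
       (use conv bound F_meas in auto)
  have lim: "(\<lambda>n. LBINT y. F n y) \<longlonglongrightarrow> (LBINT y. f y)"
    by (rule integral_dominated_convergence[OF f_meas _ dom])
       (use conv bound F_meas in auto)
  have "\<bar>LBINT y. F n y\<bar> \<le> 25 * (LBINT x. bellman (u x) (v x))" for n
  proof -
    have "pairing (flow_kernel a (S n)) u v = (LBINT y. F n y)"
      unfolding F_def by (rule pairing_iterated) (use flow_kernel_bdd S in auto)
    then show ?thesis using flow_bound[OF S(1)[of n]] by simp
  qed
  then have le: "\<bar>LBINT y. f y\<bar> \<le> 25 * (LBINT x. bellman (u x) (v x))"
    by (intro LIMSEQ_le_const2[OF tendsto_rabs[OF lim]]) auto
  have neg: "u y * (dkernel_pv a (2 * \<rho>) v y - v y / 3) = - f y" for y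
    by (simp add: f_def algebra_simps)
  show "integrable lborel (\<lambda>y. u y * (dkernel_pv a (2 * \<rho>) v y - v y / 3))"
    unfolding neg using int_f by simp
  show "\<bar>LBINT y. u y * (dkernel_pv a (2 * \<rho>) v y - v y / 3)\<bar> \<le> 25 * (LBINT x. bellman (u x) (v x))"
    unfolding neg using le by simp
qed

end

section \<open>Weighted integrals\<close>

definition ball_const :: real where "ball_const = unit_ball_vol (real DIM(real^3))"

lemma ball_const_nonneg: "0 \<le> ball_const" by (simp add: ball_const_def)

lemma emeasure_cball3: "0 \<le> t \<Longrightarrow> emeasure lborel (cball (0::real^3) t) = ennreal (ball_const * t ^ 3)"
  using emeasure_cball[of t "0::real^3"] by (simp add: ball_const_def)

text \<open>Layers again: |z|^(-5) is the integral of 5 t^(-6) over t >= |z|. After the exchange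
  whole balls are integrated, including |z| < R, hence an inequality.\<close>

lemma exterior_nn_integral:
  assumes R: "0 < R"
  shows "(\<integral>\<^sup>+z. ennreal (indicator {z. R \<le> norm z} (z::real^3) / norm z ^ 5) \<partial>lborel) \<le> ennreal (5 * ball_const / (2 * R\<^sup>2))"
proof -
  let ?g = "\<lambda>(z::real^3) t. ennreal (5 / t ^ 6) * indicator {R..} t * indicator {p. norm (fst p) \<le> snd p} (z, t)"
  have pt: "ennreal (indicator {z. R \<le> norm z} z / norm z ^ 5) \<le> (\<integral>\<^sup>+t. ?g z t \<partial>lborel)" for z :: "real^3"
  proof (cases "R \<le> norm z")
    case True
    then have z: "0 < norm z" using R by linarith
    have "(\<integral>\<^sup>+t. ennreal (5 / t ^ 6) * indicator {norm z..} t \<partial>lborel) = ennreal (0 - (- (1 / norm z ^ 5)))"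
    proof (rule nn_integral_FTC_atLeast)
      fix t assume t: "norm z \<le> t"
      then have "0 < t" using z by linarith
      then show "((\<lambda>t. - (1 / t ^ 5)) has_real_derivative 5 / t ^ 6) (at t)"
        by (auto intro!: derivative_eq_intros simp: field_simps eval_nat_numeral)
      show "0 \<le> 5 / t ^ 6" using \<open>0 < t\<close> by simp
    next
      have "((\<lambda>t::real. - (inverse t ^ 5)) \<longlongrightarrow> - (0 ^ 5)) at_top"
        by (intro tendsto_intros tendsto_inverse_0_at_top filterlim_ident)
      then show "((\<lambda>t::real. - (1 / t ^ 5)) \<longlongrightarrow> 0) at_top" by (simp add: power_inverse divide_inverse)
    qed simp
    moreover have "(\<integral>\<^sup>+t. ennreal (5 / t ^ 6) * indicator {norm z..} t \<partial>lborel) = (\<integral>\<^sup>+t. ?g z t \<partial>lborel)"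
      using True by (intro nn_integral_cong) (auto simp: indicator_def)
    ultimately show ?thesis using True by simp
  qed simp
  have "(\<integral>\<^sup>+z. ennreal (indicator {z. R \<le> norm z} (z::real^3) / norm z ^ 5) \<partial>lborel)
     \<le> (\<integral>\<^sup>+z. \<integral>\<^sup>+t. ?g z t \<partial>lborel \<partial>lborel)"
    by (intro nn_integral_mono pt)
  also have "\<dots> = (\<integral>\<^sup>+t. \<integral>\<^sup>+z. ?g z t \<partial>lborel \<partial>lborel)"
    by (rule lborel_pair.Fubini') simp
  also have "\<dots> = (\<integral>\<^sup>+t. ennreal (5 * ball_const / t ^ 3) * indicator {R..} t \<partial>lborel)"
  proof (rule nn_integral_cong)
    fix t :: real
    show "(\<integral>\<^sup>+z. ?g z t \<partial>lborel) = ennreal (5 * ball_const / t ^ 3) * indicator {R..} t"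
    proof (cases "R \<le> t")
      case True
      then have t: "0 < t" using R by linarith
      have "(\<integral>\<^sup>+z. ?g z t \<partial>lborel) = (\<integral>\<^sup>+z. ennreal (5 / t ^ 6) * indicator (cball 0 t) (z::real^3) \<partial>lborel)"
        using True by (intro nn_integral_cong) (auto simp: indicator_def)
      also have "\<dots> = ennreal (5 / t ^ 6) * ennreal (ball_const * t ^ 3)"
        using t by (simp add: nn_integral_cmult_indicator emeasure_cball3)
      also have "\<dots> = ennreal (5 * ball_const / t ^ 3)"
        using t ball_const_nonneg by (simp add: ennreal_mult[symmetric] field_simps eval_nat_numeral)
      finally show ?thesis using True by simp
    qed simp
  qed
  also have "\<dots> = ennreal (0 - (- (5 * ball_const / (2 * R\<^sup>2))))"
  proof (rule nn_integral_FTC_atLeast)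
    fix t assume t: "R \<le> t"
    then have "0 < t" using R by linarith
    then show "((\<lambda>t. - (5 * ball_const / (2 * t\<^sup>2))) has_real_derivative 5 * ball_const / t ^ 3) (at t)"
      by (auto intro!: derivative_eq_intros simp: field_simps eval_nat_numeral)
    show "0 \<le> 5 * ball_const / t ^ 3" using \<open>0 < t\<close> ball_const_nonneg by simp
  next
    have "((\<lambda>t::real. - (5 * ball_const / 2 * (inverse t ^ 2))) \<longlongrightarrow> - (5 * ball_const / 2 * 0 ^ 2)) at_top"
      by (intro tendsto_intros tendsto_inverse_0_at_top filterlim_ident)
    moreover have "- (5 * ball_const / 2 * (inverse t ^ 2)) = - (5 * ball_const / (2 * t\<^sup>2))" for t :: real
      by (cases "t = 0") (simp_all add: field_simps)
    ultimately show "((\<lambda>t::real. - (5 * ball_const / (2 * t\<^sup>2))) \<longlongrightarrow> 0) at_top"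
      by (simp only:) simp
  qed simp
  finally show ?thesis by simp
qed

lemma exterior_integral:
  assumes R: "0 < R"
  shows "integrable lborel (\<lambda>z::real^3. indicator {z. R \<le> norm z} z / norm z ^ 5)"
    and "(LBINT z. indicator {z. R \<le> norm z} (z::real^3) / norm z ^ 5) \<le> 5 * ball_const / (2 * R\<^sup>2)"
proof -
  show I: "integrable lborel (\<lambda>z::real^3. indicator {z. R \<le> norm z} z / norm z ^ 5)"
    by (rule integrableI_nonneg) (use le_less_trans[OF exterior_nn_integral[OF R], of \<infinity>] in auto)
  have "ennreal (LBINT z. indicator {z. R \<le> norm z} (z::real^3) / norm z ^ 5) \<le> ennreal (5 * ball_const / (2 * R\<^sup>2))"
    using nn_integral_eq_integral[OF I] exterior_nn_integral[OF R] by simp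
  then show "(LBINT z. indicator {z. R \<le> norm z} (z::real^3) / norm z ^ 5) \<le> 5 * ball_const / (2 * R\<^sup>2)"
    using ball_const_nonneg by (simp add: ennreal_le_iff)
qed

text \<open>Comparable to 1/R, the size of the cutoff gradient, for |z| <= R, and to R/|z|^2, the
  tail caused by the pressure, beyond. It scales as weight 1 (z/R) / R.\<close>

definition weight :: "real \<Rightarrow> real^3 \<Rightarrow> real" where
  "weight R z = R / (R\<^sup>2 + (norm z)\<^sup>2)"

lemma weight_measurable [measurable]: "weight R \<in> borel_measurable borel"
  unfolding weight_def[abs_def] by measurable

lemma weight_nonneg: "0 < R \<Longrightarrow> 0 \<le> weight R z"
  by (simp add: weight_def)

lemma weight_le: assumes "0 < R" shows "weight R z \<le> 1 / R"
proof -
  have "R / (R\<^sup>2 + (norm z)\<^sup>2) \<le> R / R\<^sup>2" using assms by (intro divide_left_mono mult_pos_pos add_pos_nonneg) auto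
  then show ?thesis using assms by (simp add: weight_def power2_eq_square)
qed

definition weight_const :: real where "weight_const = ball_const + 5 * ball_const / 2"

text \<open>Inside the ball the cube is at most R^(-3); outside it is at most R^3/|z|^6 <=
  R^2/|z|^5. Both contributions are independent of R.\<close>

lemma weight_cube:
  assumes R: "0 < R"
  shows "integrable lborel (\<lambda>z. weight R z ^ 3)" and "(LBINT z. weight R z ^ 3) \<le> weight_const"
proof -
  have B: "integrable lborel (\<lambda>z. 1 / R ^ 3 * indicator (cball (0::real^3) R) z)"
    by (intro integrable_mult_right integrable_real_indicator emeasure_bounded_finite bounded_cball) simp
  note E = exterior_integral[OF R]
  have J: "integrable lborel (\<lambda>z::real^3. 1 / R ^ 3 * indicator (cball 0 R) z + R\<^sup>2 * (indicator {z. R \<le> norm z} z / norm z ^ 5))"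
    by (intro Bochner_Integration.integrable_add B integrable_mult_right E(1))
  have le: "weight R z ^ 3 \<le> 1 / R ^ 3 * indicator (cball 0 R) z + R\<^sup>2 * (indicator {z. R \<le> norm z} z / norm z ^ 5)" for z
  proof (cases "norm z \<le> R")
    case True
    have "weight R z ^ 3 \<le> (1 / R) ^ 3" by (intro power_mono weight_le weight_nonneg R)
    also have "\<dots> = 1 / R ^ 3" by (simp add: power_divide)
    also have "\<dots> \<le> 1 / R ^ 3 * indicator (cball 0 R) z + R\<^sup>2 * (indicator {z. R \<le> norm z} z / norm z ^ 5)"
      using True R by (simp add: indicator_def)
    finally show ?thesis .
  next
    case False
    then have z: "0 < norm z" "R < norm z" using R by linarith+
    have "weight R z \<le> R / (norm z)\<^sup>2" unfolding weight_def using z R by (intro divide_left_mono mult_pos_pos add_pos_nonneg zero_less_power) auto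
    then have "weight R z ^ 3 \<le> (R / (norm z)\<^sup>2) ^ 3" by (intro power_mono weight_nonneg R)
    also have "\<dots> = R\<^sup>2 * (R / norm z) / norm z ^ 5" using z by (simp add: field_simps eval_nat_numeral)
    also have "\<dots> \<le> R\<^sup>2 * 1 / norm z ^ 5" using z R by (intro divide_right_mono mult_left_mono) auto
    finally show ?thesis using z R by (simp add: indicator_def)
  qed
  show I: "integrable lborel (\<lambda>z. weight R z ^ 3)"
  proof (rule Bochner_Integration.integrable_bound[OF J])
    show "AE z in lborel. norm (weight R z ^ 3) \<le> norm (1 / R ^ 3 * indicator (cball 0 R) z + R\<^sup>2 * (indicator {z. R \<le> norm z} z / norm z ^ 5))"
      using order_trans[OF le abs_ge_self] weight_nonneg[OF R] by (intro AE_I2) simp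
  qed measurable
  have "(LBINT z. weight R z ^ 3) \<le> (LBINT z. 1 / R ^ 3 * indicator (cball (0::real^3) R) z + R\<^sup>2 * (indicator {z. R \<le> norm z} z / norm z ^ 5))"
    by (rule integral_mono[OF I J le])
  also have "\<dots> = 1 / R ^ 3 * measure lborel (cball (0::real^3) R) + R\<^sup>2 * (LBINT z. indicator {z. R \<le> norm z} (z::real^3) / norm z ^ 5)"
    using B E(1) by (subst Bochner_Integration.integral_add) (auto simp del: times_divide_eq_left times_divide_eq_right)
  also have "\<dots> \<le> 1 / R ^ 3 * (ball_const * R ^ 3) + R\<^sup>2 * (5 * ball_const / (2 * R\<^sup>2))"
    using E(2) R ball_const_nonneg emeasure_cball3[of R] by (intro add_mono mult_left_mono) (auto simp: measure_def)
  also have "\<dots> = weight_const" using R by (simp add: weight_const_def)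
  finally show "(LBINT z. weight R z ^ 3) \<le> weight_const" .
qed

text \<open>A Young inequality for all exponents at once: if \<open>x \<ge> 1\<close> then x w <=
  x^p; if \<open>w \<le> sqrt x\<close> then x w <= x^(3/2) <= x^p; otherwise x < w^2 and x w <=
  w^3. With p = r/3 the bound \<open>p \<le> 3/2\<close> is the condition r <= 9/2.\<close>

lemma young_weight:
  fixes x w p :: real
  assumes x: "0 \<le> x" and w: "0 \<le> w" "w \<le> 1" and p: "1 \<le> p" "p \<le> 3/2"
  shows "x * w \<le> x powr p + w ^ 3"
proof (cases "1 \<le> x")
  case True
  have "x * w \<le> x powr 1 * 1" using x w True by (intro mult_mono) auto
  also have "\<dots> \<le> x powr p * 1" using powr_mono[of 1 p x] True p by simp
  finally show ?thesis using w by (simp add: add_increasing2)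
next
  case False
  show ?thesis
  proof (cases "w \<le> sqrt x")
    case True
    show ?thesis
    proof (cases "x = 0")
      case False
      then have x0: "0 < x" using x by simp
      have "x * w \<le> x * sqrt x" using True x by (intro mult_left_mono) auto
      also have "\<dots> = x powr (3/2)"
        using x0 powr_add[of x 1 "1/2"] by (simp add: powr_half_sqrt)
      also have "\<dots> \<le> x powr p" using x0 \<open>\<not> 1 \<le> x\<close> p by (intro powr_mono') auto
      finally show ?thesis using w by (simp add: add_increasing2)
    qed (use w in simp)
  next
    case False
    then have "(sqrt x)\<^sup>2 \<le> w\<^sup>2" using x by (intro power_mono) auto
    then have "x \<le> w\<^sup>2" using x by simp
    then have "x * w \<le> w\<^sup>2 * w" using w by (intro mult_right_mono)
    then show ?thesis by (simp add: power3_eq_cube power2_eq_square add_increasing)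
  qed
qed

text \<open>Young's inequality is applied to g^3/t and made homogeneous by the choice of
  \<open>t\<close>. If the norm of \<open>g\<close> vanishes there is no optimal \<open>t\<close>,
  and \<open>t\<close> tends to 0 instead.\<close>

lemma weighted_cube_integral:
  fixes g :: "real^3 \<Rightarrow> real"
  assumes [measurable]: "g \<in> borel_measurable borel" and g0: "\<And>z. 0 \<le> g z"
    and r: "3 \<le> r" "r \<le> 9/2" and int: "integrable lborel (\<lambda>z. g z powr r)" and R: "1 \<le> R"
  shows "integrable lborel (\<lambda>z. g z ^ 3 * weight R z)"
    and "(LBINT z. g z ^ 3 * weight R z) \<le> (1 + weight_const) * (LBINT z. g z powr r) powr (3 / r)"
proof -
  define N where "N = (LBINT z. g z powr r)"
  \<comment> \<open>The cube of the L^r norm: for \<open>t = m\<close> the two terms become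
    \<open>m\<close> and \<open>weight_const * m\<close>.\<close>
  define m where "m = N powr (3 / r)"
  have N0: "0 \<le> N" unfolding N_def by (intro integral_nonneg_AE) auto
  have R0: "0 < R" using R by simp
  have w1: "weight R z \<le> 1" for z using weight_le[OF R0, of z] R by (auto intro: order_trans)
  have pr: "(g z ^ 3) powr (r / 3) = g z powr r" for z
  proof (cases "g z = 0")
    case False
    then have "0 < g z" using g0[of z] by simp
    then have e: "g z ^ 3 = g z powr 3" by simp
    show ?thesis unfolding e powr_powr by simp
  qed simp
  have scaled: "g z ^ 3 * weight R z \<le> t * (g z powr r / t powr (r / 3) + weight R z ^ 3)" if t: "0 < t" for t z
  proof -
    have "g z ^ 3 / t * weight R z \<le> (g z ^ 3 / t) powr (r / 3) + weight R z ^ 3"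
      using g0[of z] t r weight_nonneg[OF R0] w1 by (intro young_weight) auto
    also have "(g z ^ 3 / t) powr (r / 3) = g z powr r / t powr (r / 3)"
      using g0[of z] t by (simp add: powr_divide pr)
    finally show ?thesis using t by (simp add: field_simps)
  qed
  have J: "integrable lborel (\<lambda>z. t * (g z powr r / t powr (r / 3) + weight R z ^ 3))" for t
    by (intro integrable_mult_right Bochner_Integration.integrable_add integrable_divide int weight_cube(1) R0)
  show I: "integrable lborel (\<lambda>z. g z ^ 3 * weight R z)"
  proof (rule Bochner_Integration.integrable_bound[OF J[of 1]])
    show "AE z in lborel. norm (g z ^ 3 * weight R z) \<le> norm (1 * (g z powr r / 1 powr (r / 3) + weight R z ^ 3))"
      using order_trans[OF scaled[of 1] abs_ge_self] g0 weight_nonneg[OF R0] by (intro AE_I2) (simp add: abs_mult)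
  qed measurable
  have le: "(LBINT z. g z ^ 3 * weight R z) \<le> t * (N / t powr (r / 3) + weight_const)" if t: "0 < t" for t
  proof -
    have "(LBINT z. g z ^ 3 * weight R z) \<le> (LBINT z. t * (g z powr r / t powr (r / 3) + weight R z ^ 3))"
      by (intro integral_mono I J scaled t)
    also have "\<dots> = t * (N / t powr (r / 3) + (LBINT z. weight R z ^ 3))"
      using int weight_cube(1)[OF R0] by (simp add: N_def)
    also have "\<dots> \<le> t * (N / t powr (r / 3) + weight_const)"
      using weight_cube(2)[OF R0] t by (intro mult_left_mono add_left_mono) auto
    finally show ?thesis .
  qed
  show "(LBINT z. g z ^ 3 * weight R z) \<le> (1 + weight_const) * (LBINT z. g z powr r) powr (3 / r)"
  proof (cases "N = 0")
    case True
    have "((\<lambda>t. t * weight_const) \<longlongrightarrow> 0 * weight_const) (at_right 0)" by (intro tendsto_intros)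
    moreover have "\<forall>\<^sub>F t in at_right 0. (LBINT z. g z ^ 3 * weight R z) \<le> t * weight_const"
      using le True by (auto simp: eventually_at_right_less[THEN eventually_mono])
    ultimately have "(LBINT z. g z ^ 3 * weight R z) \<le> 0 * weight_const"
      by (rule tendsto_lowerbound) simp
    then show ?thesis using True r by (simp add: N_def)
  next
    case False
    then have "0 < N" using N0 by simp
    then have m: "0 < m" and "m powr (r / 3) = N" using r by (auto simp: m_def powr_powr)
    then have "m * (N / m powr (r / 3) + weight_const) = (1 + weight_const) * m" using \<open>0 < N\<close> by (simp add: mult.commute)
    with le[OF m] have "(LBINT z. g z ^ 3 * weight R z) \<le> (1 + weight_const) * m" by (simp only:)
    then show ?thesis unfolding m_def N_def .
  qed
qed

text \<open>On a fixed ball the weight is at most 1/R. Outside, the uniform bound is applied to the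
  tail \<open>h M\<close>, whose L^r norm is small.\<close>

lemma weighted_cube_limit:
  fixes g :: "real^3 \<Rightarrow> real"
  assumes cont: "continuous_on UNIV g" and g0: "\<And>z. 0 \<le> g z"
    and r: "3 \<le> r" "r \<le> 9/2" and int: "integrable lborel (\<lambda>z. g z powr r)"
  shows "((\<lambda>R. LBINT z. g z ^ 3 * weight R z) \<longlongrightarrow> 0) at_top"
proof (rule tendstoI)
  have [measurable]: "g \<in> borel_measurable borel" using cont by (rule borel_measurable_continuous_onI)
  fix e :: real assume e: "0 < e"
  define h where "h M z = g z * indicator {z. M < norm z} z" for M z
  have h0: "0 \<le> h M z" and hm [measurable]: "h M \<in> borel_measurable borel" for M z
    using g0 unfolding h_def[abs_def] by auto
  have hr: "h M z powr r = g z powr r * indicator {z. M < norm z} z" for M z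
    using r by (auto simp: h_def indicator_def)
  have hint: "integrable lborel (\<lambda>z. h M z powr r)" for M
    unfolding hr using int by (intro integrable_real_mult_indicator) auto
  have "(\<lambda>n. LBINT z. h (real n) z powr r) \<longlonglongrightarrow> integral\<^sup>L lborel (\<lambda>z::real^3. 0::real)"
  proof (rule integral_dominated_convergence[OF _ _ int])
    show "AE z in lborel. (\<lambda>n. h (real n) z powr r) \<longlonglongrightarrow> 0"
    proof (rule AE_I2)
      fix z :: "real^3"
      obtain N :: nat where "norm z < real N" using reals_Archimedean2 by blast
      then have "\<forall>n\<ge>N. h (real n) z powr r = 0" by (auto simp: h_def indicator_def)
      then show "(\<lambda>n. h (real n) z powr r) \<longlonglongrightarrow> 0"
        by (intro tendsto_eventually) (auto simp: eventually_sequentially)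
    qed
    show "AE z in lborel. norm (h (real n) z powr r) \<le> g z powr r" for n
      unfolding hr by (intro AE_I2) (auto simp: indicator_def)
  qed measurable
  then have "(\<lambda>n. (1 + weight_const) * (LBINT z. h (real n) z powr r) powr (3 / r)) \<longlonglongrightarrow> (1 + weight_const) * 0 powr (3 / r)"
    using r by (intro tendsto_intros tendsto_powr2) (auto intro!: always_eventually integral_nonneg_AE)
  then have "(\<lambda>n. (1 + weight_const) * (LBINT z. h (real n) z powr r) powr (3 / r)) \<longlonglongrightarrow> 0" by simp
  then have "\<forall>\<^sub>F n in sequentially. (1 + weight_const) * (LBINT z. h (real n) z powr r) powr (3 / r) < e / 2"
    using e by (intro order_tendstoD) auto
  then obtain n where n: "(1 + weight_const) * (LBINT z. h (real n) z powr r) powr (3 / r) < e / 2"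
    by (auto simp: eventually_sequentially)
  define M where "M = real n"
  have inner: "integrable lborel (\<lambda>z. g z ^ 3 * indicator (cball 0 M) z)"
  proof -
    have "integrable lborel (\<lambda>z. indicator (cball 0 M) z *\<^sub>R g z ^ 3)"
      by (intro borel_integrable_compact continuous_on_power continuous_on_subset[OF cont]) auto
    then show ?thesis by (simp add: mult.commute)
  qed
  define A where "A = (LBINT z. g z ^ 3 * indicator (cball 0 M) z)"
  have "\<bar>LBINT z. g z ^ 3 * weight R z\<bar> < e" if R: "max 1 (2 * A / e + 1) \<le> R" for R
  proof -
    have R1: "1 \<le> R" "0 < R" and RA: "A / R < e / 2"
      using R e by (auto simp: field_simps)
    have H: "integrable lborel (\<lambda>z. h M z ^ 3 * weight R z)"
      by (rule weighted_cube_integral(1)[OF _ h0 r hint R1(1)]) simp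
    have G: "integrable lborel (\<lambda>z. g z ^ 3 * weight R z)"
      by (rule weighted_cube_integral(1)[OF _ g0 r int R1(1)]) simp
    have "(LBINT z. g z ^ 3 * weight R z) \<le> (LBINT z. 1 / R * (g z ^ 3 * indicator (cball 0 M) z) + h M z ^ 3 * weight R z)"
    proof (intro integral_mono G Bochner_Integration.integrable_add integrable_mult_right inner H)
      fix z :: "real^3"
      show "g z ^ 3 * weight R z \<le> 1 / R * (g z ^ 3 * indicator (cball 0 M) z) + h M z ^ 3 * weight R z"
      proof (cases "norm z \<le> M")
        case True
        have "g z ^ 3 * weight R z \<le> g z ^ 3 * (1 / R)" using g0[of z] by (intro mult_left_mono weight_le R1) auto
        then show ?thesis using True by (simp add: h_def indicator_def)
      qed (simp add: h_def indicator_def)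
    qed
    also have "\<dots> = A / R + (LBINT z. h M z ^ 3 * weight R z)"
      using inner H by (subst Bochner_Integration.integral_add) (auto simp: A_def)
    also have "\<dots> < e / 2 + e / 2"
      unfolding M_def
      by (intro add_strict_mono RA le_less_trans[OF weighted_cube_integral(2)[OF hm h0 r hint R1(1)] n])
    finally have "(LBINT z. g z ^ 3 * weight R z) < e" by simp
    moreover have "0 \<le> (LBINT z. g z ^ 3 * weight R z)"
      using g0 weight_nonneg[OF R1(2)] by (intro integral_nonneg_AE) auto
    ultimately show ?thesis by simp
  qed
  then show "\<forall>\<^sub>F R in at_top. dist (LBINT z. g z ^ 3 * weight R z) 0 < e"
    unfolding eventually_at_top_linorder by (intro exI[of _ "max 1 (2 * A / e + 1)"]) simp
qed

section \<open>The pressure\<close>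

lemma third_index:
  fixes i j :: 3
  assumes "i \<noteq> j"
  obtains k where "k \<noteq> i" "k \<noteq> j" "(UNIV :: 3 set) = {i, j, k}"
proof -
  have c: "card (UNIV :: 3 set) = 3" by simp
  have "(UNIV :: 3 set) \<noteq> {i, j}" using c card_2_iff' by (metis assms card_2_iff numeral_eq_iff num.distinct(5) semiring_norm(89))
  then obtain k where k: "k \<noteq> i" "k \<noteq> j" by auto
  then have "card {i, j, k} = 3" using assms by simp
  then have "{i, j, k} = (UNIV :: 3 set)" using c by (intro card_subset_eq) auto
  then show ?thesis using that k by blast
qed

lemma axis_inner: "(axis i 1 :: real^3) \<bullet> x = x $ i"
  by (simp add: inner_axis')

definition diag_plus :: "3 \<Rightarrow> 3 \<Rightarrow> real^3" where
  "diag_plus i j = (1 / sqrt 2) *\<^sub>R (axis i 1 + axis j 1)"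

definition diag_minus :: "3 \<Rightarrow> 3 \<Rightarrow> real^3" where
  "diag_minus i j = (1 / sqrt 2) *\<^sub>R (axis i 1 - axis j 1)"

lemma diag_inner:
  "diag_plus i j \<bullet> x = (x $ i + x $ j) / sqrt 2" "diag_minus i j \<bullet> x = (x $ i - x $ j) / sqrt 2"
  by (simp_all add: diag_plus_def diag_minus_def inner_add_left inner_diff_left axis_inner)

lemma axis_nth: "(axis i (1::real) :: real^3) $ k = (if k = i then 1 else 0)"
  by (simp add: axis_def)

lemma diag_nth:
  "diag_plus i j $ k = ((if k = i then 1 else 0) + (if k = j then 1 else 0)) / sqrt 2"
  "diag_minus i j $ k = ((if k = i then 1 else 0) - (if k = j then 1 else 0)) / sqrt 2"
  by (simp_all add: diag_plus_def diag_minus_def axis_nth)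

lemma vec3_inner:
  fixes x :: "real^3"
  assumes "(UNIV :: 3 set) = {i, j, k}" "i \<noteq> j" "k \<noteq> i" "k \<noteq> j"
  shows "x \<bullet> x = (x $ i)\<^sup>2 + (x $ j)\<^sup>2 + (x $ k)\<^sup>2"
  unfolding inner_vec_def assms(1) using assms(2-4) by (simp add: power2_eq_square)

lemma frame_axis:
  assumes "(UNIV :: 3 set) = {i, j, k}" "i \<noteq> j" "k \<noteq> i" "k \<noteq> j"
  shows "frame3 (axis i 1) (axis j 1) (axis k 1)"
proof unfold_locales
  show "x \<bullet> x = (axis i 1 \<bullet> x)\<^sup>2 + (axis j 1 \<bullet> x)\<^sup>2 + (axis k 1 \<bullet> x)\<^sup>2" for x :: "real^3"
    unfolding axis_inner by (rule vec3_inner[OF assms])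
qed (use assms in \<open>simp_all add: inner_axis_axis\<close>)

lemma frame_diag:
  assumes "(UNIV :: 3 set) = {i, j, k}" "i \<noteq> j" "k \<noteq> i" "k \<noteq> j"
  shows "frame3 (diag_plus i j) (diag_minus i j) (axis k 1)"
    and "frame3 (diag_minus i j) (diag_plus i j) (axis k 1)"
proof -
  show 1: "frame3 (diag_plus i j) (diag_minus i j) (axis k 1)"
  proof unfold_locales
    show "x \<bullet> x = (diag_plus i j \<bullet> x)\<^sup>2 + (diag_minus i j \<bullet> x)\<^sup>2 + (axis k 1 \<bullet> x)\<^sup>2" for x :: "real^3"
      unfolding axis_inner diag_inner vec3_inner[OF assms]
      by (simp add: power_divide) (simp add: power2_eq_square field_simps)
  qed (use assms not_sym[OF assms(2)] not_sym[OF assms(3)] not_sym[OF assms(4)] in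
      \<open>simp_all add: diag_inner axis_inner diag_nth axis_nth diff_divide_distrib[symmetric] add_divide_distrib[symmetric]\<close>)
  show "frame3 (diag_minus i j) (diag_plus i j) (axis k 1)"
    using frame3.perm_bac[OF 1] .
qed

lemma dkernel_axis: "dkernel (axis i 1) w = pressure_kernel i i w"
  by (simp add: dkernel_def pressure_kernel_def axis_inner power2_eq_square)

text \<open>Polarization: the isotropic parts cancel, and the squared components along the two
  diagonals differ by 2 w_i w_j.\<close>

lemma dkernel_diag: "i \<noteq> j \<Longrightarrow> (dkernel (diag_plus i j) w - dkernel (diag_minus i j) w) / 2 = pressure_kernel i j w"
  unfolding dkernel_def pressure_kernel_def diag_inner power_divide diff_divide_distrib[symmetric]
  by (simp add: power2_eq_square field_simps)

lemma pressure_kernel_le: "\<bar>pressure_kernel i j w\<bar> \<le> 1 / norm w ^ 3"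
proof (cases "w = 0")
  case False
  then have n: "0 < norm w" by simp
  have "\<bar>3 * w $ i * w $ j - (if i = j then 1 else 0) * (norm w)\<^sup>2\<bar> \<le> 3 * (\<bar>w $ i\<bar> * \<bar>w $ j\<bar>) + (norm w)\<^sup>2"
    by (rule order_trans[OF abs_triangle_ineq4]) (simp add: abs_mult)
  also have "\<dots> \<le> 3 * (norm w * norm w) + (norm w)\<^sup>2"
    using component_le_norm_cart[of w i] component_le_norm_cart[of w j]
    by (intro add_right_mono mult_left_mono mult_mono) auto
  also have "\<dots> \<le> 4 * pi * (norm w)\<^sup>2"
    using pi_ge_two mult_right_mono[of 4 "4 * pi" "(norm w)\<^sup>2"] by (simp add: power2_eq_square)
  finally have num: "\<bar>3 * w $ i * w $ j - (if i = j then 1 else 0) * (norm w)\<^sup>2\<bar> \<le> 4 * pi * (norm w)\<^sup>2" .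
  have "\<bar>pressure_kernel i j w\<bar> \<le> 4 * pi * (norm w)\<^sup>2 / (4 * pi * norm w ^ 5)"
  proof -
    have "\<bar>x / t\<bar> \<le> b / t" if "\<bar>x\<bar> \<le> b" "0 \<le> t" for x b t :: real
      using that by (simp add: divide_right_mono)
    note D = this
    show ?thesis unfolding pressure_kernel_def by (rule D[OF num]) simp
  qed
  also have "\<dots> = 1 / norm w ^ 3" using n by (simp add: field_simps eval_nat_numeral)
  finally show ?thesis .
qed (simp add: pressure_kernel_def)

lemma pressure_kernel_measurable [measurable]: "pressure_kernel i j \<in> borel_measurable borel"
proof -
  have [measurable]: "(\<lambda>y::real^3. y $ k) \<in> borel_measurable borel" for k
    by (intro borel_measurable_continuous_onI continuous_intros)
  show ?thesis unfolding pressure_kernel_def[abs_def] by measurable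
qed

lemma has_pv_diff:
  assumes "has_pv_integral f y I" "has_pv_integral g y J"
  shows "has_pv_integral (\<lambda>z. f z - g z) y (I - J)"
  using assms unfolding has_pv_integral_def
  by (auto intro!: set_integral_diff(1) Lim_transform_eventually[OF tendsto_diff]
      simp: set_integral_diff(2) eventually_at_right_less[THEN eventually_mono])

lemma has_pv_divide:
  assumes "has_pv_integral f y I"
  shows "has_pv_integral (\<lambda>z. f z / c) y (I / c)"
  using assms unfolding has_pv_integral_def by (cases "c = 0") (auto simp: set_integrable_def intro!: tendsto_divide)

text \<open>Once \<epsilon> is below \<open>d\<close> the truncation removes nothing. This makes the
  far part of the pressure an absolutely convergent integral.\<close>

lemma has_pv_vanishing:
  assumes pv: "has_pv_integral f y I" and d: "0 < d" and zero: "\<And>z. norm (y - z) \<le> d \<Longrightarrow> f z = 0"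
  shows "integrable lborel f" and "I = (LBINT z. f z)"
proof -
  have eq: "indicator {z. \<epsilon> < norm (y - z)} z *\<^sub>R f z = f z" if "\<epsilon> \<le> d" for z \<epsilon>
    using zero[of z] that by (cases "\<epsilon> < norm (y - z)") (auto simp: indicator_def)
  show "integrable lborel f"
  proof -
    have "set_integrable lborel {z. d < norm (y - z)} f"
      using pv d unfolding has_pv_integral_def by blast
    then show ?thesis unfolding set_integrable_def eq[OF order_refl] .
  qed
  have "((\<lambda>\<epsilon>. LINT z:{z. norm (y - z) > \<epsilon>}|lborel. f z) \<longlongrightarrow> (LINT z|lborel. f z)) (at_right 0)"
    unfolding set_lebesgue_integral_def
  proof (rule tendsto_eventually, rule eventually_mono[OF eventually_at_right_real[OF d]])
    fix \<epsilon> assume "\<epsilon> \<in> {0<..<d}"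
    then have "\<epsilon> \<le> d" by simp
    show "(LBINT z. indicator {z. \<epsilon> < norm (y - z)} z *\<^sub>R f z) = (LBINT z. f z)"
      unfolding eq[OF \<open>\<epsilon> \<le> d\<close>] ..
  qed
  then show "I = (LBINT z. f z)"
    using pv unfolding has_pv_integral_def by (auto intro: tendsto_unique[rotated])
qed

lemma bdd_int_compact_support:
  fixes f :: "real^3 \<Rightarrow> real"
  assumes [measurable]: "f \<in> borel_measurable borel" and C: "\<And>x. \<bar>f x\<bar> \<le> C"
    and supp: "\<And>x. f x \<noteq> 0 \<Longrightarrow> norm x \<le> \<rho>"
  shows "bdd_int f"
proof -
  have "integrable lborel f"
  proof (rule Bochner_Integration.integrable_bound)
    show "integrable lborel (\<lambda>x. C * indicator (cball (0::real^3) \<rho>) x)"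
      by (intro integrable_mult_right integrable_real_indicator emeasure_bounded_finite bounded_cball) simp
    show "AE x in lborel. norm (f x) \<le> norm (C * indicator (cball 0 \<rho>) x)"
    proof (rule AE_I2)
      fix x show "norm (f x) \<le> norm (C * indicator (cball 0 \<rho>) x)"
        using C[of x] supp[of x] by (cases "f x = 0") auto
    qed
  qed measurable
  then show ?thesis using C unfolding bdd_int_def by blast
qed

section \<open>Near and far field of the pressure on a time slice\<close>

text \<open>In the application \<open>u\<close> is R times the component of \<open>v\<close> along
  the negative cutoff gradient, that is 4/R psi (y.v); so it has the size of \<open>v\<close> and
  lives on the ball of radius \<open>R\<close>.\<close>

locale velocity_slice =
  fixes v :: "real^3 \<Rightarrow> real^3" and u :: "real^3 \<Rightarrow> real" and R :: real
  assumes R: "0 < R" and v_cont: "continuous_on UNIV v"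
    and v_lip: "\<exists>L. \<forall>x\<in>cball 0 (2 * R). \<forall>y\<in>cball 0 (2 * R). norm (v x - v y) \<le> L * norm (x - y)"
    and u_meas [measurable]: "u \<in> borel_measurable borel"
    and u_supp: "u y \<noteq> 0 \<Longrightarrow> norm y \<le> R" and u_le: "\<bar>u y\<bar> \<le> 4 * norm (v y)"
    and W_int: "integrable lborel (\<lambda>z. norm (v z) ^ 3 * weight R z)"
begin

lemma v_meas [measurable]: "v \<in> borel_measurable borel"
  using v_cont by (rule borel_measurable_continuous_onI)

lemma v_nth_meas [measurable]: "(\<lambda>z. v z $ i) \<in> borel_measurable borel"
  using v_cont by (intro borel_measurable_continuous_onI continuous_intros)

definition W :: real where "W = (LBINT z. norm (v z) ^ 3 * weight R z)"

definition f :: "3 \<Rightarrow> 3 \<Rightarrow> real^3 \<Rightarrow> real" where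
  "f i j z = indicator (cball 0 (2 * R)) z * (v z $ i * v z $ j)"

definition g :: "real^3 \<Rightarrow> real" where
  "g z = (\<Sum>k\<in>UNIV. f k k z)"

lemma f_meas [measurable]: "f i j \<in> borel_measurable borel"
  unfolding f_def[abs_def] by measurable

lemma g_meas [measurable]: "g \<in> borel_measurable borel"
  unfolding g_def[abs_def] by measurable

lemma g_eq: "g z = indicator (cball 0 (2 * R)) z * (norm (v z))\<^sup>2"
  unfolding g_def f_def power2_norm_eq_inner inner_vec_def
  by (simp add: sum_distrib_left)

lemma f_le_g: "\<bar>f i j z\<bar> \<le> g z"
proof -
  have "\<bar>v z $ i\<bar> * \<bar>v z $ j\<bar> \<le> norm (v z) * norm (v z)"
    by (intro mult_mono component_le_norm_cart) auto
  then show ?thesis unfolding g_eq f_def by (auto simp: indicator_def abs_mult power2_eq_square)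
qed

lemma g_nonneg: "0 \<le> g z" unfolding g_eq by simp

lemma f_supp: "f i j z \<noteq> 0 \<Longrightarrow> norm z \<le> 2 * R" and g_supp: "g z \<noteq> 0 \<Longrightarrow> norm z \<le> 2 * R"
  unfolding f_def g_eq by (auto simp: indicator_def split: if_splits)

lemma v_bounded: obtains C where "0 \<le> C" "\<And>z. norm z \<le> 2 * R \<Longrightarrow> norm (v z) \<le> C"
proof -
  have "compact (v ` cball 0 (2 * R))"
    by (intro compact_continuous_image continuous_on_subset[OF v_cont]) auto
  then obtain C where "\<And>x. x \<in> v ` cball 0 (2 * R) \<Longrightarrow> norm x \<le> C"
    using compact_imp_bounded bounded_iff by metis
  then have "norm (v z) \<le> max 0 C" if "norm z \<le> 2 * R" for z
    using that by (intro max.coboundedI2) auto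
  then show ?thesis using that[of "max 0 C"] by simp
qed

lemma g_bounded: obtains C where "0 \<le> C" "\<And>z. g z \<le> C"
proof -
  obtain C where C: "0 \<le> C" "\<And>z. norm z \<le> 2 * R \<Longrightarrow> norm (v z) \<le> C" using v_bounded by blast
  have "g z \<le> C\<^sup>2" for z
    unfolding g_eq using C power_mono[OF C(2), of z 2] by (auto simp: indicator_def)
  then show ?thesis using that[of "C\<^sup>2"] by simp
qed

lemma f_bdd_int: "bdd_int (f i j)" and g_bdd_int: "bdd_int g"
proof -
  obtain C where C: "\<And>z. g z \<le> C" using g_bounded by blast
  show "bdd_int (f i j)"
    using order_trans[OF f_le_g C] f_supp by (intro bdd_int_compact_support) auto
  show "bdd_int g"
    using C g_nonneg g_supp by (intro bdd_int_compact_support[where C=C and \<rho>="2 * R"]) auto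
qed

lemma u_bdd_int: "bdd_int u"
proof -
  obtain C where C: "0 \<le> C" "\<And>z. norm z \<le> 2 * R \<Longrightarrow> norm (v z) \<le> C" using v_bounded by blast
  show ?thesis
  proof (rule bdd_int_compact_support[where \<rho>=R])
    fix x
    show "\<bar>u x\<bar> \<le> 4 * C"
    proof (cases "u x = 0")
      case False
      then have "norm x \<le> 2 * R" using u_supp[of x] R by simp
      then show ?thesis using u_le[of x] C(2)[of x] by linarith
    qed (use C in simp)
  qed (use u_supp in auto)
qed

text \<open>The cutoff in \<open>f i j\<close> jumps at radius 2R, but points with |y| <= R see this
  jump only at displacements of at least R, where the oscillation 2 D is at most 2 D/R |w|.\<close>

lemma f_lip: obtains L where "0 \<le> L" "\<And>i j y w. norm y \<le> R \<Longrightarrow> \<bar>f i j (y - w) - f i j y\<bar> \<le> L * norm w"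
proof -
  obtain C where C: "0 \<le> C" "\<And>z. norm z \<le> 2 * R \<Longrightarrow> norm (v z) \<le> C" using v_bounded by blast
  obtain D where D: "0 \<le> D" "\<And>z. g z \<le> D" using g_bounded by blast
  obtain L where L: "\<And>x y. norm x \<le> 2 * R \<Longrightarrow> norm y \<le> 2 * R \<Longrightarrow> norm (v x - v y) \<le> L * norm (x - y)"
  proof -
    from v_lip obtain L where "\<forall>x\<in>cball 0 (2 * R). \<forall>y\<in>cball 0 (2 * R). norm (v x - v y) \<le> L * norm (x - y)"
      by blast
    then show ?thesis by (intro that[of L]) (simp add: dist_norm)
  qed
  define M where "M = 2 * C * \<bar>L\<bar> + 2 * D / R"
  have M: "0 \<le> M" using C D R by (simp add: M_def)
  show ?thesis
  proof (rule that[OF M])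
    fix i j and y w :: "real^3" assume y: "norm y \<le> R"
    then have y2: "norm y \<le> 2 * R" using R by simp
    show "\<bar>f i j (y - w) - f i j y\<bar> \<le> M * norm w"
    proof (cases "norm w \<le> R")
      case True
      then have yw: "norm (y - w) \<le> 2 * R" using y norm_triangle_ineq4[of y w] by linarith
      have d: "\<bar>v (y - w) $ k - v y $ k\<bar> \<le> \<bar>L\<bar> * norm w" for k
      proof -
        have "\<bar>v (y - w) $ k - v y $ k\<bar> \<le> norm (v (y - w) - v y)"
          using component_le_norm_cart[of "v (y - w) - v y" k] by simp
        also have "\<dots> \<le> L * norm w" using L[OF yw y2] by simp
        also have "\<dots> \<le> \<bar>L\<bar> * norm w" by (intro mult_right_mono) auto
        finally show ?thesis .
      qed
      have c: "\<bar>v (y - w) $ k\<bar> \<le> C" "\<bar>v y $ k\<bar> \<le> C" for k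
        using component_le_norm_cart order_trans C(2)[OF yw] C(2)[OF y2] by blast+
      have "f i j (y - w) - f i j y = v (y - w) $ i * (v (y - w) $ j - v y $ j) + v y $ j * (v (y - w) $ i - v y $ i)"
        using yw y2 by (simp add: f_def algebra_simps)
      also have "\<bar>\<dots>\<bar> \<le> C * (\<bar>L\<bar> * norm w) + C * (\<bar>L\<bar> * norm w)"
        by (rule order_trans[OF abs_triangle_ineq], unfold abs_mult)
           (intro add_mono mult_mono c d C(1), auto)
      also have "\<dots> \<le> M * norm w" using D R by (simp add: M_def algebra_simps)
      finally show ?thesis .
    next
      case False
      have "\<bar>f i j (y - w) - f i j y\<bar> \<le> 2 * D"
        using order_trans[OF f_le_g D(2), of i j "y - w"] order_trans[OF f_le_g D(2), of i j y] by linarith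
      also have "\<dots> = 2 * D / R * R" using R by simp
      also have "\<dots> \<le> 2 * D / R * norm w" using False R D by (intro mult_left_mono) auto
      also have "\<dots> \<le> M * norm w" using C by (intro mult_right_mono) (auto simp: M_def)
      finally show ?thesis .
    qed
  qed
qed

definition Q :: real where "Q = (LBINT z. indicator (cball 0 (2 * R)) z * norm (v z) ^ 3)"

lemma Q_int: "integrable lborel (\<lambda>z. indicator (cball 0 (2 * R)) z * norm (v z) ^ 3)"
proof -
  have "integrable lborel (\<lambda>z. indicator (cball 0 (2 * R)) z *\<^sub>R norm (v z) ^ 3)"
    by (intro borel_integrable_compact continuous_on_power continuous_on_norm continuous_on_subset[OF v_cont]) auto
  then show ?thesis by simp
qed

lemma bellman_integral_le:
  assumes h: "bdd_int h" "\<And>z. 0 \<le> h z" "\<And>z. h z \<le> 2 * g z"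
  shows "(LBINT x. bellman (u x) (h x)) \<le> 268 * Q"
proof -
  \<comment> \<open>268 = 4 (64 + 3): the 4 is from \<open>bellman_le\<close>, 64 is the cube of 4
    in \<open>u_le\<close>, and 3 bounds 2 sqrt 2.\<close>
  have le: "bellman (u x) (h x) \<le> 268 * (indicator (cball 0 (2 * R)) x * norm (v x) ^ 3)" for x
  proof (cases "norm x \<le> 2 * R")
    case True
    have "sqrt (h x) \<le> sqrt 2 * norm (v x)"
    proof -
      have "h x \<le> 2 * (norm (v x))\<^sup>2" using h(3)[of x] True by (simp add: g_eq)
      then have "sqrt (h x) \<le> sqrt (2 * (norm (v x))\<^sup>2)" by simp
      then show ?thesis by (simp add: real_sqrt_mult)
    qed
    then have "sqrt (h x) ^ 3 \<le> (sqrt 2 * norm (v x)) ^ 3" using h(2)[of x] by (intro power_mono) auto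
    also have "\<dots> = 2 * sqrt 2 * norm (v x) ^ 3" by (simp add: power_mult_distrib power3_eq_cube)
    also have "\<dots> \<le> 3 * norm (v x) ^ 3"
    proof (rule mult_right_mono)
      show "2 * sqrt 2 \<le> (3::real)" using real_le_lsqrt[of "3/2" 2] by (simp add: power2_eq_square)
    qed simp
    finally have 1: "sqrt (h x) ^ 3 \<le> 3 * norm (v x) ^ 3" .
    have "\<bar>u x\<bar> ^ 3 \<le> (4 * norm (v x)) ^ 3" by (intro power_mono u_le) auto
    then have "\<bar>u x\<bar> ^ 3 \<le> 64 * norm (v x) ^ 3" by (simp add: power_mult_distrib)
    with 1 bellman_le[OF h(2), of "u x" x] show ?thesis using True by simp
  next
    case False
    then have "g x = 0" "u x = 0" using g_supp[of x] u_supp[of x] R by force+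
    then show ?thesis using h(2)[of x] h(3)[of x] False by (simp add: bellman_def)
  qed
  have "(LBINT x. bellman (u x) (h x)) \<le> (LBINT x. 268 * (indicator (cball 0 (2 * R)) x * norm (v x) ^ 3))"
    by (intro integral_mono le bdd_int_integrable bdd_int_bellman u_bdd_int h integrable_mult_right Q_int)
  then show ?thesis by (simp add: Q_def)
qed

text \<open>At points of the support of \<open>u\<close> this is minus the second derivative along
  \<open>a\<close> of the inverse Laplacian of \<open>f i j\<close>. The radius 4R covers all
  displacements within the ball of radius 2R.\<close>

definition N :: "real^3 \<Rightarrow> 3 \<Rightarrow> 3 \<Rightarrow> real^3 \<Rightarrow> real" where
  "N a i j y = dkernel_pv a (4 * R) (f i j) y - f i j y / 3"

text \<open>Since \<open>f i j\<close> has no sign, the flow bound is applied to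
  \<open>h = f i j + g\<close> and to \<open>g\<close>, both nonnegative. The constant is 2 * 25 *
  268.\<close>

lemma near_field:
  assumes frame: "frame3 a b c"
  shows "integrable lborel (\<lambda>y. u y * N a i j y)"
    and "\<bar>LBINT y. u y * N a i j y\<bar> \<le> 13400 * Q"
    and "u y \<noteq> 0 \<Longrightarrow> has_pv_integral (\<lambda>z. dkernel a (y - z) * f i j z) y (dkernel_pv a (4 * R) (f i j) y)"
proof -
  obtain L where L: "0 \<le> L" "\<And>i j y w. norm y \<le> R \<Longrightarrow> \<bar>f i j (y - w) - f i j y\<bar> \<le> L * norm w"
    using f_lip by blast
  obtain D where D: "0 \<le> D" "\<And>z. g z \<le> D" using g_bounded by blast
  have g_lip: "\<bar>g (y - w) - g y\<bar> \<le> (3 * L) * norm w" if "norm y \<le> R" for y w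
  proof -
    have "\<bar>g (y - w) - g y\<bar> \<le> (\<Sum>k\<in>UNIV. \<bar>f k k (y - w) - f k k y\<bar>)"
      unfolding g_def sum_subtractf[symmetric] by (rule sum_abs)
    also have "\<dots> \<le> (\<Sum>k\<in>(UNIV::3 set). L * norm w)" by (intro sum_mono L that)
    finally show ?thesis by simp
  qed
  define h where "h z = f i j z + g z" for z
  have h0: "0 \<le> h z" and h2: "h z \<le> 2 * g z" for z using f_le_g[of i j z] by (auto simp: h_def)
  have h_supp: "h z \<noteq> 0 \<Longrightarrow> norm z \<le> 2 * R" for z using f_supp g_supp by (force simp: h_def)
  have h_bdd: "bdd_int h"
    unfolding h_def[abs_def]
  proof (rule bdd_int_compact_support[where C="2 * D"])
    show "\<bar>f i j z + g z\<bar> \<le> 2 * D" for z using f_le_g[of i j z] g_nonneg[of z] D(2)[of z] by linarith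
  qed (use h_supp in \<open>auto simp: h_def\<close>)
  have h_lip: "\<bar>h (y - w) - h y\<bar> \<le> (4 * L) * norm w" if "norm y \<le> R" for y w
    using L(2)[OF that, of i j w] g_lip[OF that, of w] unfolding h_def by (simp add: algebra_simps)
  have uR: "norm y \<le> 2 * R" if "u y \<noteq> 0" for y using u_supp[OF that] R by simp
  interpret F: frame3 a b c by fact
  interpret H: lipschitz_flow a b c u h "2 * R" "4 * L"
    by unfold_locales (use u_bdd_int h_bdd uR h_supp h0 h_lip u_supp in auto)
  interpret Gg: lipschitz_flow a b c u g "2 * R" "3 * L"
    by unfold_locales (use u_bdd_int g_bdd_int uR g_supp g_nonneg g_lip u_supp in auto)
  have far: "norm w \<le> 4 * R" if "u y \<noteq> 0" "norm (y - w) \<le> 2 * R" for y w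
    using that u_supp[of y] norm_triangle_ineq4[of y "y - w"] R by simp
  have kpf: "kernel_point a b c (f i j) y (4 * R) L D" if "u y \<noteq> 0" for y
    by unfold_locales (use order_trans[OF f_le_g D(2)] L(2) u_supp f_supp that far in auto)
  have kpg: "kernel_point a b c g y (4 * R) (3 * L) D" if "u y \<noteq> 0" for y
    by unfold_locales (use g_nonneg D(2) g_lip u_supp g_supp that far in auto)
  have split: "u y * N a i j y = u y * (dkernel_pv a (2 * (2 * R)) h y - h y / 3) - u y * (dkernel_pv a (2 * (2 * R)) g y - g y / 3)" for y
  proof (cases "u y = 0")
    case False
    note If = kernel_point.truncated_integrable(1)[OF kpf[OF False], of "\<lambda>_. 1"]
    note Ig = kernel_point.truncated_integrable(1)[OF kpg[OF False], of "\<lambda>_. 1"]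
    have "dkernel_pv a (4 * R) h y = dkernel_pv a (4 * R) (f i j) y + dkernel_pv a (4 * R) g y"
    proof -
      have "indicator (cball 0 (4 * R)) w * (dkernel a w * (h (y - w) - h y))
        = indicator (cball 0 (4 * R)) w * (dkernel a w * (1 * (f i j (y - w) - f i j y)))
        + indicator (cball 0 (4 * R)) w * (dkernel a w * (1 * (g (y - w) - g y)))" for w
        by (simp add: h_def algebra_simps)
      then show ?thesis unfolding dkernel_pv_def using If Ig by simp
    qed
    then show ?thesis by (simp add: N_def h_def algebra_simps add_divide_distrib)
  qed simp
  show "integrable lborel (\<lambda>y. u y * N a i j y)"
    unfolding split by (intro Bochner_Integration.integrable_diff H.singular_integral_bound(1) Gg.singular_integral_bound(1))
  have "(LBINT y. u y * N a i j y) = (LBINT y. u y * (dkernel_pv a (2 * (2 * R)) h y - h y / 3))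
      - (LBINT y. u y * (dkernel_pv a (2 * (2 * R)) g y - g y / 3))"
    unfolding split by (intro Bochner_Integration.integral_diff H.singular_integral_bound(1) Gg.singular_integral_bound(1))
  moreover have "(LBINT x. bellman (u x) (h x)) \<le> 268 * Q"
    by (rule bellman_integral_le[OF h_bdd h0 h2])
  moreover have "(LBINT x. bellman (u x) (g x)) \<le> 268 * Q"
    by (rule bellman_integral_le[OF g_bdd_int g_nonneg]) (use g_nonneg in auto)
  ultimately show "\<bar>LBINT y. u y * N a i j y\<bar> \<le> 13400 * Q"
    using H.singular_integral_bound(2) Gg.singular_integral_bound(2) by linarith
  show "has_pv_integral (\<lambda>z. dkernel a (y - z) * f i j z) y (dkernel_pv a (4 * R) (f i j) y)" if "u y \<noteq> 0"
    by (rule kernel_point.has_pv_dkernel[OF kpf[OF that] bdd_int_integrable[OF f_bdd_int]])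
qed

text \<open>In the off-diagonal case the two thirds of \<open>f i j\<close> cancel in the
  difference, so only principal values remain.\<close>

definition T :: "3 \<Rightarrow> 3 \<Rightarrow> real^3 \<Rightarrow> real" where
  "T i j y = (if i = j then N (axis i 1) i i y else (N (diag_plus i j) i j y - N (diag_minus i j) i j y) / 2)"

lemma near_field_ij:
  shows "integrable lborel (\<lambda>y. u y * T i j y)"
    and "\<bar>LBINT y. u y * T i j y\<bar> \<le> 13400 * Q"
    and "u y \<noteq> 0 \<Longrightarrow> has_pv_integral (\<lambda>z. pressure_kernel i j (y - z) * f i j z) y
        (T i j y + (if i = j then f i i y / 3 else 0))"
proof -
  have "integrable lborel (\<lambda>y. u y * T i j y) \<and> \<bar>LBINT y. u y * T i j y\<bar> \<le> 13400 * Q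
    \<and> (u y \<noteq> 0 \<longrightarrow> has_pv_integral (\<lambda>z. pressure_kernel i j (y - z) * f i j z) y
        (T i j y + (if i = j then f i i y / 3 else 0)))"
  proof (cases "i = j")
    case True
    obtain j' :: 3 where "i \<noteq> j'" using exhaust_3 by (metis one_neq_zero zero_neq_one)
    then obtain k where k: "k \<noteq> i" "k \<noteq> j'" "(UNIV :: 3 set) = {i, j', k}" using third_index by metis
    note F = frame_axis[OF k(3) \<open>i \<noteq> j'\<close> k(1,2)]
    show ?thesis
      using near_field(1,2)[OF F, where i=i and j=i] near_field(3)[OF F, where y=y and i=i and j=i] True
      by (auto simp: T_def dkernel_axis N_def)
  next
    case False
    then obtain k where k: "k \<noteq> i" "k \<noteq> j" "(UNIV :: 3 set) = {i, j, k}" using third_index by metis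
    note Fp = frame_diag(1)[OF k(3) False k(1,2)] and Fm = frame_diag(2)[OF k(3) False k(1,2)]
    have eq: "u y * T i j y = (u y * N (diag_plus i j) i j y - u y * N (diag_minus i j) i j y) / 2" for y
      using False by (simp add: T_def right_diff_distrib)
    have 1: "integrable lborel (\<lambda>y. u y * T i j y)"
      unfolding eq by (intro integrable_divide Bochner_Integration.integrable_diff near_field(1)[OF Fp] near_field(1)[OF Fm])
    have "(LBINT y. u y * T i j y) = ((LBINT y. u y * N (diag_plus i j) i j y) - (LBINT y. u y * N (diag_minus i j) i j y)) / 2"
      unfolding eq using near_field(1)[OF Fp] near_field(1)[OF Fm] by simp
    then have 2: "\<bar>LBINT y. u y * T i j y\<bar> \<le> 13400 * Q"
      using near_field(2)[OF Fp, where i=i and j=j] near_field(2)[OF Fm, where i=i and j=j]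
      by (simp add: abs_le_iff field_simps)
    have 3: "has_pv_integral (\<lambda>z. pressure_kernel i j (y - z) * f i j z) y (T i j y)" if "u y \<noteq> 0"
    proof -
      have "has_pv_integral (\<lambda>z. (dkernel (diag_plus i j) (y - z) * f i j z - dkernel (diag_minus i j) (y - z) * f i j z) / 2) y
         ((dkernel_pv (diag_plus i j) (4 * R) (f i j) y - dkernel_pv (diag_minus i j) (4 * R) (f i j) y) / 2)"
        by (intro has_pv_divide has_pv_diff near_field(3)[OF Fp that] near_field(3)[OF Fm that])
      moreover have "(dkernel (diag_plus i j) (y - z) * f i j z - dkernel (diag_minus i j) (y - z) * f i j z) / 2
          = pressure_kernel i j (y - z) * f i j z" for z
        unfolding dkernel_diag[OF False, symmetric] by (simp add: left_diff_distrib)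
      ultimately show ?thesis using False by (simp add: T_def N_def)
    qed
    show ?thesis using 1 2 3 False by simp
  qed
  then show "integrable lborel (\<lambda>y. u y * T i j y)"
    and "\<bar>LBINT y. u y * T i j y\<bar> \<le> 13400 * Q"
    and "u y \<noteq> 0 \<Longrightarrow> has_pv_integral (\<lambda>z. pressure_kernel i j (y - z) * f i j z) y
        (T i j y + (if i = j then f i i y / 3 else 0))" by auto
qed

lemma W_nonneg: "0 \<le> W"
  unfolding W_def using weight_nonneg[OF R] by (intro integral_nonneg_AE) auto

text \<open>On the ball of radius 2R the weight is at least R/(R^2 + 4 R^2) = 1/(5 R).\<close>

lemma Q_le_W: "Q \<le> 5 * R * W"
proof -
  have "Q \<le> (LBINT z. 5 * R * (norm (v z) ^ 3 * weight R z))"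
    unfolding Q_def
  proof (intro integral_mono Q_int integrable_mult_right W_int)
    fix z
    show "indicator (cball 0 (2 * R)) z * norm (v z) ^ 3 \<le> 5 * R * (norm (v z) ^ 3 * weight R z)"
    proof (cases "norm z \<le> 2 * R")
      case True
      then have "(norm z)\<^sup>2 \<le> (2 * R)\<^sup>2" by (intro power_mono) auto
      then have "1 \<le> 5 * R * weight R z"
        using R by (simp add: weight_def field_simps power2_eq_square add_pos_nonneg)
      then have "norm (v z) ^ 3 * 1 \<le> norm (v z) ^ 3 * (5 * R * weight R z)" by (intro mult_left_mono) auto
      then show ?thesis using True by (simp add: mult_ac)
    qed (use weight_nonneg[OF R] R in simp)
  qed
  then show ?thesis by (simp add: W_def)
qed

text \<open>Only |z| > 2R contributes, where |y - z| >= |z|/2 and the kernel is at most 8/|z|^3. The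
  factor \<open>norm (v y)\<close> is included in order to estimate a b^2 by separate cubes of a =
  |v y| and b = |v z|.\<close>

lemma far_field:
  assumes uy: "u y \<noteq> 0"
    and pv: "has_pv_integral (\<lambda>z. pressure_kernel i j (y - z) * v z $ i * v z $ j) y I"
  shows "norm (v y) * \<bar>I - (T i j y + (if i = j then f i i y / 3 else 0))\<bar>
    \<le> 5 * ball_const * norm (v y) ^ 3 + 10 * W / R\<^sup>2"
proof -
  have y: "norm y \<le> R" using u_supp[OF uy] .
  define F where "F z = pressure_kernel i j (y - z) * v z $ i * v z $ j - pressure_kernel i j (y - z) * f i j z" for z
  define J where "J = I - (T i j y + (if i = j then f i i y / 3 else 0))"
  have pvF: "has_pv_integral F y J"
    unfolding F_def J_def by (rule has_pv_diff[OF pv near_field_ij(3)[OF uy]])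
  have F_eq: "F z = indicator {z. 2 * R < norm z} z * (pressure_kernel i j (y - z) * (v z $ i * v z $ j))" for z
    by (simp add: F_def f_def indicator_def)
  have zero: "F z = 0" if "norm (y - z) \<le> R" for z
    using that y norm_triangle_ineq2[of z y] unfolding F_eq by (auto simp: norm_minus_commute)
  note V = has_pv_vanishing[OF pvF R zero]
  define a where "a = norm (v y)"
  define M where "M z = 8 * (a ^ 3 * R\<^sup>2 * (indicator {z. 2 * R \<le> norm z} z / norm z ^ 5)
      + 5 / (4 * R\<^sup>2) * (norm (v z) ^ 3 * weight R z))" for z
  note E = exterior_integral[of "2 * R"]
  have M_int: "integrable lborel M"
    unfolding M_def by (intro integrable_mult_right Bochner_Integration.integrable_add E(1) W_int) (use R in simp)
  have le: "a * \<bar>F z\<bar> \<le> M z" for z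
  proof (cases "2 * R < norm z")
    case True
    then have z: "0 < norm z" using R by linarith
    define b where "b = norm (v z)"
    have b0: "0 \<le> b" "0 \<le> a" by (auto simp: a_def b_def)
    have yz: "norm z / 2 \<le> norm (y - z)" using norm_triangle_ineq2[of z y] y True by (simp add: norm_minus_commute)
    then have yz0: "0 < norm (y - z)" using z by linarith
    have "\<bar>F z\<bar> \<le> 1 / norm (y - z) ^ 3 * (b * b)"
    proof -
      have "\<bar>F z\<bar> = \<bar>pressure_kernel i j (y - z)\<bar> * (\<bar>v z $ i\<bar> * \<bar>v z $ j\<bar>)"
        using True by (simp add: F_eq abs_mult)
      also have "\<dots> \<le> 1 / norm (y - z) ^ 3 * (b * b)"
        unfolding b_def by (intro mult_mono pressure_kernel_le component_le_norm_cart) auto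
      finally show ?thesis .
    qed
    also have "\<dots> \<le> 1 / (norm z / 2) ^ 3 * (b * b)"
      using yz yz0 z b0 by (intro mult_right_mono divide_left_mono power_mono mult_pos_pos zero_less_power) auto
    also have "\<dots> = 8 * b\<^sup>2 / norm z ^ 3" by (simp add: power_divide power2_eq_square)
    finally have 1: "a * \<bar>F z\<bar> \<le> 8 * (a * b\<^sup>2 / norm z ^ 3)"
      using mult_left_mono[of "\<bar>F z\<bar>" "8 * b\<^sup>2 / norm z ^ 3" a] b0 by (simp add: mult_ac)
    \<comment> \<open>With this ratio l^2 a^3/|z|^3 becomes a^3 R^2/|z|^5, integrable outside the
      ball, while b^3/(l |z|^3) becomes b^3/(R |z|^2), comparable to b^3 times the weight over
      R^2.\<close>
    define l where "l = R / norm z"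
    have l: "0 < l" using R z by (simp add: l_def)
    have "a * b\<^sup>2 \<le> l\<^sup>2 * a ^ 3 + b ^ 3 / l"
    proof (cases "l * a \<le> b")
      case True
      then have "l * a * b\<^sup>2 \<le> b * b\<^sup>2" by (intro mult_right_mono) auto
      then have "a * b\<^sup>2 \<le> b ^ 3 / l" using l by (simp add: field_simps eval_nat_numeral)
      then show ?thesis using b0 by (simp add: add_increasing)
    next
      case False
      then have "b\<^sup>2 \<le> (l * a)\<^sup>2" using b0 by (intro power_mono) auto
      then have "a * b\<^sup>2 \<le> a * (l * a)\<^sup>2" using b0 by (intro mult_left_mono) auto
      then show ?thesis using b0 l by (simp add: power_mult_distrib eval_nat_numeral mult_ac add_increasing2)
    qed
    then have "a * b\<^sup>2 / norm z ^ 3 \<le> (l\<^sup>2 * a ^ 3 + b ^ 3 / l) / norm z ^ 3" using z by (intro divide_right_mono) auto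
    also have "\<dots> = a ^ 3 * R\<^sup>2 * (1 / norm z ^ 5) + 1 / R * (b ^ 3 / (norm z)\<^sup>2)"
      using z R by (simp add: l_def power_divide field_simps eval_nat_numeral)
    also have "1 / R * (b ^ 3 / (norm z)\<^sup>2) \<le> 5 / (4 * R\<^sup>2) * (b ^ 3 * weight R z)"
    proof -
      have "(2 * R)\<^sup>2 \<le> (norm z)\<^sup>2" using True R by (intro power_mono) auto
      then have w: "R\<^sup>2 + (norm z)\<^sup>2 \<le> 5/4 * (norm z)\<^sup>2" by (simp add: power2_eq_square)
      have "1 / (norm z)\<^sup>2 \<le> 5/4 / (R\<^sup>2 + (norm z)\<^sup>2)"
        using w z R by (simp add: field_simps add_pos_pos)
      also have "\<dots> = 5/4 * weight R z / R" using R by (simp add: weight_def)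
      finally have "b ^ 3 / R * (1 / (norm z)\<^sup>2) \<le> b ^ 3 / R * (5/4 * weight R z / R)"
        using b0 R by (intro mult_left_mono) auto
      then show ?thesis by (simp add: power2_eq_square mult_ac)
    qed
    finally have 2: "a * b\<^sup>2 / norm z ^ 3 \<le> a ^ 3 * R\<^sup>2 * (1 / norm z ^ 5) + 5 / (4 * R\<^sup>2) * (b ^ 3 * weight R z)" by simp
    have "M z = 8 * (a ^ 3 * R\<^sup>2 * (1 / norm z ^ 5) + 5 / (4 * R\<^sup>2) * (b ^ 3 * weight R z))"
      using True by (simp add: M_def b_def)
    then show ?thesis using order_trans[OF 1 mult_left_mono[OF 2, of 8]] by simp
  next
    case False
    then have "F z = 0" by (simp add: F_eq)
    then show ?thesis unfolding M_def using R weight_nonneg[OF R] by (simp add: a_def)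
  qed
  have "a * \<bar>J\<bar> \<le> a * (LBINT z. \<bar>F z\<bar>)"
  proof (rule mult_left_mono)
    have "J = (LBINT z. F z)" by (rule V(2))
    then show "\<bar>J\<bar> \<le> (LBINT z. \<bar>F z\<bar>)" using integral_abs_bound[of lborel F] by simp
  qed (simp add: a_def)
  also have "\<dots> = (LBINT z. a * \<bar>F z\<bar>)" by simp
  also have "\<dots> \<le> (LBINT z. M z)"
    using V(1) by (intro integral_mono le M_int integrable_mult_right integrable_abs)
  also have "\<dots> = 8 * (a ^ 3 * R\<^sup>2 * (LBINT z. indicator {z. 2 * R \<le> norm z} (z::real^3) / norm z ^ 5) + 5 / (4 * R\<^sup>2) * W)"
  proof -
    have E1: "integrable lborel (\<lambda>z::real^3. indicator {z. 2 * R \<le> norm z} z / norm z ^ 5)" using E(1) R by simp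
    show ?thesis unfolding M_def W_def
      by (subst integral_mult_right_zero, subst Bochner_Integration.integral_add)
         (intro integrable_mult_right E1 W_int, intro integrable_mult_right E1 W_int, simp only: integral_mult_right_zero)
  qed
  also have "\<dots> \<le> 8 * (a ^ 3 * R\<^sup>2 * (5 * ball_const / (2 * (2 * R)\<^sup>2)) + 5 / (4 * R\<^sup>2) * W)"
    using E(2) R by (intro mult_left_mono add_right_mono) (auto simp: a_def)
  also have "\<dots> = 5 * ball_const * a ^ 3 + 10 * W / R\<^sup>2"
    using R by (simp add: field_simps)
  finally show ?thesis by (simp add: a_def J_def)
qed

text \<open>On the ball the diagonal terms \<open>f i i y / 3\<close> sum to |v|^2/3 and cancel the
  local term of the pressure. What remains is nine near-field operators and a pointwise far-field
  error.\<close>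

lemma pressure_pairing:
  assumes p_int: "integrable lborel (\<lambda>y. u y * p y)"
    and p: "\<And>y. \<exists>I :: 3 \<Rightarrow> 3 \<Rightarrow> real.
        (\<forall>i j. has_pv_integral (\<lambda>z. pressure_kernel i j (y - z) * v z $ i * v z $ j) y (I i j)) \<and>
        p y = - (norm (v y))\<^sup>2 / 3 + (\<Sum>i\<in>UNIV. \<Sum>j\<in>UNIV. I i j)"
  shows "\<bar>LBINT y. u y * p y\<bar> \<le> (603000 + 1260 * ball_const) * (R * W)"
proof -
  define S where "S y = (\<Sum>i\<in>UNIV. \<Sum>j\<in>UNIV. u y * T i j y)" for y
  have S_int: "integrable lborel S"
    unfolding S_def by (intro Bochner_Integration.integrable_sum near_field_ij(1))
  have S_le: "\<bar>LBINT y. S y\<bar> \<le> 9 * (13400 * Q)"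
  proof -
    have "(LBINT y. S y) = (\<Sum>i\<in>UNIV. \<Sum>j\<in>UNIV. LBINT y. u y * T i j y)"
      unfolding S_def by (simp add: near_field_ij(1))
    also have "\<bar>\<dots>\<bar> \<le> (\<Sum>i\<in>UNIV. \<Sum>j\<in>UNIV. \<bar>LBINT y. u y * T i j y\<bar>)"
      by (rule order_trans[OF sum_abs], rule sum_mono, rule sum_abs)
    also have "\<dots> \<le> (\<Sum>i\<in>(UNIV::3 set). \<Sum>j\<in>(UNIV::3 set). 13400 * Q)"
      by (intro sum_mono near_field_ij(2))
    finally show ?thesis by simp
  qed
  \<comment> \<open>36 is the factor 4 from \<open>u_le\<close> times the nine index pairs.\<close>
  define B where "B y = 36 * (5 * ball_const * (indicator (cball 0 (2 * R)) y * norm (v y) ^ 3)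
      + 10 * W / R\<^sup>2 * indicator (cball 0 R) y)" for y
  have ind: "integrable lborel (indicator (cball (0::real^3) R) :: real^3 \<Rightarrow> real)"
    by (intro integrable_real_indicator emeasure_bounded_finite bounded_cball) simp
  have B_int: "integrable lborel B"
    unfolding B_def by (intro integrable_mult_right Bochner_Integration.integrable_add Q_int ind)
  have diff: "\<bar>u y * p y - S y\<bar> \<le> B y" for y
  proof (cases "u y = 0")
    case True
    then show ?thesis using ball_const_nonneg W_nonneg R by (simp add: S_def B_def)
  next
    case False
    have y: "norm y \<le> R" using u_supp[OF False] .
    obtain I where I: "\<And>i j. has_pv_integral (\<lambda>z. pressure_kernel i j (y - z) * v z $ i * v z $ j) y (I i j)"
      "p y = - (norm (v y))\<^sup>2 / 3 + (\<Sum>i\<in>UNIV. \<Sum>j\<in>UNIV. I i j)" using p by blast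
    define X where "X i j = I i j - (T i j y + (if i = j then f i i y / 3 else 0))" for i j
    have "(\<Sum>i\<in>UNIV. \<Sum>j\<in>UNIV. if i = j then f i i y / 3 else (0::real)) = (norm (v y))\<^sup>2 / 3"
    proof -
      have "(\<Sum>i\<in>UNIV. \<Sum>j\<in>UNIV. if i = j then f i i y / 3 else (0::real)) = g y / 3"
        by (simp add: g_def sum_divide_distrib)
      then show ?thesis using y R by (simp add: g_eq)
    qed
    then have "p y = (\<Sum>i\<in>UNIV. \<Sum>j\<in>UNIV. T i j y) + (\<Sum>i\<in>UNIV. \<Sum>j\<in>UNIV. X i j)"
      unfolding I(2) X_def by (simp add: sum_subtractf sum.distrib)
    then have eq: "u y * p y - S y = u y * (\<Sum>i\<in>UNIV. \<Sum>j\<in>UNIV. X i j)"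
      unfolding S_def by (simp add: sum_distrib_left distrib_left)
    have "\<bar>u y * (\<Sum>i\<in>UNIV. \<Sum>j\<in>UNIV. X i j)\<bar> \<le> (4 * norm (v y)) * (\<Sum>i\<in>UNIV. \<Sum>j\<in>UNIV. \<bar>X i j\<bar>)"
      unfolding abs_mult
      by (intro mult_mono u_le order_trans[OF sum_abs] sum_mono sum_abs sum_nonneg) auto
    also have "\<dots> = 4 * (\<Sum>i\<in>UNIV. \<Sum>j\<in>UNIV. norm (v y) * \<bar>X i j\<bar>)"
      by (simp add: sum_distrib_left mult.assoc)
    also have "\<dots> \<le> 4 * (\<Sum>i\<in>(UNIV::3 set). \<Sum>j\<in>(UNIV::3 set). 5 * ball_const * norm (v y) ^ 3 + 10 * W / R\<^sup>2)"
      unfolding X_def by (intro mult_left_mono sum_mono far_field[OF False I(1)]) auto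
    also have "\<dots> = B y" using y R by (simp add: B_def)
    finally show ?thesis unfolding eq .
  qed
  have "\<bar>LBINT y. u y * p y - S y\<bar> \<le> (LBINT y. \<bar>u y * p y - S y\<bar>)"
    by (rule integral_abs_bound)
  also have "\<dots> \<le> (LBINT y. B y)"
    by (intro integral_mono diff integrable_abs Bochner_Integration.integrable_diff p_int S_int B_int)
  also have "\<dots> = 36 * (5 * ball_const * Q + 10 * W / R\<^sup>2 * (LBINT y. indicator (cball (0::real^3) R) y))"
    unfolding B_def Q_def
    by (subst integral_mult_right_zero, subst Bochner_Integration.integral_add)
       (intro integrable_mult_right Q_int ind, intro integrable_mult_right Q_int ind, simp only: integral_mult_right_zero)
  also have "(LBINT y. indicator (cball (0::real^3) R) y) = ball_const * R ^ 3"
    using emeasure_cball3[of R] R ball_const_nonneg by (simp add: measure_def)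
  also have "36 * (5 * ball_const * Q + 10 * W / R\<^sup>2 * (ball_const * R ^ 3)) = 180 * ball_const * Q + 360 * ball_const * (R * W)"
    using R by (simp add: field_simps eval_nat_numeral)
  finally have far: "\<bar>LBINT y. u y * p y - S y\<bar> \<le> 180 * ball_const * Q + 360 * ball_const * (R * W)" .
  have "(LBINT y. u y * p y) = (LBINT y. u y * p y - S y) + (LBINT y. S y)"
    using p_int S_int by simp
  then have "\<bar>LBINT y. u y * p y\<bar> \<le> 180 * ball_const * Q + 360 * ball_const * (R * W) + 9 * (13400 * Q)"
    using far S_le by linarith
  also have "\<dots> = (180 * ball_const + 120600) * Q + 360 * ball_const * (R * W)" by (simp add: algebra_simps)
  also have "\<dots> \<le> (180 * ball_const + 120600) * (5 * R * W) + 360 * ball_const * (R * W)"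
    using Q_le_W ball_const_nonneg by (intro add_right_mono mult_left_mono) auto
  \<comment> \<open>603000 = 5 * 9 * 13400 and 1260 = 5 * 180 + 360, the 5 coming from
    \<open>Q_le_W\<close>.\<close>
  also have "\<dots> = (603000 + 1260 * ball_const) * (R * W)" by (simp add: algebra_simps)
  finally show ?thesis .
qed

end

section \<open>The energy identity\<close>

text \<open>A box containing the ball of radius \<open>R\<close>: on it the integrals can be
  differentiated in time, and for functions supported in the ball they agree with the Lebesgue
  integrals over space.\<close>

definition cube :: "real \<Rightarrow> (real^3) set" where
  "cube R = cbox (- (\<chi> i. R)) (\<chi> i. R)"

lemma integral_compact_support:
  fixes f :: "real^3 \<Rightarrow> real"
  assumes cont: "continuous_on UNIV f" and supp: "\<And>y. f y \<noteq> 0 \<Longrightarrow> norm y \<le> R"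
  shows "integrable lborel f" and "(LBINT y. f y) = integral (cube R) f"
proof -
  have c: "f y = 0" if "y \<notin> cube R" for y
  proof (rule ccontr)
    assume "f y \<noteq> 0"
    then have "norm y \<le> R" by (rule supp)
    then have "\<bar>y $ i\<bar> \<le> R" for i using component_le_norm_cart[of y i] by linarith
    then have "y \<in> cube R" unfolding cube_def mem_box_cart by (auto simp: abs_le_iff minus_le_iff)
    then show False using that by simp
  qed
  have eq: "indicator (cube R) y *\<^sub>R f y = f y" for y using c[of y] by (cases "y \<in> cube R") auto
  have I: "integrable lborel (\<lambda>y. indicator (cube R) y *\<^sub>R f y)"
    unfolding cube_def by (intro borel_integrable_compact continuous_on_subset[OF cont]) auto
  then show "integrable lborel f" unfolding eq .
  show "(LBINT y. f y) = integral (cube R) f"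
    using set_borel_integral_eq_integral(2)[of "cube R" f] I
    unfolding set_integrable_def set_lebesgue_integral_def eq by simp
qed

lemma slice_integral_continuous:
  fixes k :: "(real^3) \<times> real \<Rightarrow> real"
  assumes cont: "continuous_on UNIV k" and supp: "\<And>y s. k (y, s) \<noteq> 0 \<Longrightarrow> norm y \<le> R"
  shows "continuous_on UNIV (\<lambda>s. LBINT y. k (y, s))"
proof -
  have sl: "continuous_on UNIV (\<lambda>y. k (y, s))" for s
    by (intro continuous_on_compose2[OF cont] continuous_intros) auto
  have "(LBINT y. k (y, s)) = integral (cube R) (\<lambda>y. k (y, s))" for s
    by (rule integral_compact_support(2)[OF sl supp])
  moreover have "continuous_on UNIV (\<lambda>s. integral (cube R) (\<lambda>y. k (y, s)))"
    unfolding cube_def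
    by (intro integral_continuous_on_param continuous_on_compose2[OF cont] continuous_intros)
       (auto simp: case_prod_beta' intro!: continuous_on_compose2[OF cont] continuous_intros)
  ultimately show ?thesis by simp
qed

lemma has_derivative_imp_continuous_on:
  assumes "\<And>y. (f has_derivative f' y) (at y)"
  shows "continuous_on UNIV f"
  using assms has_derivative_continuous continuous_at_imp_continuous_on by blast

text \<open>Difference quotients integrate to zero by translation invariance. The mean value theorem
  dominates them by a constant on the ball enlarged by \<open>norm e\<close>, the steps being at
  most 1.\<close>

lemma integral_directional_derivative:
  fixes g :: "real^3 \<Rightarrow> real"
  assumes d: "\<And>y. (g has_derivative g' y) (at y)" and cont: "continuous_on UNIV (\<lambda>y. g' y e)"
    and supp: "\<And>y. g y \<noteq> 0 \<Longrightarrow> norm y \<le> R"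
  shows "(LBINT y. g' y e) = 0"
proof -
  have gcont: "continuous_on UNIV g"
    by (rule has_derivative_imp_continuous_on[OF d])
  then have [measurable]: "g \<in> borel_measurable borel" by (rule borel_measurable_continuous_onI)
  have g'_supp: "norm y \<le> R" if "g' y e \<noteq> 0" for y
  proof (rule ccontr)
    assume "\<not> norm y \<le> R"
    then have y: "y \<in> - cball 0 R" by simp
    have "(g has_derivative (\<lambda>_. 0)) (at y)"
      by (rule has_derivative_transform_within_open[of "\<lambda>_. 0" _ _ _ "- cball 0 R"])
         (use y supp in auto)
    then have "g' y = (\<lambda>_. 0)" using d[of y] has_derivative_unique by blast
    then show False using that by simp
  qed
  obtain B where B: "\<And>y. \<bar>g' y e\<bar> \<le> B"
  proof -
    have "compact ((\<lambda>y. g' y e) ` cball 0 R)"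
      by (intro compact_continuous_image continuous_on_subset[OF cont]) auto
    then obtain B where B: "\<And>x. x \<in> (\<lambda>y. g' y e) ` cball 0 R \<Longrightarrow> norm x \<le> B"
      using compact_imp_bounded bounded_iff by metis
    have "\<bar>g' y e\<bar> \<le> max 0 B" for y
    proof (cases "g' y e = 0")
      case False
      then have "y \<in> cball 0 R" using g'_supp by simp
      then show ?thesis using B[of "g' y e"] by (intro max.coboundedI2) auto
    qed simp
    then show ?thesis using that by blast
  qed
  define t where "t n = 1 / real (Suc n)" for n
  have t: "0 < t n" "t n \<le> 1" for n by (auto simp: t_def)
  have t0: "t \<longlonglongrightarrow> 0" unfolding t_def using LIMSEQ_inverse_real_of_nat by (simp add: inverse_eq_divide)
  define q where "q n y = (g (y + t n *\<^sub>R e) - g y) / t n" for n y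
  have dl: "((\<lambda>\<tau>. g (y + \<tau> *\<^sub>R e)) has_real_derivative g' (y + \<tau> *\<^sub>R e) e) (at \<tau>)" for y \<tau>
  proof -
    have "((\<lambda>\<tau>. y + \<tau> *\<^sub>R e) has_derivative (\<lambda>h. h *\<^sub>R e)) (at \<tau>)" by (auto intro!: derivative_eq_intros)
    from has_derivative_compose[OF this d]
    have D: "((\<lambda>\<tau>. g (y + \<tau> *\<^sub>R e)) has_derivative (\<lambda>h. g' (y + \<tau> *\<^sub>R e) (h *\<^sub>R e))) (at \<tau>)" .
    have "linear (g' (y + \<tau> *\<^sub>R e))" using d has_derivative_linear by blast
    then have "(\<lambda>h. g' (y + \<tau> *\<^sub>R e) (h *\<^sub>R e)) = (*) (g' (y + \<tau> *\<^sub>R e) e)"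
      by (auto simp: fun_eq_iff linear_cmul mult.commute)
    then show ?thesis using D by (simp add: has_field_derivative_def)
  qed
  have q_le: "\<bar>q n y\<bar> \<le> B * indicator (cball 0 (R + norm e)) y" for n y
  proof (cases "norm y \<le> R + norm e")
    case True
    obtain z where "g (y + t n *\<^sub>R e) - g (y + 0 *\<^sub>R e) = (t n - 0) * g' (y + z *\<^sub>R e) e"
      using MVT2[of 0 "t n" "\<lambda>\<tau>. g (y + \<tau> *\<^sub>R e)" "\<lambda>\<tau>. g' (y + \<tau> *\<^sub>R e) e"] t dl by blast
    then have "q n y = g' (y + z *\<^sub>R e) e" using t[of n] by (simp add: q_def)
    then show ?thesis using True B by simp
  next
    case False
    have "norm (t n *\<^sub>R e) \<le> 1 * norm e" using mult_right_mono[of "t n" 1 "norm e"] t[of n] by simp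
    then have "\<not> norm (y + t n *\<^sub>R e) \<le> R" using False norm_diff_ineq[of y "t n *\<^sub>R e"] by linarith
    moreover have "\<not> norm y \<le> R" using False norm_ge_zero[of e] by linarith
    ultimately have "g (y + t n *\<^sub>R e) = 0" "g y = 0" using supp by blast+
    then show ?thesis using False by (simp add: q_def)
  qed
  have dom: "integrable lborel (\<lambda>y. B * indicator (cball (0::real^3) (R + norm e)) y)"
    by (intro integrable_mult_right integrable_real_indicator emeasure_bounded_finite bounded_cball) simp
  have lim: "(\<lambda>n. q n y) \<longlonglongrightarrow> g' y e" for y
  proof -
    have "((\<lambda>h. (g (y + (0 + h) *\<^sub>R e) - g (y + 0 *\<^sub>R e)) / h) \<longlongrightarrow> g' (y + 0 *\<^sub>R e) e) (at 0)"
      using dl[of y 0] unfolding DERIV_def .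
    moreover have "filterlim t (at 0) sequentially"
      unfolding filterlim_at using t t0 by (auto intro!: always_eventually) (metis less_irrefl)
    ultimately have "(\<lambda>n. (g (y + (0 + t n) *\<^sub>R e) - g (y + 0 *\<^sub>R e)) / t n) \<longlonglongrightarrow> g' (y + 0 *\<^sub>R e) e"
      by (rule filterlim_compose)
    then show ?thesis by (simp add: q_def)
  qed
  have g'_meas: "(\<lambda>y. g' y e) \<in> borel_measurable lborel"
    using cont borel_measurable_continuous_onI by fastforce
  have "(\<lambda>n. LBINT y. q n y) \<longlonglongrightarrow> (LBINT y. g' y e)"
  proof (rule integral_dominated_convergence[OF g'_meas _ dom])
    show "q n \<in> borel_measurable lborel" for n unfolding q_def[abs_def] by measurable
  qed (use lim q_le in auto)
  moreover have "(LBINT y. q n y) = 0" for n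
  proof -
    have gi: "integrable lborel g" by (rule integral_compact_support(1)[OF gcont supp])
    have "(LBINT y. q n y) = ((LBINT y. g (y + t n *\<^sub>R e)) - (LBINT y. g y)) / t n"
      unfolding q_def using gi lborel_translate(1)[of g "t n *\<^sub>R e"] by simp
    then show ?thesis using lborel_translate(2)[of g "t n *\<^sub>R e"] by simp
  qed
  ultimately show ?thesis by (simp add: LIMSEQ_const_iff)
qed

lemma blinfun_expansion:
  fixes f :: "(real^3) \<Rightarrow>\<^sub>L 'b::real_normed_vector"
  shows "blinfun_apply f w = (\<Sum>i\<in>UNIV. w $ i *\<^sub>R blinfun_apply f (axis i 1))"
proof -
  have "w = (\<Sum>i\<in>UNIV. w $ i *\<^sub>R axis i 1)"
    using basis_expansion[of w] by (simp add: scalar_mult_eq_scaleR)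
  then have "blinfun_apply f w = blinfun_apply f (\<Sum>i\<in>UNIV. w $ i *\<^sub>R axis i 1)" by simp
  then show ?thesis by (simp only: blinfun.sum_right blinfun.scaleR_right)
qed

lemma integral_by_parts_div:
  fixes g :: "real^3 \<Rightarrow> real" and g' :: "real^3 \<Rightarrow> (real^3) \<Rightarrow>\<^sub>L real"
    and F :: "real^3 \<Rightarrow> real^3" and F' :: "real^3 \<Rightarrow> (real^3) \<Rightarrow>\<^sub>L (real^3)"
  assumes dg: "\<And>y. (g has_derivative g' y) (at y)" and cg: "continuous_on UNIV g'"
    and dF: "\<And>y. (F has_derivative F' y) (at y)" and cF: "continuous_on UNIV F'"
    and supp: "\<And>y. g y \<noteq> 0 \<Longrightarrow> norm y \<le> R" and supp': "\<And>y. g' y \<noteq> 0 \<Longrightarrow> norm y \<le> R"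
  shows "(LBINT y. g' y (F y) + g y * (\<Sum>i\<in>UNIV. F' y (axis i 1) $ i)) = 0"
proof -
  note gc = has_derivative_imp_continuous_on[OF dg] and Fc = has_derivative_imp_continuous_on[OF dF]
  let ?h = "\<lambda>i y. g' y (axis i 1) * F y $ i + g y * F' y (axis i 1) $ i"
  have hc: "continuous_on UNIV (?h i)" for i
    by (intro continuous_intros gc Fc cg cF)
  have hs: "norm y \<le> R" if "?h i y \<noteq> 0" for i y
    using that supp[of y] supp'[of y] by (cases "g y = 0"; cases "g' y = 0") auto
  have z: "(LBINT y. ?h i y) = 0" for i
  proof -
    have "((\<lambda>y. g y * F y $ i) has_derivative (\<lambda>w. g y * F' y w $ i + g' y w * F y $ i)) (at y)" for y
      by (intro has_derivative_mult dg bounded_linear.has_derivative[OF bounded_linear_vec_nth] dF)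
    from integral_directional_derivative[OF this, of "axis i 1" R] hc[of i] supp
    show ?thesis by (simp add: add.commute)
  qed
  have "g' y (F y) + g y * (\<Sum>i\<in>UNIV. F' y (axis i 1) $ i) = (\<Sum>i\<in>UNIV. ?h i y)" for y
    unfolding blinfun_expansion[of "g' y" "F y"]
    by (simp add: sum.distrib sum_distrib_left mult.commute)
  then show ?thesis
    using z integral_compact_support(1)[OF hc hs] by simp
qed

section \<open>The cutoff and the energy identity on a time slice\<close>

definition psi :: "real \<Rightarrow> real^3 \<Rightarrow> real" where
  "psi R y = max 0 (1 - (norm y)\<^sup>2 / R\<^sup>2)"

text \<open>The square makes the positive part C^1 across |y| = R; the gradient -(4/R^2) psi y is
  explicit, and its radial component has the sign needed in the balance.\<close>

definition cutoff :: "real \<Rightarrow> real^3 \<Rightarrow> real" where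
  "cutoff R y = (psi R y)\<^sup>2"

lemma psi_nonneg: "0 \<le> psi R y" and psi_le: "psi R y \<le> 1"
  by (simp_all add: psi_def)

lemma psi_supp: assumes "0 < R" "psi R y \<noteq> 0" shows "norm y \<le> R"
proof -
  have "(norm y)\<^sup>2 / R\<^sup>2 \<le> 1" using assms(2) by (auto simp: psi_def max_def split: if_splits)
  then have "(norm y)\<^sup>2 \<le> R\<^sup>2" using assms(1) by simp
  then show ?thesis using assms(1) by (simp add: power2_le_iff_abs_le)
qed

lemma cutoff_supp: "0 < R \<Longrightarrow> cutoff R y \<noteq> 0 \<Longrightarrow> norm y \<le> R"
  using psi_supp by (auto simp: cutoff_def)

lemma psi_continuous: "continuous_on S (psi R)"
  unfolding psi_def divide_inverse by (intro continuous_intros)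

lemma cutoff_continuous: "continuous_on S (cutoff R)"
  unfolding cutoff_def by (intro continuous_intros psi_continuous)

lemma square_pos_part_deriv: "((\<lambda>x::real. (max 0 x)\<^sup>2) has_real_derivative 2 * max 0 x) (at x)"
proof -
  consider "0 < x" | "x < 0" | "x = 0" by linarith
  then show ?thesis
  proof cases
    case 1
    have "((\<lambda>x. x\<^sup>2) has_real_derivative 2 * x) (at x)" by (auto intro!: derivative_eq_intros)
    then have "((\<lambda>x. (max 0 x)\<^sup>2) has_real_derivative 2 * x) (at x)"
      by (rule has_field_derivative_transform_within_open[where S="{0<..}"]) (use 1 in auto)
    then show ?thesis using 1 by simp
  next
    case 2
    have "((\<lambda>x::real. 0) has_real_derivative 0) (at x)" by simp
    then have "((\<lambda>x. (max 0 x)\<^sup>2) has_real_derivative 0) (at x)"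
      by (rule has_field_derivative_transform_within_open[where S="{..<0}"]) (use 2 in auto)
    then show ?thesis using 2 by simp
  next
    case 3
    have "((\<lambda>h::real. (max 0 h)\<^sup>2 / h) \<longlongrightarrow> 0) (at 0)"
    proof (rule Lim_null_comparison)
      have "norm ((max 0 h)\<^sup>2 / h) \<le> \<bar>h\<bar>" for h :: real
        by (cases "0 < h") (auto simp: max_def power2_eq_square)
      then show "\<forall>\<^sub>F h in at 0. norm ((max 0 h)\<^sup>2 / h) \<le> \<bar>h\<bar>" by simp
      show "((\<lambda>h::real. \<bar>h\<bar>) \<longlongrightarrow> 0) (at 0)" by (intro tendsto_rabs_zero tendsto_ident_at)
    qed
    then show ?thesis using 3 by (simp add: DERIV_def)
  qed
qed

definition cutoff' :: "real \<Rightarrow> real^3 \<Rightarrow> (real^3) \<Rightarrow>\<^sub>L real" where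
  "cutoff' R y = - (4 / R\<^sup>2 * psi R y) *\<^sub>R blinfun_inner_right y"

lemma cutoff'_apply: "cutoff' R y w = - (4 / R\<^sup>2 * psi R y * (y \<bullet> w))"
  by (simp add: cutoff'_def blinfun.scaleR_left blinfun.minus_left)

lemma cutoff_has_derivative: "(cutoff R has_derivative cutoff' R y) (at y)"
proof -
  have 1: "((\<lambda>y. 1 - (y \<bullet> y) / R\<^sup>2) has_derivative (\<lambda>w. - (2 * (y \<bullet> w)) / R\<^sup>2)) (at y)"
    unfolding divide_inverse by (auto intro!: derivative_eq_intros simp: inner_commute)
  have 2: "((\<lambda>x::real. (max 0 x)\<^sup>2) has_derivative (\<lambda>h. 2 * max 0 x * h)) (at x)" for x
    using square_pos_part_deriv[of x] by (simp add: has_field_derivative_def mult_commute_abs)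
  have "((\<lambda>y. (max 0 (1 - (y \<bullet> y) / R\<^sup>2))\<^sup>2) has_derivative
     (\<lambda>w. 2 * max 0 (1 - (y \<bullet> y) / R\<^sup>2) * (- (2 * (y \<bullet> w)) / R\<^sup>2))) (at y)"
    by (rule has_derivative_compose[OF 1 2])
  moreover have "(\<lambda>w. 2 * max 0 (1 - (y \<bullet> y) / R\<^sup>2) * (- (2 * (y \<bullet> w)) / R\<^sup>2)) = cutoff' R y"
    by (auto simp: fun_eq_iff cutoff'_apply psi_def power2_norm_eq_inner)
  moreover have "(\<lambda>y. (max 0 (1 - (y \<bullet> y) / R\<^sup>2))\<^sup>2) = cutoff R"
    by (auto simp: fun_eq_iff cutoff_def psi_def power2_norm_eq_inner)
  ultimately show ?thesis by simp
qed

lemma cutoff'_continuous: "continuous_on UNIV (cutoff' R)"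
  unfolding cutoff'_def
  by (intro continuous_intros psi_continuous bounded_linear.continuous_on[OF bounded_linear_blinfun_inner_right])

text \<open>In the product with v the damping gives 2 \<alpha>/(\<alpha> + 1), while integrating the
  drift by parts gives -3/(\<alpha> + 1) because div y = 3; hence the threshold 3/2. Convection and
  pressure form one transport term v.grad(q + p), which loses its divergence part since div v =
  0.\<close>

lemma slice_energy:
  fixes v :: "real^3 \<Rightarrow> real^3" and v' :: "real^3 \<Rightarrow> (real^3) \<Rightarrow>\<^sub>L (real^3)"
    and p :: "real^3 \<Rightarrow> real" and p' :: "real^3 \<Rightarrow> (real^3) \<Rightarrow>\<^sub>L real" and vt :: "real^3 \<Rightarrow> real^3"
  assumes R: "0 < R" and \<alpha>: "\<alpha> > -1"
    and dv: "\<And>y. (v has_derivative v' y) (at y)" and cv: "continuous_on UNIV v'"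
    and dp: "\<And>y. (p has_derivative p' y) (at y)" and cp: "continuous_on UNIV p'"
    and ct: "continuous_on UNIV vt"
    and div: "\<And>y. (\<Sum>i\<in>UNIV. v' y (axis i 1) $ i) = 0"
    and pde: "\<And>y. vt y + (\<alpha> / (\<alpha> + 1)) *\<^sub>R v y + (1 / (\<alpha> + 1)) *\<^sub>R v' y y + v' y (v y)
        = - (\<chi> i. p' y (axis i 1))"
  shows "(LBINT y. (v y \<bullet> vt y) * cutoff R y)
    = - ((2 * \<alpha> - 3) / (\<alpha> + 1) * (LBINT y. (v y \<bullet> v y) / 2 * cutoff R y)
       + 1 / (\<alpha> + 1) * (LBINT y. 4 / R\<^sup>2 * psi R y * (y \<bullet> y) * ((v y \<bullet> v y) / 2))
       + (LBINT y. 4 / R\<^sup>2 * psi R y * (y \<bullet> v y) * ((v y \<bullet> v y) / 2 + p y)))"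
proof -
  note vc = has_derivative_imp_continuous_on[OF dv] and pc = has_derivative_imp_continuous_on[OF dp]
  note cs = continuous_intros vc pc cv cp ct psi_continuous cutoff_continuous cutoff'_continuous
  note sp = psi_supp[OF R] cutoff_supp[OF R]
  define q where "q y = (v y \<bullet> v y) / 2" for y
  have qc: "continuous_on UNIV q" unfolding q_def by (intro cs) simp
  define q' where "q' y = blinfun_inner_right (v y) o\<^sub>L v' y" for y
  have q'_apply: "q' y w = v y \<bullet> v' y w" for y w by (simp add: q'_def)
  have q'c: "continuous_on UNIV q'"
    unfolding q'_def by (intro cs bounded_linear.continuous_on[OF bounded_linear_blinfun_inner_right])
  have dq: "(q has_derivative q' y) (at y)" for y
  proof -
    have "((\<lambda>y. (v y \<bullet> v y) / 2) has_derivative (\<lambda>w. (v y \<bullet> v' y w + v' y w \<bullet> v y) / 2)) (at y)"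
      by (intro bounded_linear.has_derivative[OF bounded_linear_divide] has_derivative_inner dv)
    moreover have "(\<lambda>w. (v y \<bullet> v' y w + v' y w \<bullet> v y) / 2) = q' y"
      by (auto simp: fun_eq_iff q'_apply inner_commute)
    ultimately show ?thesis unfolding q_def[abs_def] by simp
  qed
  \<comment> \<open>Stated for a general field \<open>F\<close> and an extra potential
    \<open>h\<close>: it is used with \<open>F\<close> the identity and \<open>h = 0\<close> for the
    drift, and with \<open>F = v\<close> and \<open>h = p\<close> for transport.\<close>
  have ibp: "(LBINT y. (q' y (F y) + h' y (F y)) * cutoff R y + (q y + h y) * cutoff' R y (F y)
       + (q y + h y) * cutoff R y * (\<Sum>i\<in>UNIV. F' y (axis i 1) $ i)) = 0"
    if F: "\<And>y. (F has_derivative blinfun_apply (F' y)) (at y)" "continuous_on UNIV F'"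
      and h: "\<And>y. (h has_derivative blinfun_apply (h' y)) (at y)" "continuous_on UNIV h'" for F F' h h'
  proof -
    note hc = has_derivative_imp_continuous_on[OF h(1)]
    define g' where "g' y = (q y + h y) *\<^sub>R cutoff' R y + cutoff R y *\<^sub>R (q' y + h' y)" for y
    have g'_apply: "g' y w = (q y + h y) * cutoff' R y w + (q' y w + h' y w) * cutoff R y" for y w
      by (simp add: g'_def blinfun.add_left blinfun.scaleR_left mult.commute)
    have dg: "((\<lambda>y. (q y + h y) * cutoff R y) has_derivative g' y) (at y)" for y
    proof -
      have "((\<lambda>y. (q y + h y) * cutoff R y) has_derivative
        (\<lambda>w. (q y + h y) * cutoff' R y w + (q' y w + h' y w) * cutoff R y)) (at y)"
        by (intro has_derivative_mult has_derivative_add dq h cutoff_has_derivative)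
      moreover have "(\<lambda>w. (q y + h y) * cutoff' R y w + (q' y w + h' y w) * cutoff R y) = g' y"
        by (simp add: fun_eq_iff g'_apply)
      ultimately show ?thesis by simp
    qed
    have "(LBINT y. g' y (F y) + (q y + h y) * cutoff R y * (\<Sum>i\<in>UNIV. F' y (axis i 1) $ i)) = 0"
    proof (rule integral_by_parts_div[OF dg _ F, of R])
      show "continuous_on UNIV g'" unfolding g'_def by (intro cs qc hc q'c h)
      show "norm y \<le> R" if "(q y + h y) * cutoff R y \<noteq> 0" for y using that sp by auto
      show "norm y \<le> R" if "g' y \<noteq> 0" for y
        using that sp[of y] unfolding g'_def cutoff'_def by (cases "psi R y = 0") (auto simp: cutoff_def)
    qed
    then show ?thesis by (simp add: g'_apply add_ac)
  qed
  define a b where "a = \<alpha> / (\<alpha> + 1)" and "b = 1 / (\<alpha> + 1)"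
  define k1 k2 k3 k4 k5 where "k1 y = (v y \<bullet> vt y) * cutoff R y"
    and "k2 y = q y * cutoff R y"
    and "k3 y = 4 / R\<^sup>2 * psi R y * (y \<bullet> y) * q y"
    and "k4 y = 4 / R\<^sup>2 * psi R y * (y \<bullet> v y) * (q y + p y)"
    and "k5 y = q' y y * cutoff R y" for y
  define k6 where "k6 y = (q' y (v y) + p' y (v y)) * cutoff R y" for y
  have I: "integrable lborel k1" "integrable lborel k2" "integrable lborel k3"
    "integrable lborel k4" "integrable lborel k5" "integrable lborel k6"
    unfolding k1_def k2_def k3_def k4_def k5_def k6_def
    by (rule integral_compact_support(1)[where R=R], (intro cs qc q'c)[1], use sp in force)+
  have e1: "(LBINT y. k5 y) - (LBINT y. k3 y) + 3 * (LBINT y. k2 y) = 0"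
  proof -
    have id: "((\<lambda>y::real^3. y) has_derivative blinfun_apply id_blinfun) (at y)" for y by simp
    have d3: "(\<Sum>i\<in>UNIV. blinfun_apply id_blinfun (axis i (1::real)) $ (i::3)) = 3" by (simp add: axis_def)
    have "(LBINT y. k5 y - k3 y + 3 * k2 y) = 0"
    proof -
      have zero: "((\<lambda>y::real^3. 0::real) has_derivative blinfun_apply 0) (at y)" for y
        unfolding zero_blinfun.rep_eq by (rule has_derivative_const)
      have "(LBINT y. (q' y y + blinfun_apply 0 y) * cutoff R y + (q y + 0) * cutoff' R y y
         + (q y + 0) * cutoff R y * (\<Sum>i\<in>UNIV. blinfun_apply id_blinfun (axis i (1::real)) $ (i::3))) = 0"
        by (rule ibp[OF id _ zero]) (intro continuous_intros)+
      then show ?thesis unfolding d3 by (simp add: k2_def k3_def k5_def cutoff'_apply algebra_simps)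
    qed
    then show ?thesis using I by simp
  qed
  have e2: "(LBINT y. k6 y) - (LBINT y. k4 y) = 0"
  proof -
    have "(LBINT y. k6 y - k4 y) = 0"
      using ibp[OF dv cv dp cp] by (simp add: div k6_def k4_def cutoff'_apply algebra_simps)
    then show ?thesis using I by simp
  qed
  have pt: "k1 y = - (2 * a * k2 y + b * k5 y + k6 y)" for y
  proof -
    have "v y \<bullet> (vt y + a *\<^sub>R v y + b *\<^sub>R v' y y + v' y (v y)) = - (v y \<bullet> (\<chi> i. p' y (axis i 1)))"
      unfolding a_def b_def pde by simp
    also have "v y \<bullet> (\<chi> i. p' y (axis i 1)) = p' y (v y)"
      unfolding blinfun_expansion[of "p' y" "v y"] by (simp add: inner_vec_def)
    finally have vv: "v y \<bullet> vt y = - (2 * a * q y + b * q' y y + q' y (v y) + p' y (v y))"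
      by (simp add: inner_add_right q_def q'_apply algebra_simps)
    show ?thesis unfolding k1_def k2_def k5_def k6_def vv by (simp add: algebra_simps)
  qed
  have "(LBINT y. k1 y) = - (2 * a * (LBINT y. k2 y) + b * (LBINT y. k5 y) + (LBINT y. k6 y))"
    unfolding pt using I by simp
  also have "\<dots> = - ((2 * a - 3 * b) * (LBINT y. k2 y) + b * (LBINT y. k3 y) + (LBINT y. k4 y))"
  proof -
    have k5: "(LBINT y. k5 y) = (LBINT y. k3 y) - 3 * (LBINT y. k2 y)" using e1 by simp
    have k6: "(LBINT y. k6 y) = (LBINT y. k4 y)" using e2 by simp
    show ?thesis unfolding k5 k6 by (simp add: algebra_simps)
  qed
  also have "2 * a - 3 * b = (2 * \<alpha> - 3) / (\<alpha> + 1)" by (simp add: a_def b_def diff_divide_distrib)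
  finally show ?thesis unfolding k1_def k2_def k3_def k4_def q_def b_def .
qed

section \<open>Periodic solutions\<close>

lemma psi_mono: "0 < R \<Longrightarrow> R \<le> R' \<Longrightarrow> psi R y \<le> psi R' y"
  unfolding psi_def by (intro max.mono diff_left_mono divide_left_mono power_mono mult_pos_pos zero_less_power) auto

text \<open>Domination and convergence are available only for almost every time, whereas the balance
  integrates continuous functions over the closed interval; both integrals are identified
  here.\<close>

lemma time_integral_limit:
  fixes D :: "nat \<Rightarrow> real \<Rightarrow> real"
  assumes cont: "\<And>n. continuous_on UNIV (D n)" and g: "set_integrable lborel {0<..<S} g"
    and AE: "AE s in lborel. s \<in> {0<..<S} \<longrightarrow> (\<forall>n. \<bar>D n s\<bar> \<le> g s) \<and> (\<lambda>n. D n s) \<longlonglongrightarrow> 0"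
  shows "(\<lambda>n. integral {0..S} (D n)) \<longlonglongrightarrow> 0"
proof -
  have [measurable]: "D n \<in> borel_measurable borel" for n
    using cont by (rule borel_measurable_continuous_onI)
  have eq: "integral {0..S} (D n) = (LBINT s. indicator {0<..<S} s *\<^sub>R D n s)" for n
  proof -
    have "set_integrable lborel {0..S} (D n)"
      by (intro borel_integrable_atLeastAtMost' continuous_on_subset[OF cont]) auto
    then have "set_integrable lborel {0<..<S} (D n)" by (rule set_integrable_subset) auto
    from set_borel_integral_eq_integral(2)[OF this] show ?thesis
      by (simp add: set_lebesgue_integral_def integral_open_interval_real)
  qed
  have "(\<lambda>n. LBINT s. indicator {0<..<S} s *\<^sub>R D n s) \<longlonglongrightarrow> integral\<^sup>L lborel (\<lambda>s::real. 0::real)"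
  proof (rule integral_dominated_convergence)
    show "integrable lborel (\<lambda>s. indicator {0<..<S} s *\<^sub>R g s)" using g by (simp add: set_integrable_def)
    show "AE s in lborel. norm (indicator {0<..<S} s *\<^sub>R D n s) \<le> indicator {0<..<S} s *\<^sub>R g s" for n
      using AE by eventually_elim (auto simp: indicator_def)
    show "AE s in lborel. (\<lambda>n. indicator {0<..<S} s *\<^sub>R D n s) \<longlonglongrightarrow> 0"
      using AE by eventually_elim (auto simp: indicator_def)
  qed measurable
  then show ?thesis unfolding eq by simp
qed

lemma blinfun_local_lipschitz:
  fixes v :: "real^3 \<Rightarrow> real^3"
  assumes d: "\<And>y. (v has_derivative blinfun_apply (v' y)) (at y)" and c: "continuous_on UNIV v'"
  shows "\<exists>L. \<forall>x\<in>cball 0 r. \<forall>y\<in>cball 0 r. norm (v x - v y) \<le> L * norm (x - y)"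
proof -
  have "compact (v' ` cball 0 r)"
    by (intro compact_continuous_image continuous_on_subset[OF c]) auto
  then obtain L where "\<And>x. x \<in> v' ` cball 0 r \<Longrightarrow> norm x \<le> L"
    using compact_imp_bounded bounded_iff by metis
  then have "norm (v x - v y) \<le> L * norm (x - y)" if "x \<in> cball 0 r" "y \<in> cball 0 r" for x y
    using that
    by (intro differentiable_bound[of "cball 0 r" v "\<lambda>y. blinfun_apply (v' y)"])
       (auto intro: has_derivative_at_withinI[OF d] simp: norm_blinfun.rep_eq[symmetric])
  then show ?thesis by blast
qed

section \<open>Space-time solutions and the balance over one period\<close>

locale periodic_solution =
  fixes \<alpha> S :: real and V :: "(real^3) \<times> real \<Rightarrow> real^3" and P :: "(real^3) \<times> real \<Rightarrow> real"
    and V' :: "(real^3) \<times> real \<Rightarrow> ((real^3) \<times> real) \<Rightarrow>\<^sub>L (real^3)"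
    and P' :: "(real^3) \<times> real \<Rightarrow> ((real^3) \<times> real) \<Rightarrow>\<^sub>L real"
  assumes \<alpha>: "\<alpha> > -1" and S: "0 < S"
    and dV: "\<And>x. (V has_derivative V' x) (at x)" and cV': "continuous_on UNIV V'"
    and dP: "\<And>x. (P has_derivative P' x) (at x)" and cP': "continuous_on UNIV P'"
    and periodic: "time_periodic S V"
    and Euler: "solves_self_similar_Euler \<alpha> V P"
    and pressure: "pressure_given_by V P"
begin

lemmas cV = has_derivative_imp_continuous_on[OF dV] and cP = has_derivative_imp_continuous_on[OF dP]

text \<open>The inclusion of space into space-time; composition with it restricts a derivative to
  space and keeps its continuity as a bounded linear map.\<close>

definition J :: "(real^3) \<Rightarrow>\<^sub>L ((real^3) \<times> real)" where "J = Blinfun (\<lambda>w. (w, 0))"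

lemma J_apply: "blinfun_apply J w = (w, 0)"
  unfolding J_def by (subst bounded_linear_Blinfun_apply) (auto intro: bounded_linear_Pair bounded_linear_ident bounded_linear_zero)

definition vd :: "real \<Rightarrow> real^3 \<Rightarrow> (real^3) \<Rightarrow>\<^sub>L (real^3)" where "vd s y = V' (y, s) o\<^sub>L J"
definition pd :: "real \<Rightarrow> real^3 \<Rightarrow> (real^3) \<Rightarrow>\<^sub>L real" where "pd s y = P' (y, s) o\<^sub>L J"
definition vt :: "real \<Rightarrow> real^3 \<Rightarrow> real^3" where "vt s y = V' (y, s) (0, 1)"

lemma slice_derivative: "((\<lambda>y. (y, s)) has_derivative (\<lambda>w. (w, 0))) (at y)"
  by (auto intro!: derivative_eq_intros)

lemma vd_derivative: "((\<lambda>y. V (y, s)) has_derivative vd s y) (at y)"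
proof -
  have "((\<lambda>y. V (y, s)) has_derivative (\<lambda>w. V' (y, s) (w, 0))) (at y)"
    by (rule has_derivative_compose[OF slice_derivative dV])
  moreover have "(\<lambda>w. V' (y, s) (w, 0)) = vd s y" by (simp add: fun_eq_iff vd_def J_apply)
  ultimately show ?thesis by simp
qed

lemma pd_derivative: "((\<lambda>y. P (y, s)) has_derivative pd s y) (at y)"
proof -
  have "((\<lambda>y. P (y, s)) has_derivative (\<lambda>w. P' (y, s) (w, 0))) (at y)"
    by (rule has_derivative_compose[OF slice_derivative dP])
  moreover have "(\<lambda>w. P' (y, s) (w, 0)) = pd s y" by (simp add: fun_eq_iff pd_def J_apply)
  ultimately show ?thesis by simp
qed

lemma vt_derivative: "((\<lambda>t. V (y, t)) has_vector_derivative vt s y) (at s)"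
proof -
  have "((\<lambda>t. (y, t)) has_derivative (\<lambda>h. (0, h))) (at s)" by (auto intro!: derivative_eq_intros)
  from has_derivative_compose[OF this dV]
  have "((\<lambda>t. V (y, t)) has_derivative (\<lambda>h. V' (y, s) (0, h))) (at s)" .
  moreover have "V' (y, s) (0, h) = h *\<^sub>R vt s y" for h
    using blinfun.scaleR_right[of "V' (y, s)" h "(0, 1)"] by (simp add: vt_def)
  ultimately show ?thesis by (simp add: has_vector_derivative_def)
qed

lemma continuous_slices:
  "continuous_on UNIV (vd s)" "continuous_on UNIV (pd s)" "continuous_on UNIV (vt s)"
  "continuous_on UNIV (\<lambda>y. V (y, s))" "continuous_on UNIV (\<lambda>y. P (y, s))"
  unfolding vd_def vt_def pd_def
  by (auto intro!: continuous_intros continuous_on_compose2[OF cV'] continuous_on_compose2[OF cP']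
      continuous_on_compose2[OF cV] continuous_on_compose2[OF cP])

lemma dir_deriv_V: "dir_deriv a V (y, s) = vd s y a"
  unfolding dir_deriv_def using frechet_derivative_at[OF vd_derivative] by simp

lemma Euler_slice:
  "vt s y + (\<alpha> / (\<alpha> + 1)) *\<^sub>R V (y, s) + (1 / (\<alpha> + 1)) *\<^sub>R vd s y y + vd s y (V (y, s))
     = - (\<chi> i. pd s y (axis i 1))"
proof -
  have "time_deriv V (y, s) = vt s y"
    unfolding time_deriv_def using vector_derivative_at[OF vt_derivative] by simp
  moreover have "space_grad P (y, s) = (\<chi> i. pd s y (axis i 1))"
    unfolding space_grad_def dir_deriv_def using frechet_derivative_at[OF pd_derivative, symmetric] by simp
  ultimately show ?thesis
    using Euler unfolding solves_self_similar_Euler_def dir_deriv_V by metis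
qed

lemma div_slice: "(\<Sum>i\<in>UNIV. vd s y (axis i 1) $ i) = 0"
proof -
  have "((\<lambda>y. V (y, s) $ i) has_derivative (\<lambda>w. vd s y w $ i)) (at y)" for i
    by (rule bounded_linear.has_derivative[OF bounded_linear_vec_nth vd_derivative])
  from frechet_derivative_at[OF this]
  have "dir_deriv (axis i 1) (\<lambda>x'. V x' $ i) (y, s) = vd s y (axis i 1) $ i" for i
    unfolding dir_deriv_def by (simp add: fun_eq_iff)
  then have "space_div V (y, s) = (\<Sum>i\<in>UNIV. vd s y (axis i 1) $ i)"
    unfolding space_div_def by simp
  then show ?thesis using Euler unfolding solves_self_similar_Euler_def by metis
qed

text \<open>\<open>A\<close>, \<open>B\<close> and \<open>D\<close> are the quantities of the
  balance at a fixed time, with the negative cutoff gradient written out as 4/R^2 psi y.\<close>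

definition A :: "real \<Rightarrow> real \<Rightarrow> real" where
  "A R s = (LBINT y. (V (y, s) \<bullet> V (y, s)) / 2 * cutoff R y)"
definition B :: "real \<Rightarrow> real \<Rightarrow> real" where
  "B R s = (LBINT y. 4 / R\<^sup>2 * psi R y * (y \<bullet> y) * ((V (y, s) \<bullet> V (y, s)) / 2))"
definition D :: "real \<Rightarrow> real \<Rightarrow> real" where
  "D R s = (LBINT y. 4 / R\<^sup>2 * psi R y * (y \<bullet> V (y, s)) * ((V (y, s) \<bullet> V (y, s)) / 2 + P (y, s)))"

lemma slice_identity:
  "0 < R \<Longrightarrow> (LBINT y. (V (y, s) \<bullet> vt s y) * cutoff R y)
     = - ((2 * \<alpha> - 3) / (\<alpha> + 1) * A R s + 1 / (\<alpha> + 1) * B R s + D R s)"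
  unfolding A_def B_def D_def
  by (rule slice_energy[OF _ \<alpha> vd_derivative continuous_slices(1) pd_derivative continuous_slices(2,3) div_slice Euler_slice])

lemma continuous_fields:
  "continuous_on T (\<lambda>p. V (f p, g p))" "continuous_on T (\<lambda>p. P (f p, g p))"
  if "continuous_on T f" "continuous_on T g" for T :: "('x::topological_space) set" and f g
  using that by (auto intro!: continuous_on_compose2[OF cV] continuous_on_compose2[OF cP] continuous_intros)

lemma continuous_ABD:
  assumes R: "0 < R"
  shows "continuous_on UNIV (A R)" "continuous_on UNIV (B R)" "continuous_on UNIV (D R)"
proof -
  have psi: "continuous_on UNIV (\<lambda>x::(real^3) \<times> real. psi R (fst x))"
    by (rule continuous_on_compose2[OF psi_continuous[of UNIV]]) (intro continuous_intros, simp)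
  have cut: "continuous_on UNIV (\<lambda>x::(real^3) \<times> real. cutoff R (fst x))"
    by (rule continuous_on_compose2[OF cutoff_continuous[of UNIV]]) (intro continuous_intros, simp)
  have R2: "R\<^sup>2 \<noteq> 0" using R by simp
  note cs = continuous_intros continuous_fields psi cut cV cP
  have "continuous_on UNIV (\<lambda>s. LBINT y. (\<lambda>x. (V x \<bullet> V x) / 2 * cutoff R (fst x)) (y, s))"
    by (rule slice_integral_continuous[where R=R], (intro cs, simp), use cutoff_supp[OF R] in auto)
  then show "continuous_on UNIV (A R)" by (simp add: A_def[abs_def])
  have "continuous_on UNIV (\<lambda>s. LBINT y. (\<lambda>x. 4 / R\<^sup>2 * psi R (fst x) * (fst x \<bullet> fst x) * ((V x \<bullet> V x) / 2)) (y, s))"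
    by (rule slice_integral_continuous[where R=R], (intro cs, simp), use psi_supp[OF R] in auto)
  then show "continuous_on UNIV (B R)" by (simp add: B_def[abs_def])
  have "continuous_on UNIV (\<lambda>s. LBINT y. (\<lambda>x. 4 / R\<^sup>2 * psi R (fst x) * (fst x \<bullet> V x) * ((V x \<bullet> V x) / 2 + P x)) (y, s))"
    by (rule slice_integral_continuous[where R=R], (intro cs, simp), use psi_supp[OF R] in auto)
  then show "continuous_on UNIV (D R)" by (simp add: D_def[abs_def])
qed

lemma integrable_ABD:
  assumes R: "0 < R"
  shows "A R integrable_on {0..S}" "B R integrable_on {0..S}" "D R integrable_on {0..S}"
  by (rule integrable_continuous_real continuous_on_subset[OF continuous_ABD(1)[OF R]]
      continuous_on_subset[OF continuous_ABD(2)[OF R]] continuous_on_subset[OF continuous_ABD(3)[OF R]] subset_UNIV)+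

lemma A_cube: "0 < R \<Longrightarrow> A R s = integral (cube R) (\<lambda>y. (V (y, s) \<bullet> V (y, s)) / 2 * cutoff R y)"
  unfolding A_def
  by (rule integral_compact_support(2))
     (use cutoff_supp in \<open>auto intro!: continuous_intros cutoff_continuous continuous_slices\<close>)

lemma A_derivative:
  assumes R: "0 < R"
  shows "(A R has_vector_derivative - ((2 * \<alpha> - 3) / (\<alpha> + 1) * A R s + 1 / (\<alpha> + 1) * B R s + D R s)) (at s)"
proof -
  have "((\<lambda>s. integral (cube R) (\<lambda>y. (V (y, s) \<bullet> V (y, s)) / 2 * cutoff R y)) has_vector_derivative
      integral (cube R) (\<lambda>y. (V (y, s) \<bullet> vt s y) * cutoff R y)) (at s within UNIV)"
    unfolding cube_def
  proof (rule leibniz_rule_vector_derivative)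
    show "((\<lambda>s. (V (y, s) \<bullet> V (y, s)) / 2 * cutoff R y) has_vector_derivative (V (y, s) \<bullet> vt s y) * cutoff R y) (at s within UNIV)" for s y
    proof -
      have d: "((\<lambda>t. V (y, t)) has_derivative (\<lambda>h. h *\<^sub>R vt s y)) (at s)"
        using vt_derivative by (simp add: has_vector_derivative_def)
      have "((\<lambda>s. (V (y, s) \<bullet> V (y, s)) / 2 * cutoff R y) has_derivative
        (\<lambda>h. (V (y, s) \<bullet> (h *\<^sub>R vt s y) + (h *\<^sub>R vt s y) \<bullet> V (y, s)) / 2 * cutoff R y)) (at s)"
        by (intro bounded_linear.has_derivative[OF bounded_linear_mult_left] bounded_linear.has_derivative[OF bounded_linear_divide] has_derivative_inner d)
      moreover have "(\<lambda>h. (V (y, s) \<bullet> (h *\<^sub>R vt s y) + (h *\<^sub>R vt s y) \<bullet> V (y, s)) / 2 * cutoff R y)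
         = (\<lambda>h. h *\<^sub>R ((V (y, s) \<bullet> vt s y) * cutoff R y))"
        by (auto simp: fun_eq_iff inner_commute)
      ultimately show ?thesis by (simp add: has_vector_derivative_def)
    qed
    show "(\<lambda>y. (V (y, s) \<bullet> V (y, s)) / 2 * cutoff R y) integrable_on cbox (- (\<chi> i. R)) (\<chi> i. R)" for s
      by (intro integrable_continuous continuous_intros cutoff_continuous continuous_on_subset[OF continuous_slices(4)]) auto
    show "continuous_on (UNIV \<times> cbox (- (\<chi> i. R)) (\<chi> i. R)) (\<lambda>(s, y). V (y, s) \<bullet> vt s y * cutoff R y)"
      unfolding vt_def case_prod_beta
      by (auto intro!: continuous_intros continuous_fields continuous_on_compose2[OF cV'] continuous_on_compose2[OF cutoff_continuous[of UNIV]])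
  qed auto
  moreover have "integral (cube R) (\<lambda>y. (V (y, s) \<bullet> vt s y) * cutoff R y) = (LBINT y. (V (y, s) \<bullet> vt s y) * cutoff R y)"
    by (rule integral_compact_support(2)[symmetric])
       (use cutoff_supp[OF R] in \<open>auto intro!: continuous_intros cutoff_continuous continuous_slices\<close>)
  ultimately show ?thesis
    unfolding slice_identity[OF R] A_cube[OF R, symmetric] by simp
qed

lemma periodic_V: "V (y, s + S) = V (y, s)"
  using periodic by (simp add: time_periodic_def)

text \<open>The boundary values of \<open>A R\<close> at 0 and \<open>S\<close> agree by
  periodicity, so its derivative has integral zero.\<close>

lemma energy_balance:
  assumes R: "0 < R"
  shows "(2 * \<alpha> - 3) / (\<alpha> + 1) * integral {0..S} (A R) + 1 / (\<alpha> + 1) * integral {0..S} (B R) + integral {0..S} (D R) = 0"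
proof -
  have "((\<lambda>s. - ((2 * \<alpha> - 3) / (\<alpha> + 1) * A R s + 1 / (\<alpha> + 1) * B R s + D R s)) has_integral A R S - A R 0) {0..S}"
    using S by (intro fundamental_theorem_of_calculus has_vector_derivative_at_within[OF A_derivative[OF R]]) simp
  moreover have "A R S = A R 0" using periodic_V[of _ 0] by (simp add: A_def)
  ultimately have "((\<lambda>s. - ((2 * \<alpha> - 3) / (\<alpha> + 1) * A R s + 1 / (\<alpha> + 1) * B R s + D R s)) has_integral 0) {0..S}"
    by simp
  from has_integral_neg[OF this]
  have 1: "((\<lambda>s. (2 * \<alpha> - 3) / (\<alpha> + 1) * A R s + 1 / (\<alpha> + 1) * B R s + D R s) has_integral 0) {0..S}"
    by (simp only: minus_minus minus_zero)
  note i = integrable_ABD[OF R]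
  have 2: "((\<lambda>s. (2 * \<alpha> - 3) / (\<alpha> + 1) * A R s + 1 / (\<alpha> + 1) * B R s + D R s) has_integral
     ((2 * \<alpha> - 3) / (\<alpha> + 1) * integral {0..S} (A R) + 1 / (\<alpha> + 1) * integral {0..S} (B R) + integral {0..S} (D R))) {0..S}"
    by (intro has_integral_add has_integral_mult_right integrable_integral i)
  show ?thesis by (rule has_integral_unique[OF 2 1])
qed

lemma A_nonneg: "0 \<le> A R s" and B_nonneg: "0 \<le> B R s"
  unfolding A_def B_def cutoff_def by (auto intro!: integral_nonneg_AE AE_I2 mult_nonneg_nonneg divide_nonneg_nonneg psi_nonneg)

lemma A_mono:
  assumes R: "0 < R" "R \<le> R'" shows "A R s \<le> A R' s"
proof -
  have R': "0 < R'" using R by simp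
  have I: "integrable lborel (\<lambda>y. (V (y, s) \<bullet> V (y, s)) / 2 * cutoff r y)" if "0 < r" for r
    by (rule integral_compact_support(1)[where R=r])
       (use cutoff_supp[OF that] in \<open>auto intro!: continuous_intros cutoff_continuous continuous_slices\<close>)
  show ?thesis unfolding A_def
    by (intro integral_mono I R R' mult_left_mono) (auto simp: cutoff_def intro!: power_mono psi_mono R psi_nonneg)
qed

text \<open>The last 10 belongs to the kinetic part |V|^2/2 of the flux, which contributes at most 2
  Q <= 10 R W; the rest is from the pressure.\<close>

definition flux_const :: real where "flux_const = 603000 + 1260 * ball_const + 10"

lemma flux_const_nonneg: "0 \<le> flux_const" using ball_const_nonneg by (simp add: flux_const_def)

text \<open>Normalising \<open>u\<close> to the size of the velocity leaves a factor 1/R in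
  \<open>D\<close>, which cancels the \<open>R\<close> in the bound R W of the pairing.\<close>

lemma D_bound:
  assumes R: "0 < R" and W: "integrable lborel (\<lambda>z. norm (V (z, s)) ^ 3 * weight R z)"
  shows "\<bar>D R s\<bar> \<le> flux_const * (LBINT z. norm (V (z, s)) ^ 3 * weight R z)"
proof -
  define v where "v y = V (y, s)" for y
  define u where "u y = 4 / R * psi R y * (y \<bullet> v y)" for y
  have vc: "continuous_on UNIV v" unfolding v_def by (rule continuous_slices)
  have uc: "continuous_on UNIV u"
    unfolding u_def using R by (intro continuous_intros vc psi_continuous) auto
  have u_supp: "norm y \<le> R" if "u y \<noteq> 0" for y using that psi_supp[OF R] by (auto simp: u_def)
  have u_le: "\<bar>u y\<bar> \<le> 4 * norm (v y)" for y
  proof (cases "psi R y = 0")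
    case False
    then have y: "norm y \<le> R" by (rule psi_supp[OF R])
    have "\<bar>y \<bullet> v y\<bar> \<le> R * norm (v y)"
      by (rule order_trans[OF Cauchy_Schwarz_ineq2]) (intro mult_right_mono y norm_ge_zero)
    then have "psi R y * \<bar>y \<bullet> v y\<bar> \<le> 1 * (R * norm (v y))"
      by (intro mult_mono psi_le) (use R in auto)
    then have "4 / R * (psi R y * \<bar>y \<bullet> v y\<bar>) \<le> 4 / R * (R * norm (v y))"
      using R by (intro mult_left_mono) auto
    then show ?thesis using R psi_nonneg[of R y] by (simp add: u_def abs_mult mult.assoc)
  qed (simp add: u_def)
  interpret velocity_slice v u R
  proof unfold_locales
    show "\<exists>L. \<forall>x\<in>cball 0 (2 * R). \<forall>y\<in>cball 0 (2 * R). norm (v x - v y) \<le> L * norm (x - y)"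
      unfolding v_def by (rule blinfun_local_lipschitz[OF vd_derivative continuous_slices(1)])
    show "u \<in> borel_measurable borel" using uc by (rule borel_measurable_continuous_onI)
    show "integrable lborel (\<lambda>z. norm (v z) ^ 3 * weight R z)" using W by (simp add: v_def)
  qed (use R vc u_supp u_le in auto)
  have pc: "continuous_on UNIV (\<lambda>y. P (y, s))" by (rule continuous_slices)
  have Ip: "integrable lborel (\<lambda>y. u y * P (y, s))"
    by (rule integral_compact_support(1)[where R=R]) (use u_supp in \<open>auto intro!: continuous_intros uc pc\<close>)
  have Iq: "integrable lborel (\<lambda>y. u y * ((v y \<bullet> v y) / 2))"
    by (rule integral_compact_support(1)[where R=R]) (use u_supp in \<open>auto intro!: continuous_intros uc vc\<close>)
  have 1: "\<bar>LBINT y. u y * P (y, s)\<bar> \<le> (603000 + 1260 * ball_const) * (R * W)"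
    using pressure unfolding pressure_given_by_def by (intro pressure_pairing[OF Ip]) (simp add: v_def)
  have 2: "\<bar>LBINT y. u y * ((v y \<bullet> v y) / 2)\<bar> \<le> 10 * (R * W)"
  proof -
    have "\<bar>LBINT y. u y * ((v y \<bullet> v y) / 2)\<bar> \<le> (LBINT y. \<bar>u y * ((v y \<bullet> v y) / 2)\<bar>)"
      by (rule integral_abs_bound)
    also have "\<dots> \<le> (LBINT y. 2 * (indicator (cball 0 (2 * R)) y * norm (v y) ^ 3))"
    proof (intro integral_mono integrable_abs Iq integrable_mult_right Q_int)
      fix y
      show "\<bar>u y * ((v y \<bullet> v y) / 2)\<bar> \<le> 2 * (indicator (cball 0 (2 * R)) y * norm (v y) ^ 3)"
      proof (cases "u y = 0")
        case False
        then have "norm y \<le> 2 * R" using u_supp[of y] R by simp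
        moreover have "\<bar>u y\<bar> * ((v y \<bullet> v y) / 2) \<le> 4 * norm (v y) * ((v y \<bullet> v y) / 2)"
          by (intro mult_right_mono u_le) auto
        moreover have "4 * norm (v y) * ((v y \<bullet> v y) / 2) = 2 * norm (v y) ^ 3"
          by (simp add: power2_norm_eq_inner[symmetric] power3_eq_cube power2_eq_square)
        ultimately show ?thesis by (simp add: abs_mult)
      qed simp
    qed
    also have "\<dots> = 2 * Q" by (simp add: Q_def)
    also have "\<dots> \<le> 10 * (R * W)" using Q_le_W by simp
    finally show ?thesis .
  qed
  have "D R s = (LBINT y. 1 / R * (u y * ((v y \<bullet> v y) / 2) + u y * P (y, s)))"
    unfolding D_def u_def v_def using R
    by (intro Bochner_Integration.integral_cong refl) (simp add: power2_eq_square distrib_left)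
  also have "\<dots> = 1 / R * ((LBINT y. u y * ((v y \<bullet> v y) / 2)) + (LBINT y. u y * P (y, s)))"
    using Ip Iq by (subst integral_mult_right_zero, subst Bochner_Integration.integral_add) auto
  also have "\<bar>\<dots>\<bar> \<le> 1 / R * (10 * (R * W) + (603000 + 1260 * ball_const) * (R * W))"
    unfolding abs_mult using R by (intro mult_mono order_trans[OF abs_triangle_ineq] add_mono 1 2) auto
  also have "\<dots> = flux_const * W" using R by (simp add: flux_const_def field_simps)
  finally show ?thesis by (simp add: W_def v_def)
qed

section \<open>Large radii and the vanishing of the solution\<close>

text \<open>For almost every time the slice lies in L^r; there the weighted cube tends to 0 and is
  dominated by the cube of the L^r norm, which is integrable in time. The radii \<open>Suc n\<close>
  are at least 1, as the uniform bound requires.\<close>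

lemma flux_limit:
  assumes r: "3 \<le> r" "r \<le> 9/2" and L: "in_Lp_Lq 3 r S V"
  shows "(\<lambda>n. integral {0..S} (D (real (Suc n)))) \<longlonglongrightarrow> 0"
proof (rule time_integral_limit)
  show "continuous_on UNIV (D (real (Suc n)))" for n by (rule continuous_ABD) simp
  define g where "g s = Lq_norm r (\<lambda>y. V (y, s)) powr 3" for s
  show "set_integrable lborel {0<..<S} (\<lambda>s. flux_const * (1 + weight_const) * g s)"
    using L unfolding in_Lp_Lq_def g_def by (intro set_integrable_mult_right) auto
  have g_eq: "g s = (LBINT y. norm (V (y, s)) powr r) powr (3 / r)" for s
    by (simp add: g_def Lq_norm_def powr_powr)
  have "AE s in lborel. s \<in> {0<..<S} \<longrightarrow> integrable lborel (\<lambda>y. norm (V (y, s)) powr r)"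
    using L by (simp add: in_Lp_Lq_def)
  then show "AE s in lborel. s \<in> {0<..<S} \<longrightarrow> (\<forall>n. \<bar>D (real (Suc n)) s\<bar> \<le> flux_const * (1 + weight_const) * g s)
      \<and> (\<lambda>n. D (real (Suc n)) s) \<longlonglongrightarrow> 0"
  proof (eventually_elim, intro impI)
    fix s assume "s \<in> {0<..<S} \<longrightarrow> integrable lborel (\<lambda>y. norm (V (y, s)) powr r)" "s \<in> {0<..<S}"
    then have int: "integrable lborel (\<lambda>y. norm (V (y, s)) powr r)" by simp
    have nc: "continuous_on UNIV (\<lambda>y. norm (V (y, s)))" by (intro continuous_intros continuous_slices)
    then have nm: "(\<lambda>y. norm (V (y, s))) \<in> borel_measurable borel" by (rule borel_measurable_continuous_onI)
    have R: "1 \<le> real (Suc n)" "0 < real (Suc n)" for n by auto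
    note WB = weighted_cube_integral[OF nm norm_ge_zero r int R(1)]
    have le: "\<bar>D (real (Suc n)) s\<bar> \<le> flux_const * (LBINT z. norm (V (z, s)) ^ 3 * weight (real (Suc n)) z)" for n
      by (rule D_bound[OF R(2) WB(1)])
    have "((\<lambda>R. LBINT z. norm (V (z, s)) ^ 3 * weight R z) \<longlongrightarrow> 0) at_top"
      by (rule weighted_cube_limit[OF nc norm_ge_zero r int])
    moreover have "filterlim (\<lambda>n. real (Suc n)) at_top sequentially"
      by (rule filterlim_compose[OF filterlim_real_sequentially filterlim_Suc])
    ultimately have "(\<lambda>n. LBINT z. norm (V (z, s)) ^ 3 * weight (real (Suc n)) z) \<longlonglongrightarrow> 0"
      by (rule filterlim_compose)
    then have lim: "(\<lambda>n. flux_const * (LBINT z. norm (V (z, s)) ^ 3 * weight (real (Suc n)) z)) \<longlonglongrightarrow> 0"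
      by (rule tendsto_mult_right_zero)
    have "\<bar>D (real (Suc n)) s\<bar> \<le> flux_const * (1 + weight_const) * g s" for n
      using order_trans[OF le mult_left_mono[OF WB(2) flux_const_nonneg]] by (simp add: g_eq mult.assoc)
    moreover have "(\<lambda>n. D (real (Suc n)) s) \<longlonglongrightarrow> 0"
      by (rule Lim_null_comparison[OF _ lim]) (use le in auto)
    ultimately show "(\<forall>n. \<bar>D (real (Suc n)) s\<bar> \<le> flux_const * (1 + weight_const) * g s)
      \<and> (\<lambda>n. D (real (Suc n)) s) \<longlonglongrightarrow> 0" by blast
  qed
qed

text \<open>The factor 4/R^2 psi |y|^2 is at most 4 on the support of psi and of order R^(-2) at a
  fixed point. Dominated convergence applies first in space, then in time.\<close>

lemma drift_limit:
  assumes L: "in_Lp_Lq 2 2 S V"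
  shows "(\<lambda>n. integral {0..S} (B (real (Suc n)))) \<longlonglongrightarrow> 0"
proof (rule time_integral_limit)
  show "continuous_on UNIV (B (real (Suc n)))" for n by (rule continuous_ABD) simp
  define g where "g s = Lq_norm 2 (\<lambda>y. V (y, s)) powr 2" for s
  show "set_integrable lborel {0<..<S} (\<lambda>s. 2 * g s)"
    using L unfolding in_Lp_Lq_def g_def by (intro set_integrable_mult_right) auto
  have "AE s in lborel. s \<in> {0<..<S} \<longrightarrow> integrable lborel (\<lambda>y. norm (V (y, s)) powr 2)"
    using L by (simp add: in_Lp_Lq_def)
  then show "AE s in lborel. s \<in> {0<..<S} \<longrightarrow> (\<forall>n. \<bar>B (real (Suc n)) s\<bar> \<le> 2 * g s)
      \<and> (\<lambda>n. B (real (Suc n)) s) \<longlonglongrightarrow> 0"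
  proof (eventually_elim, intro impI)
    fix s assume "s \<in> {0<..<S} \<longrightarrow> integrable lborel (\<lambda>y. norm (V (y, s)) powr 2)" "s \<in> {0<..<S}"
    then have int: "integrable lborel (\<lambda>y. (norm (V (y, s)))\<^sup>2)" by simp
    have int2: "integrable lborel (\<lambda>y. 2 * (norm (V (y, s)))\<^sup>2)" using int by simp
    have g_eq: "g s = (LBINT y. (norm (V (y, s)))\<^sup>2)"
      by (simp add: g_def Lq_norm_def powr_powr integral_nonneg_AE)
    define k where "k n y = 4 / (real (Suc n))\<^sup>2 * psi (real (Suc n)) y * (y \<bullet> y) * ((V (y, s) \<bullet> V (y, s)) / 2)" for n y
    have B_k: "B (real (Suc n)) s = (LBINT y. k n y)" for n by (simp add: B_def k_def)
    have kc: "continuous_on UNIV (k n)" for n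
      unfolding k_def by (intro continuous_intros psi_continuous continuous_slices) auto
    then have km [measurable]: "k n \<in> borel_measurable borel" for n by (rule borel_measurable_continuous_onI)
    have ki: "integrable lborel (k n)" for n
      by (rule integral_compact_support(1)[OF kc, of n "real (Suc n)"]) (use psi_supp in \<open>auto simp: k_def\<close>)
    have k0: "0 \<le> k n y" for n y
      unfolding k_def by (intro mult_nonneg_nonneg divide_nonneg_nonneg psi_nonneg) auto
    have kle: "k n y \<le> 2 * (norm (V (y, s)))\<^sup>2" for n y
    proof (cases "psi (real (Suc n)) y = 0")
      case False
      then have "norm y \<le> real (Suc n)" by (intro psi_supp) auto
      then have "(norm y)\<^sup>2 \<le> (real (Suc n))\<^sup>2" by (intro power_mono) auto
      then have "psi (real (Suc n)) y * (y \<bullet> y) \<le> 1 * (real (Suc n))\<^sup>2"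
        by (intro mult_mono psi_le) (auto simp: power2_norm_eq_inner)
      then have "2 / (real (Suc n))\<^sup>2 * (psi (real (Suc n)) y * (y \<bullet> y)) \<le> 2 / (real (Suc n))\<^sup>2 * (real (Suc n))\<^sup>2"
        by (intro mult_left_mono) auto
      then have "2 / (real (Suc n))\<^sup>2 * (psi (real (Suc n)) y * (y \<bullet> y)) * (V (y, s) \<bullet> V (y, s)) \<le> 2 * (V (y, s) \<bullet> V (y, s))"
        by (intro mult_right_mono) auto
      then show ?thesis by (simp add: k_def power2_norm_eq_inner mult_ac)
    qed (simp add: k_def)
    have "\<bar>B (real (Suc n)) s\<bar> \<le> 2 * g s" for n
    proof -
      have "(LBINT y. k n y) \<le> (LBINT y. 2 * (norm (V (y, s)))\<^sup>2)"
        by (intro integral_mono ki int2 kle)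
      then show ?thesis using B_nonneg[of "real (Suc n)" s] unfolding B_k g_eq by simp
    qed
    moreover have "(\<lambda>n. LBINT y. k n y) \<longlonglongrightarrow> integral\<^sup>L lborel (\<lambda>y::real^3. 0::real)"
    proof (rule integral_dominated_convergence[OF _ _ int2])
      show "AE y in lborel. norm (k n y) \<le> 2 * (norm (V (y, s)))\<^sup>2" for n
        using k0 kle by (intro AE_I2) simp
      show "AE y in lborel. (\<lambda>n. k n y) \<longlonglongrightarrow> 0"
      proof (rule AE_I2)
        fix y :: "real^3"
        \<comment> \<open>The integrand without psi and without 1/R^2.\<close>
        define C where "C = 4 * ((y \<bullet> y) * ((V (y, s) \<bullet> V (y, s)) / 2))"
        have C0: "0 \<le> C" by (simp add: C_def)
        have "(\<lambda>n. C * (inverse (real (Suc n)))\<^sup>2) \<longlonglongrightarrow> C * 0\<^sup>2"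
          by (intro tendsto_intros LIMSEQ_inverse_real_of_nat)
        then have lim: "(\<lambda>n. C * (inverse (real (Suc n)))\<^sup>2) \<longlonglongrightarrow> 0" by simp
        have "norm (k n y) \<le> C * (inverse (real (Suc n)))\<^sup>2" for n
        proof -
          have eq: "k n y = psi (real (Suc n)) y * (C * (inverse (real (Suc n)))\<^sup>2)"
            by (simp add: k_def C_def inverse_eq_divide power_divide)
          have "psi (real (Suc n)) y * (C * (inverse (real (Suc n)))\<^sup>2) \<le> 1 * (C * (inverse (real (Suc n)))\<^sup>2)"
            using C0 by (intro mult_right_mono psi_le) auto
          then show ?thesis using k0[of n y] eq by simp
        qed
        then show "(\<lambda>n. k n y) \<longlonglongrightarrow> 0" by (intro Lim_null_comparison[OF _ lim]) auto
      qed
    qed measurable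
    then have "(\<lambda>n. B (real (Suc n)) s) \<longlonglongrightarrow> 0" unfolding B_k by simp
    ultimately show "(\<forall>n. \<bar>B (real (Suc n)) s\<bar> \<le> 2 * g s) \<and> (\<lambda>n. B (real (Suc n)) s) \<longlonglongrightarrow> 0" by blast
  qed
qed

text \<open>The period integral of \<open>A R\<close> is nonnegative and increases with
  \<open>R\<close>, so a zero limit forces it to vanish for every \<open>R\<close>. Continuity in
  time and then in space makes the integrand vanish at each point of a period, and periodicity does
  the rest.\<close>

lemma vanishing:
  assumes lim: "(\<lambda>n. integral {0..S} (A (real (Suc n)))) \<longlonglongrightarrow> 0"
  shows "V (y, s) = 0"
proof -
  have zero: "V (y, s) = 0" if s: "s \<in> {0..S}" for y s
  proof -
    \<comment> \<open>The point \<open>y\<close> then lies in the open ball where the cutoff is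
      positive.\<close>
    define R where "R = norm y + 1"
    have R: "0 < R" by (simp add: R_def add_nonneg_pos)
    note ci = integrable_ABD(1)
    have "integral {0..S} (A R) \<le> 0"
    proof (rule LIMSEQ_le_const[OF lim])
      obtain N :: nat where N: "R < real N" using reals_Archimedean2 by blast
      have "integral {0..S} (A R) \<le> integral {0..S} (A (real (Suc n)))" if "N \<le> n" for n
      proof -
        have "real N \<le> real (Suc n)" using that by simp
        then have "R \<le> real (Suc n)" using N by linarith
        then show ?thesis using R by (intro integral_le ci A_mono) auto
      qed
      then show "\<exists>N. \<forall>n\<ge>N. integral {0..S} (A R) \<le> integral {0..S} (A (real (Suc n)))" by blast
    qed
    moreover have "0 \<le> integral {0..S} (A R)" by (intro integral_nonneg ci R A_nonneg)
    ultimately have "integral {0..S} (A R) = 0" by simp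
    then have "A R s = 0"
      using integral_eq_0_iff[of 0 S "A R"] continuous_on_subset[OF continuous_ABD(1)[OF R]] S s A_nonneg by auto
    then have 0: "integral (cube R) (\<lambda>y. (V (y, s) \<bullet> V (y, s)) / 2 * cutoff R y) = 0"
      by (simp add: A_cube[OF R])
    have yR: "\<bar>y $ i\<bar> < R" for i using component_le_norm_cart[of y i] by (simp add: R_def)
    have ybox: "y \<in> box (- (\<chi> i. R)) (\<chi> i. R)"
      unfolding mem_box_cart using yR by (auto simp: abs_less_iff minus_less_iff)
    have "(V (y, s) \<bullet> V (y, s)) / 2 * cutoff R y = 0"
    proof -
      have "\<forall>x\<in>cube R. (V (x, s) \<bullet> V (x, s)) / 2 * cutoff R x = 0"
        using 0 ybox unfolding cube_def
        by (subst (asm) integral_cbox_eq_0_iff)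
           (auto intro!: continuous_intros psi_continuous continuous_on_subset[OF continuous_slices(4)] simp: cutoff_def)
      moreover have "y \<in> cube R" unfolding cube_def using ybox box_subset_cbox by blast
      ultimately show ?thesis by blast
    qed
    moreover have "cutoff R y \<noteq> 0"
    proof -
      have "(norm y)\<^sup>2 < R\<^sup>2" by (intro power_strict_mono) (auto simp: R_def)
      then have "(norm y)\<^sup>2 / R\<^sup>2 < 1" using R by simp
      then have "0 < psi R y" by (simp only: psi_def)
      then show ?thesis by (simp add: cutoff_def)
    qed
    ultimately show ?thesis by simp
  qed
  have shift: "V (y, s + real n * S) = V (y, s)" for n s
  proof (induction n)
    case (Suc n)
    have "V (y, s + real (Suc n) * S) = V (y, (s + real n * S) + S)" by (simp add: algebra_simps)
    then show ?case using Suc periodic_V by simp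
  qed simp
  \<comment> \<open>\<open>k\<close> may be negative; \<open>shift\<close>, which moves by a natural
    number of periods, then starts from \<open>s\<close> instead of \<open>s'\<close>.\<close>
  define k where "k = \<lfloor>s / S\<rfloor>"
  define s' where "s' = s - of_int k * S"
  have "of_int k \<le> s / S" "s / S < of_int k + 1" unfolding k_def by linarith+
  then have s': "s' \<in> {0..S}" using S by (auto simp: s'_def field_simps)
  have "V (y, s) = V (y, s')"
  proof (cases "0 \<le> k")
    case True
    then show ?thesis using shift[of s' "nat k"] by (simp add: s'_def)
  next
    case False
    then show ?thesis using shift[of s "nat (- k)"] by (simp add: s'_def)
  qed
  then show ?thesis using zero[OF s'] by simp
qed

text \<open>The coefficient \<open>c\<close> is positive and the \<open>B\<close> term is
  nonnegative, so \<open>A\<close> is bounded by the flux alone.\<close>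

lemma vanishing_fast:
  assumes "\<alpha> > 3/2" "3 \<le> r" "r \<le> 9/2" "in_Lp_Lq 3 r S V"
  shows "V (y, s) = 0"
proof (rule vanishing)
  define c where "c = (2 * \<alpha> - 3) / (\<alpha> + 1)"
  have c: "0 < c" using assms(1) by (simp add: c_def)
  have lim: "(\<lambda>n. \<bar>integral {0..S} (D (real (Suc n)))\<bar> / c) \<longlonglongrightarrow> \<bar>0\<bar> / c"
    using c by (intro tendsto_intros flux_limit[OF assms(2-4)]) auto
  have i: "A (real (Suc n)) integrable_on {0..S}" "B (real (Suc n)) integrable_on {0..S}" for n
    by (rule integrable_ABD, simp)+
  have nn: "0 \<le> integral {0..S} (A (real (Suc n)))" "0 \<le> integral {0..S} (B (real (Suc n)))" for n
    by (intro integral_nonneg i A_nonneg B_nonneg)+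
  have "integral {0..S} (A (real (Suc n))) \<le> \<bar>integral {0..S} (D (real (Suc n)))\<bar> / c" for n
  proof -
    have "c * integral {0..S} (A (real (Suc n))) + 1 / (\<alpha> + 1) * integral {0..S} (B (real (Suc n))) + integral {0..S} (D (real (Suc n))) = 0"
      unfolding c_def by (rule energy_balance) simp
    moreover have "0 \<le> 1 / (\<alpha> + 1) * integral {0..S} (B (real (Suc n)))"
      using nn(2)[of n] \<alpha> by (intro mult_nonneg_nonneg) auto
    ultimately have "c * integral {0..S} (A (real (Suc n))) \<le> \<bar>integral {0..S} (D (real (Suc n)))\<bar>" by linarith
    then show ?thesis using c by (simp add: field_simps)
  qed
  then have "\<forall>\<^sub>F n in sequentially. norm (integral {0..S} (A (real (Suc n)))) \<le> \<bar>integral {0..S} (D (real (Suc n)))\<bar> / c"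
    using nn(1) by (intro always_eventually) simp
  moreover have "(\<lambda>n. \<bar>integral {0..S} (D (real (Suc n)))\<bar> / c) \<longlonglongrightarrow> 0" using lim by simp
  ultimately show "(\<lambda>n. integral {0..S} (A (real (Suc n)))) \<longlonglongrightarrow> 0"
    by (rule Lim_null_comparison)
qed

text \<open>The coefficient \<open>c\<close> is negative, so the sign of \<open>B\<close> does not
  help; the balance is solved for \<open>A\<close>, and both other terms tend to zero.\<close>

lemma vanishing_slow:
  assumes "\<alpha> < 3/2" "3 \<le> r" "r \<le> 9/2" "in_Lp_Lq 3 r S V" "in_Lp_Lq 2 2 S V"
  shows "V (y, s) = 0"
proof (rule vanishing)
  define c where "c = (2 * \<alpha> - 3) / (\<alpha> + 1)"
  have c: "c \<noteq> 0" using assms(1) \<alpha> by (simp add: c_def)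
  have eq: "integral {0..S} (A (real (Suc n)))
      = - (1 / (\<alpha> + 1) * integral {0..S} (B (real (Suc n))) + integral {0..S} (D (real (Suc n)))) / c" for n
  proof -
    have "c * integral {0..S} (A (real (Suc n))) + 1 / (\<alpha> + 1) * integral {0..S} (B (real (Suc n))) + integral {0..S} (D (real (Suc n))) = 0"
      unfolding c_def by (rule energy_balance) simp
    then have "c * integral {0..S} (A (real (Suc n)))
      = - (1 / (\<alpha> + 1) * integral {0..S} (B (real (Suc n))) + integral {0..S} (D (real (Suc n))))" by linarith
    then show ?thesis using c by (simp add: eq_divide_eq mult.commute)
  qed
  have "(\<lambda>n. - (1 / (\<alpha> + 1) * integral {0..S} (B (real (Suc n))) + integral {0..S} (D (real (Suc n)))) / c)
     \<longlonglongrightarrow> - (1 / (\<alpha> + 1) * 0 + 0) / c"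
    by (intro tendsto_intros flux_limit[OF assms(2-4)] drift_limit[OF assms(5)] c)
  then show "(\<lambda>n. integral {0..S} (A (real (Suc n)))) \<longlonglongrightarrow> 0" unfolding eq by simp
qed

end

theorem theorem3p1:
  fixes \<alpha> S\<^sub>0 :: real
    and V :: "(real^3) \<times> real \<Rightarrow> real^3"
    and P :: "(real^3) \<times> real \<Rightarrow> real"
  assumes "\<alpha> > -1"
    and "S\<^sub>0 > 0"
    and "C1_on_space V" and "C1_on_space P"
    and "time_periodic S\<^sub>0 V" and "time_periodic S\<^sub>0 P"
    and "solves_self_similar_Euler \<alpha> V P"
    and "pressure_given_by V P"
    and "\<exists>r. 3 \<le> r \<and> r \<le> 9 / 2 \<and>
           ((\<alpha> > 3 / 2 \<and> in_Lp_Lq 3 r S\<^sub>0 V) \<or>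
            (-1 < \<alpha> \<and> \<alpha> < 3 / 2 \<and> in_Lp_Lq 2 2 S\<^sub>0 V \<and> in_Lp_Lq 3 r S\<^sub>0 V))"
  shows "\<forall>y s. V (y, s) = 0"
proof -
  obtain V' where V': "\<And>x. (V has_derivative blinfun_apply (V' x)) (at x)" "continuous_on UNIV V'"
    using assms(3) unfolding C1_on_space_def by blast
  obtain P' where P': "\<And>x. (P has_derivative blinfun_apply (P' x)) (at x)" "continuous_on UNIV P'"
    using assms(4) unfolding C1_on_space_def by blast
  interpret periodic_solution \<alpha> S\<^sub>0 V P V' P'
    by unfold_locales (fact assms V' P')+
  from assms(9) show ?thesis using vanishing_fast vanishing_slow by metis
qed

end
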